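(* Let $f\in\mathbb{C}[z_1,z_2]$ be a polynomial that does not vanish on $\mathbb{D}^2$, and let $\mathcal{Z}(f)$ denote its zero set. Then: (a) If $f$ vanishes on $\mathbb{T}^2$ at finitely many points (and at least one), then $f$ is cyclic in $\mathcal{D}_\beta(\mathbb{D}^2)$ for $\beta\le 3/2$, and non-cyclic for $\beta>2$. (b) If $\dim(\mathcal{Z}(f)\cap\mathbb{T}^2)=1$, then $f$ is cyclic in $\mathcal{D}_\beta(\mathbb{D}^2)$ if and only if $\beta\le 1$. (c) For $\beta>2$, $f$ is cyclic in $\mathcal{D}_\beta(\mathbb{D}^2)$ if and only if $f$ does not vanish on $\overline{\mathbb{D}}^2$.
   Context: $\mathbb{D}^2$ is the open unit bidisk in $\mathbb{C}^2$, $\mathbb{T}^2=\{|z_1|=|z_2|=1\}$ its distinguished boundary, and $\dim$ denotes real dimension. For $\beta\in\mathbb{R}$, $\mathcal{D}_\beta(\mathbb{D}^2)$ is the Hilbert space of holomorphic functions $f(z)=\sum_{L}a_Lz^L$ on $\mathbb{D}^2$ (sum over multi-indices $L=(l_1,l_2)$ of nonnegative integers, $|L|=l_1+l_2$) with $$\|f\|^2_{\mathcal{D}_\beta(\mathbb{D}^2)}=\sum_L|a_L|^2(|L|+2)^\beta<\infty .$$ (This is the Poletsky–Stessin weighted Bergman space $A^2_{u,\alpha}(\mathbb{D}^2)$ with $u(z)=\log\max\{|z_1|,|z_2|\}$ and $\beta=-(\alpha+1)$.) A function $f\in\mathcal{D}_\beta(\mathbb{D}^2)$ is called cyclic if the closure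 in $\mathcal{D}_\beta(\mathbb{D}^2)$ of $\{pf:p\in\mathbb{C}[z_1,z_2]\}$ is all of $\mathcal{D}_\beta(\mathbb{D}^2)$. *)

theory Defs
  imports
    "HOL-Analysis.Analysis"
    "HOL-Complex_Analysis.Complex_Analysis"
    "HOL-Computational_Algebra.Computational_Algebra"
begin

definition bidisk :: "(complex \<times> complex) set" where
  "bidisk = ball 0 1 \<times> ball 0 1"

definition closed_bidisk :: "(complex \<times> complex) set" where
  "closed_bidisk = cball 0 1 \<times> cball 0 1"

definition torus2 :: "(complex \<times> complex) set" where
  "torus2 = sphere 0 1 \<times> sphere 0 1"

(* The ring C[z1,z2] is rendered as (C[z1])[z2]: coeff (coeff p n) m is the
   coefficient of z1^m z2^n. *)
definition eval2 :: "complex poly poly \<Rightarrow> complex \<times> complex \<Rightarrow> complex" where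
  "eval2 p z = poly (poly p [:snd z:]) (fst z)"

definition zero_set :: "complex poly poly \<Rightarrow> (complex \<times> complex) set" where
  "zero_set p = {z. eval2 p z = 0}"

(* f is holomorphic on the bidisk with power series sum a_L z^L there; the
   unordered (absolutely convergent) sum ranges over all multi-indices. *)
definition has_expansion ::
    "(nat \<times> nat \<Rightarrow> complex) \<Rightarrow> (complex \<times> complex \<Rightarrow> complex) \<Rightarrow> bool" where
  "has_expansion a f \<longleftrightarrow>
     (\<forall>z\<in>bidisk. ((\<lambda>L. a L * (fst z ^ fst L * snd z ^ snd L)) has_sum f z) UNIV)"

lemma has_expansion_unique:
  assumes "has_expansion a f" "has_expansion b f"
  shows "a = b"
proof -
  define c where "c L = a L - b L" for L
  have sum0: "((\<lambda>(m, n). c (m, n) * (z ^ m * w ^ n)) has_sum 0) (UNIV \<times> UNIV)"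
    if "norm z < 1" "norm w < 1" for z w
  proof -
    have "(z, w) \<in> bidisk"
      using that by (simp add: bidisk_def)
    then have "((\<lambda>L. a L * (z ^ fst L * w ^ snd L)) has_sum f (z, w)) UNIV"
      and "((\<lambda>L. b L * (z ^ fst L * w ^ snd L)) has_sum f (z, w)) UNIV"
      using assms unfolding has_expansion_def by force+
    then have "((\<lambda>L. a L * (z ^ fst L * w ^ snd L) + - (b L * (z ^ fst L * w ^ snd L))) has_sum
                 (f (z, w) + - f (z, w))) UNIV"
      by (intro has_sum_add has_sum_uminusI)
    then show ?thesis
      by (simp add: c_def algebra_simps case_prod_unfold)
  qed
  have zero: "d = (\<lambda>_. 0)"
    if *: "\<And>z. norm z < 1 \<Longrightarrow> (\<lambda>n. d n * z ^ n) sums 0" for d :: "nat \<Rightarrow> complex"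
  proof (rule ccontr)
    assume "d \<noteq> (\<lambda>_. 0)"
    then obtain m where m: "d m \<noteq> 0" by auto
    have d0: "d 0 = 0"
      using *[of 0] by simp
    then have "m > 0"
      using m by (cases m) auto
    show False
    proof (rule powser_0_nonzero[of 1 0 d "\<lambda>_. 0" m])
      fix s :: real
      assume s: "0 < s" and "\<And>z. z \<in> cball 0 s - {0::complex} \<Longrightarrow> (0::complex) \<noteq> 0"
      from this(2)[of "of_real s"] show False
        using s by simp
    qed (use * m \<open>m > 0\<close> in auto)
  qed
  have inner: "(\<lambda>n. c (m, n) * w ^ n) summable_on UNIV" if "norm w < 1" for m w
  proof -
    have "(\<lambda>(m, n). c (m, n) * ((1 / 2) ^ m * w ^ n)) summable_on (UNIV \<times> UNIV)"
      using sum0[of "1 / 2" w] that by (auto simp: summable_on_def norm_divide)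
    from summable_on_SigmaD1[OF this, of m]
    have "(\<lambda>n. (1 / 2) ^ m * (c (m, n) * w ^ n)) summable_on UNIV"
      by (simp add: mult_ac)
    then have "(\<lambda>n. 2 ^ m * ((1 / 2) ^ m * (c (m, n) * w ^ n))) summable_on UNIV"
      by (rule summable_on_cmult_right)
    then show ?thesis
      by (simp add: power_divide)
  qed
  have "(\<lambda>n. c (m, n)) = (\<lambda>_. 0)" for m
  proof (rule zero)
    fix w :: complex
    assume w: "norm w < 1"
    define d where "d m = infsum (\<lambda>n. c (m, n) * w ^ n) UNIV" for m
    have d: "((\<lambda>n. c (m, n) * w ^ n) has_sum d m) UNIV" for m
      using inner[OF w] unfolding d_def by (rule has_sum_infsum)
    have "d = (\<lambda>_. 0)"
    proof (rule zero)
      fix z :: complex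
      assume z: "norm z < 1"
      have "((\<lambda>m. d m * z ^ m) has_sum 0) UNIV"
      proof (rule has_sum_SigmaD[OF sum0[OF z w]])
        fix m
        have "((\<lambda>n. z ^ m * (c (m, n) * w ^ n)) has_sum (z ^ m * d m)) UNIV"
          by (rule has_sum_cmult_right[OF d])
        then show "((\<lambda>n. (case (m, n) of (m, n) \<Rightarrow> c (m, n) * (z ^ m * w ^ n)))
                     has_sum (d m * z ^ m)) UNIV"
          by (simp add: mult_ac)
      qed
      then show "(\<lambda>m. d m * z ^ m) sums 0"
        by (rule has_sum_imp_sums)
    qed
    then show "(\<lambda>n. c (m, n) * w ^ n) sums 0"
      using d[of m] by (simp add: has_sum_imp_sums)
  qed
  then have "c (m, n) = 0" for m n
    by (meson fun_cong)
  then show ?thesis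
    by (auto simp: c_def)
qed

definition power_coeffs :: "(complex \<times> complex \<Rightarrow> complex) \<Rightarrow> nat \<times> nat \<Rightarrow> complex" where
  "power_coeffs f = (THE a. has_expansion a f)"

lemma power_coeffs_eq: "has_expansion a f \<Longrightarrow> power_coeffs f = a"
  unfolding power_coeffs_def using has_expansion_unique by (intro the_equality)

definition dirichlet_term ::
    "real \<Rightarrow> (complex \<times> complex \<Rightarrow> complex) \<Rightarrow> nat \<times> nat \<Rightarrow> real" where
  "dirichlet_term \<beta> f L =
     (norm (power_coeffs f L))\<^sup>2 * (real (fst L + snd L) + 2) powr \<beta>"

(* Elements are functions on all of C^2; only their values on the bidisk matter
   here and in all definitions below. *)
definition dirichlet_space :: "real \<Rightarrow> (complex \<times> complex \<Rightarrow> complex) set" where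
  "dirichlet_space \<beta> = {f. (\<exists>a. has_expansion a f) \<and> dirichlet_term \<beta> f summable_on UNIV}"

definition dirichlet_norm :: "real \<Rightarrow> (complex \<times> complex \<Rightarrow> complex) \<Rightarrow> real" where
  "dirichlet_norm \<beta> f = sqrt (infsum (dirichlet_term \<beta> f) UNIV)"

(* Approximants are restricted to the space because infsum, hence dirichlet_norm,
   is 0 on functions whose series diverges. *)
definition dirichlet_closure ::
    "real \<Rightarrow> (complex \<times> complex \<Rightarrow> complex) set \<Rightarrow> (complex \<times> complex \<Rightarrow> complex) set" where
  "dirichlet_closure \<beta> S =
     {g \<in> dirichlet_space \<beta>.
        \<forall>\<epsilon>>0. \<exists>h \<in> S \<inter> dirichlet_space \<beta>. dirichlet_norm \<beta> (\<lambda>z. g z - h z) < \<epsilon>}"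

definition cyclic :: "real \<Rightarrow> (complex \<times> complex \<Rightarrow> complex) \<Rightarrow> bool" where
  "cyclic \<beta> f \<longleftrightarrow>
     f \<in> dirichlet_space \<beta> \<and>
     dirichlet_closure \<beta> (range (\<lambda>p z. eval2 p z * f z)) = dirichlet_space \<beta>"

(* The real dimension of a semialgebraic set: the largest d such that the set
   contains a homeomorphic copy of the open unit ball of R^d, or -1 for the empty
   set. The model ball of R^d is taken inside a d-dimensional linear subspace of
   the ambient space, so that d can be a number rather than a type. *)
definition real_dim :: "'a::euclidean_space set \<Rightarrow> int" where
  "real_dim S =
     Max (insert (-1) {int (dim V) | (V :: 'a set) T.
            subspace V \<and> T \<subseteq> S \<and> (V \<inter> ball 0 1) homeomorphic T})"

end

theory Submission
  imports Defs
begin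

text \<open>
  The space of the theorem is a weighted l2 space of coefficient arrays, and multiplication by
  polynomials is bounded on it. So f is cyclic if and only if the constant 1 is a limit of polynomial
  multiples of f (\<open>cyclic_iff_in_closure\<close>), and the three parts become statements about
  approximating 1.

  Non-cyclicity is shown by a bounded functional that kills every multiple of f but not 1. If
  \<open>\<beta> > 2\<close>, evaluation at a zero in the closed bidisk is bounded, because the sum of
  \<open>(|L| + 2) powr (- \<beta>)\<close> over all L converges. If the zero set meets the torus in a set
  that contains an arc, then the arc is connected, so one of its two coordinates, say the first, sweeps
  out a set of angles s of positive measure. A measurable choice \<open>\<phi> s\<close> of a second
  coordinate turns integration over these points into a functional whose value at the monomial
  \<open>(k, l)\<close> is a Fourier coefficient of index k of the bounded function
  \<open>cis (l * \<phi> s)\<close>. By Bessel's inequality the squares of these values have a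
  sum over k that is bounded independently of l, and the weight \<open>(l + 2) powr (- \<beta>)\<close>
  makes the double sum finite when \<open>\<beta> > 1\<close>.

  For \<open>\<beta> \<le> 1\<close> every f without zeros in the bidisk is cyclic. The approximants
  are \<open>f(z) / f(r z)\<close> with r tending to 1. They are bounded by a power of 2, because this
  holds along each complex line through 0 for each linear factor separately. For a fixed value
  of one variable they are rational functions of the other variable, of bounded degree n. The sum of
  \<open>(k + 1) |b k|^2\<close> over the coefficients of such a function is the squared Hilbert-Schmidt
  norm of the Hankel matrix \<open>b (i + j)\<close>. This matrix has rank at most \<open>n + 1\<close>, and
  its operator norm is at most the supremum of the function (\<open>rational_dirichlet_bound\<close>).
  Averaging over the other variable bounds the norm for \<open>\<beta> = 1\<close> of the
  approximants. Bounded sequences that converge coefficientwise converge weakly, and a weak limit of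
  elements of a closed subspace lies in it (\<open>in_closure_weak_limit\<close>).

  If f has only finitely many zeros \<open>\<zeta>\<close> on the torus, then f is compared with
  the product g of the model polynomials
  \<open>2 - cnj (fst \<zeta>) z1 - cnj (snd \<zeta>) z2\<close>. Let F be the reflection of f, so that
  \<open>|F| = |f|\<close> on the torus. A common component of f and F would have all its zeros over
  generic points of the circle on the torus, and so f would have infinitely many zeros there. Therefore
  the ideal of f and F contains a nonzero polynomial R in the first variable alone
  (\<open>elimination_polynomial\<close>), and \<open>|R| \<le> C |f|\<close> on the torus. This
  gives a Lojasiewicz inequality: some power of \<open>|g|\<close> is at most \<open>C |f|\<close>,
  on the torus and on all smaller tori (\<open>radial_domination\<close>). Hence for large M the
  quotient \<open>g ^ M / f\<close> has bounded first derivatives there and belongs to the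
  space for \<open>\<beta> = 2\<close>, so \<open>g ^ M\<close> is a limit of multiples of f. It remains to
  see that the model polynomial is cyclic for \<open>\<beta> = 3 / 2\<close>. With
  \<open>X = (z1 + z2) / 2\<close> (after a rotation) the squared norm of \<open>X ^ k\<close> is
  of order k, since the central binomial coefficient contributes a factor \<open>k powr (- 1 / 2)\<close>.
  So logarithmic averages of the powers \<open>X ^ k\<close> tend to 0, while 1 minus such an
  average is divisible by \<open>1 - X\<close>.
\<close>

section \<open>Weighted square-summable coefficient arrays\<close>

definition wt :: "real \<Rightarrow> nat \<times> nat \<Rightarrow> real" where
  "wt \<beta> L = (real (fst L + snd L) + 2) powr \<beta>"

definition in_l2 :: "real \<Rightarrow> (nat \<times> nat \<Rightarrow> complex) \<Rightarrow> bool" where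
  "in_l2 \<beta> a \<longleftrightarrow> (\<lambda>L. (norm (a L))\<^sup>2 * wt \<beta> L) summable_on UNIV"

text \<open>
  The square of the norm is used throughout. The inequality \<open>|a + b|^2 \<le> 2 |a|^2 + 2 |b|^2\<close>
  then replaces the triangle inequality. As an infinite sum, the value is meaningful only under
  \<open>in_l2\<close>.
\<close>
definition sqnorm :: "real \<Rightarrow> (nat \<times> nat \<Rightarrow> complex) \<Rightarrow> real" where
  "sqnorm \<beta> a = infsum (\<lambda>L. (norm (a L))\<^sup>2 * wt \<beta> L) UNIV"

lemma wt_pos [simp]: "wt \<beta> L > 0"
  by (simp add: wt_def add_nonneg_pos)

lemma wt_nonneg [simp]: "wt \<beta> L \<ge> 0"
  by (simp add: less_imp_le)

lemma wt_mono: "\<beta> \<le> \<beta>' \<Longrightarrow> wt \<beta> L \<le> wt \<beta>' L"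
  by (simp add: wt_def powr_mono)

lemma sqnorm_nonneg [simp]: "sqnorm \<beta> a \<ge> 0"
  unfolding sqnorm_def by (intro infsum_nonneg) simp

lemma in_l2_dominated:
  assumes "in_l2 \<beta> a" "\<And>L. (norm (b L))\<^sup>2 * wt \<gamma> L \<le> C * ((norm (a L))\<^sup>2 * wt \<beta> L)"
  shows "in_l2 \<gamma> b" "sqnorm \<gamma> b \<le> C * sqnorm \<beta> a"
proof -
  have *: "(\<lambda>L. C * ((norm (a L))\<^sup>2 * wt \<beta> L)) summable_on UNIV"
    using assms(1) unfolding in_l2_def by (rule summable_on_cmult_right)
  show b: "in_l2 \<gamma> b"
    unfolding in_l2_def by (rule summable_on_comparison_test[OF *]) (use assms in auto)
  have "sqnorm \<gamma> b \<le> infsum (\<lambda>L. C * ((norm (a L))\<^sup>2 * wt \<beta> L)) UNIV"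
    unfolding sqnorm_def by (rule infsum_mono) (use b * assms in \<open>auto simp: in_l2_def\<close>)
  also have "\<dots> = C * sqnorm \<beta> a"
    unfolding sqnorm_def using assms(1) by (intro infsum_cmult_right) (auto simp: in_l2_def)
  finally show "sqnorm \<gamma> b \<le> C * sqnorm \<beta> a" .
qed

lemma in_l2_bounded_sums:
  assumes "\<And>S. finite S \<Longrightarrow> (\<Sum>L\<in>S. (norm (a L))\<^sup>2 * wt \<beta> L) \<le> C"
  shows "in_l2 \<beta> a" "sqnorm \<beta> a \<le> C"
proof -
  show 1: "in_l2 \<beta> a"
    unfolding in_l2_def by (rule nonneg_bounded_partial_sums_imp_summable_on[where C=C])
      (use assms in \<open>auto intro!: always_eventually simp: eventually_finite_subsets_at_top\<close>)
  show "sqnorm \<beta> a \<le> C"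
    unfolding sqnorm_def by (rule infsum_le_finite_sums) (use 1 assms in \<open>auto simp: in_l2_def\<close>)
qed

lemma in_l2_antimono:
  assumes "in_l2 \<beta>' a" "\<beta> \<le> \<beta>'"
  shows "in_l2 \<beta> a" "sqnorm \<beta> a \<le> sqnorm \<beta>' a"
  using in_l2_dominated[OF assms(1), of a \<beta> 1] wt_mono[OF assms(2)]
  by (auto simp: mult_left_mono)

lemma norm_add_sq_le: "(norm (x + y))\<^sup>2 \<le> 2 * (norm x)\<^sup>2 + 2 * (norm (y::'a::real_normed_vector))\<^sup>2"
proof -
  have "(norm (x + y))\<^sup>2 \<le> (norm x + norm y)\<^sup>2"
    by (intro power_mono norm_triangle_ineq) auto
  also have "\<dots> \<le> 2 * (norm x)\<^sup>2 + 2 * (norm y)\<^sup>2"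
    using sum_squares_bound[of "norm x" "norm y"] by (simp add: power2_sum)
  finally show ?thesis .
qed

lemma
  assumes "in_l2 \<beta> a" "in_l2 \<beta> b"
  shows in_l2_add: "in_l2 \<beta> (\<lambda>L. a L + b L)"
    and sqnorm_add_le: "sqnorm \<beta> (\<lambda>L. a L + b L) \<le> 2 * sqnorm \<beta> a + 2 * sqnorm \<beta> b"
proof -
  have *: "((\<lambda>L. 2 * ((norm (a L))\<^sup>2 * wt \<beta> L) + 2 * ((norm (b L))\<^sup>2 * wt \<beta> L))
      has_sum (2 * sqnorm \<beta> a + 2 * sqnorm \<beta> b)) UNIV"
    using assms unfolding in_l2_def sqnorm_def
    by (intro has_sum_add has_sum_cmult_right has_sum_infsum)
  have le: "(norm (a L + b L))\<^sup>2 * wt \<beta> L \<le> 2 * ((norm (a L))\<^sup>2 * wt \<beta> L) + 2 * ((norm (b L))\<^sup>2 * wt \<beta> L)" for L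
    using mult_right_mono[OF norm_add_sq_le[of "a L" "b L"], of "wt \<beta> L"] by (simp add: algebra_simps)
  show 1: "in_l2 \<beta> (\<lambda>L. a L + b L)"
    unfolding in_l2_def by (rule summable_on_comparison_test[OF has_sum_imp_summable[OF *]]) (use le in auto)
  show "sqnorm \<beta> (\<lambda>L. a L + b L) \<le> 2 * sqnorm \<beta> a + 2 * sqnorm \<beta> b"
    unfolding sqnorm_def[of _ "\<lambda>L. a L + b L"] infsumI[OF *, symmetric]
    by (rule infsum_mono) (use 1 le has_sum_imp_summable[OF *] in \<open>auto simp: in_l2_def\<close>)
qed

lemma
  assumes "in_l2 \<beta> a"
  shows in_l2_cmult: "in_l2 \<beta> (\<lambda>L. c * a L)"
    and sqnorm_cmult: "sqnorm \<beta> (\<lambda>L. c * a L) \<le> (norm c)\<^sup>2 * sqnorm \<beta> a"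
  using in_l2_dominated[OF assms, of "\<lambda>L. c * a L" \<beta> "(norm c)\<^sup>2"]
  by (auto simp: norm_mult power_mult_distrib)

lemma
  assumes "in_l2 \<beta> a" "in_l2 \<beta> b"
  shows in_l2_diff: "in_l2 \<beta> (\<lambda>L. a L - b L)"
    and sqnorm_diff_le: "sqnorm \<beta> (\<lambda>L. a L - b L) \<le> 2 * sqnorm \<beta> a + 2 * sqnorm \<beta> b"
proof -
  have "in_l2 \<beta> (\<lambda>L. - b L)" "sqnorm \<beta> (\<lambda>L. - b L) = sqnorm \<beta> b"
    using assms(2) by (auto simp: in_l2_def sqnorm_def)
  then show "in_l2 \<beta> (\<lambda>L. a L - b L)" "sqnorm \<beta> (\<lambda>L. a L - b L) \<le> 2 * sqnorm \<beta> a + 2 * sqnorm \<beta> b"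
    using in_l2_add[OF assms(1), of "\<lambda>L. - b L"] sqnorm_add_le[OF assms(1), of "\<lambda>L. - b L"] by auto
qed

lemma sqnorm_diff_commute: "sqnorm \<beta> (\<lambda>L. a L - b L) = sqnorm \<beta> (\<lambda>L. b L - a L)"
  by (simp add: sqnorm_def norm_minus_commute)

lemma sqnorm_diff_triangle:
  assumes "in_l2 \<beta> a" "in_l2 \<beta> b" "in_l2 \<beta> c"
  shows "sqnorm \<beta> (\<lambda>L. a L - c L) \<le> 2 * sqnorm \<beta> (\<lambda>L. a L - b L) + 2 * sqnorm \<beta> (\<lambda>L. b L - c L)"
  using sqnorm_add_le[OF in_l2_diff[OF assms(1,2)] in_l2_diff[OF assms(2,3)]] by simp

lemma in_l2_finite_support: "finite {L. a L \<noteq> 0} \<Longrightarrow> in_l2 \<beta> a"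
  unfolding in_l2_def
  by (subst summable_on_cong_neutral[where T="{L. a L \<noteq> 0}" and g="\<lambda>L. (norm (a L))\<^sup>2 * wt \<beta> L"]) auto

section \<open>Polynomials as coefficient arrays\<close>

definition pcoef :: "complex poly poly \<Rightarrow> nat \<times> nat \<Rightarrow> complex" where
  "pcoef p L = coeff (coeff p (snd L)) (fst L)"

definition poly_of :: "(nat \<times> nat \<Rightarrow> complex) \<Rightarrow> (nat \<times> nat) set \<Rightarrow> complex poly poly" where
  "poly_of c S = (\<Sum>M\<in>S. monom (monom (c M) (fst M)) (snd M))"

lemma pcoef_poly_of: "finite S \<Longrightarrow> pcoef (poly_of c S) L = (if L \<in> S then c L else 0)"
proof -
  assume S: "finite S"
  have "pcoef (poly_of c S) L = (\<Sum>M\<in>S. if L = M then c M else 0)"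
    unfolding pcoef_def poly_of_def coeff_sum by (intro sum.cong) (auto simp: prod_eq_iff)
  then show ?thesis using S by simp
qed

lemma pcoef_eqI: "(\<And>L. pcoef p L = pcoef q L) \<Longrightarrow> p = q"
  unfolding pcoef_def by (intro poly_eqI) (metis fst_conv snd_conv)

lemma finite_pcoef_support: "finite {L. pcoef p L \<noteq> 0}"
proof (rule finite_subset)
  show "{L. pcoef p L \<noteq> 0} \<subseteq> (\<Union>n\<in>{..degree p}. (\<lambda>m. (m, n)) ` {..degree (coeff p n)})"
  proof
    fix L assume "L \<in> {L. pcoef p L \<noteq> 0}"
    then have *: "coeff (coeff p (snd L)) (fst L) \<noteq> 0" by (simp add: pcoef_def)
    then have "coeff p (snd L) \<noteq> 0" by auto
    then have "snd L \<le> degree p" "fst L \<le> degree (coeff p (snd L))"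
      using * by (auto intro: le_degree)
    then show "L \<in> (\<Union>n\<in>{..degree p}. (\<lambda>m. (m, n)) ` {..degree (coeff p n)})"
      by (auto intro!: bexI[of _ "snd L"] image_eqI[of _ _ "fst L"] simp: prod_eq_iff)
  qed
qed auto

definition supp :: "complex poly poly \<Rightarrow> (nat \<times> nat) set" where
  "supp p = {L. pcoef p L \<noteq> 0}"

lemma finite_supp [simp]: "finite (supp p)"
  by (simp add: supp_def finite_pcoef_support)

lemma poly_of_pcoef: "poly_of (pcoef p) (supp p) = p"
  by (rule pcoef_eqI) (simp add: pcoef_poly_of, simp add: supp_def)

lemma eval2_add [simp]: "eval2 (p + q) z = eval2 p z + eval2 q z"
  and eval2_mult [simp]: "eval2 (p * q) z = eval2 p z * eval2 q z"
  and eval2_diff [simp]: "eval2 (p - q) z = eval2 p z - eval2 q z"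
  and eval2_minus [simp]: "eval2 (- p) z = - eval2 p z"
  and eval2_0 [simp]: "eval2 0 z = 0"
  and eval2_1 [simp]: "eval2 1 z = 1"
  by (simp_all add: eval2_def)

lemma eval2_power [simp]: "eval2 (p ^ n) z = eval2 p z ^ n"
  by (induction n) auto

lemma eval2_sum: "eval2 (sum g S) z = (\<Sum>M\<in>S. eval2 (g M) z)"
  by (induction S rule: infinite_finite_induct) auto

lemma eval2_prod: "eval2 (prod g S) z = (\<Prod>M\<in>S. eval2 (g M) z)"
  by (induction S rule: infinite_finite_induct) auto

lemma eval2_monom: "eval2 (monom (monom c m) n) z = c * fst z ^ m * snd z ^ n"
  by (simp add: eval2_def poly_monom)

lemma eval2_poly_of: "eval2 (poly_of c S) z = (\<Sum>M\<in>S. c M * (fst z ^ fst M * snd z ^ snd M))"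
  by (simp add: poly_of_def eval2_sum eval2_monom mult_ac)

lemma eval2_eq_sum: "eval2 p z = (\<Sum>M\<in>supp p. pcoef p M * (fst z ^ fst M * snd z ^ snd M))"
  by (subst poly_of_pcoef[symmetric]) (simp only: eval2_poly_of)

lemma has_expansion_eval2: "has_expansion (pcoef p) (eval2 p)"
  unfolding has_expansion_def
proof
  fix z
  show "((\<lambda>L. pcoef p L * (fst z ^ fst L * snd z ^ snd L)) has_sum eval2 p z) UNIV"
    by (rule has_sum_finite_neutralI[of "supp p"]) (auto simp: eval2_eq_sum supp_def finite_pcoef_support)
qed

lemma in_l2_pcoef [simp]: "in_l2 \<beta> (pcoef p)"
  by (intro in_l2_finite_support finite_pcoef_support)

lemma pcoef_0 [simp]: "pcoef 0 = (\<lambda>_. 0)"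
  by (auto simp: pcoef_def)

lemma pcoef_1: "pcoef 1 = (\<lambda>L. if L = (0,0) then 1 else 0)"
  by (auto simp: pcoef_def fun_eq_iff one_pCons coeff_pCons split: nat.splits)

lemma pcoef_add: "pcoef (p + q) L = pcoef p L + pcoef q L"
  by (simp add: pcoef_def)
lemma pcoef_diff: "pcoef (p - q) L = pcoef p L - pcoef q L"
  by (simp add: pcoef_def)

section \<open>Multiplication by polynomials\<close>

lemma has_sum_finite_sum:
  fixes g :: "'i \<Rightarrow> 'b \<Rightarrow> complex"
  assumes "finite S" "\<And>i. i \<in> S \<Longrightarrow> (g i has_sum s i) A"
  shows "((\<lambda>x. \<Sum>i\<in>S. g i x) has_sum (\<Sum>i\<in>S. s i)) A"
  using assms by (induction S) (auto intro!: has_sum_add)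

definition shift :: "nat \<times> nat \<Rightarrow> (nat \<times> nat \<Rightarrow> complex) \<Rightarrow> nat \<times> nat \<Rightarrow> complex" where
  "shift M a L = (if fst M \<le> fst L \<and> snd M \<le> snd L then a (fst L - fst M, snd L - snd M) else 0)"

definition pmul :: "complex poly poly \<Rightarrow> (nat \<times> nat \<Rightarrow> complex) \<Rightarrow> nat \<times> nat \<Rightarrow> complex" where
  "pmul p a L = (\<Sum>M\<in>supp p. pcoef p M * shift M a L)"

lemma pmul_diff: "pmul p (\<lambda>L. a L - b L) L = pmul p a L - pmul p b L"
  unfolding pmul_def sum_subtractf[symmetric] by (intro sum.cong) (auto simp: shift_def algebra_simps)

lemma inj_shift: "inj (\<lambda>L. (fst L + fst M, snd L + snd M) :: nat \<times> nat)"
  by (auto simp: inj_on_def prod_eq_iff)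

lemma shift_range:
  "L \<notin> range (\<lambda>L. (fst L + fst M, snd L + snd M)) \<Longrightarrow> shift M a L = 0"
proof (rule ccontr)
  assume L: "L \<notin> range (\<lambda>L. (fst L + fst M, snd L + snd M))" and "shift M a L \<noteq> 0"
  then have "L = (\<lambda>L. (fst L + fst M, snd L + snd M)) (fst L - fst M, snd L - snd M)"
    by (auto simp: shift_def prod_eq_iff split: if_splits)
  with L show False by blast
qed

lemma has_sum_shift_iff:
  fixes g :: "nat \<times> nat \<Rightarrow> 'c::{comm_monoid_add, topological_space}"
  assumes "\<And>L. L \<notin> range (\<lambda>L. (fst L + fst M, snd L + snd M)) \<Longrightarrow> g L = 0"
  shows "(g has_sum s) UNIV \<longleftrightarrow> ((\<lambda>L. g (fst L + fst M, snd L + snd M)) has_sum s) UNIV"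
proof -
  have "(g has_sum s) UNIV \<longleftrightarrow> (g has_sum s) (range (\<lambda>L. (fst L + fst M, snd L + snd M)))"
    by (rule has_sum_cong_neutral) (use assms in auto)
  also have "\<dots> \<longleftrightarrow> ((\<lambda>L. g (fst L + fst M, snd L + snd M)) has_sum s) UNIV"
    using has_sum_reindex[OF inj_shift, where g=g] by (simp add: o_def)
  finally show ?thesis .
qed

lemma has_expansion_shift:
  assumes "has_expansion a F"
  shows "has_expansion (shift M a) (\<lambda>z. fst z ^ fst M * snd z ^ snd M * F z)"
  unfolding has_expansion_def
proof
  fix z assume "z \<in> bidisk"
  then have "((\<lambda>L. a L * (fst z ^ fst L * snd z ^ snd L)) has_sum F z) UNIV"
    using assms by (auto simp: has_expansion_def)
  then have "((\<lambda>L. (fst z ^ fst M * snd z ^ snd M) * (a L * (fst z ^ fst L * snd z ^ snd L)))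
      has_sum (fst z ^ fst M * snd z ^ snd M * F z)) UNIV"
    by (rule has_sum_cmult_right)
  then show "((\<lambda>L. shift M a L * (fst z ^ fst L * snd z ^ snd L)) has_sum
      fst z ^ fst M * snd z ^ snd M * F z) UNIV"
    by (subst has_sum_shift_iff[where M=M]) (simp_all add: shift_range, simp add: shift_def power_add mult_ac)
qed

lemma has_expansion_pmul:
  assumes "has_expansion a F"
  shows "has_expansion (pmul p a) (\<lambda>z. eval2 p z * F z)"
  unfolding has_expansion_def
proof
  fix z assume z: "z \<in> bidisk"
  have "((\<lambda>L. \<Sum>M\<in>supp p. pcoef p M * (shift M a L * (fst z ^ fst L * snd z ^ snd L))) has_sum
      (\<Sum>M\<in>supp p. pcoef p M * (fst z ^ fst M * snd z ^ snd M * F z))) UNIV"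
    by (intro has_sum_finite_sum has_sum_cmult_right finite_supp)
      (use has_expansion_shift[OF assms] z in \<open>auto simp: has_expansion_def\<close>)
  then show "((\<lambda>L. pmul p a L * (fst z ^ fst L * snd z ^ snd L)) has_sum eval2 p z * F z) UNIV"
    by (simp add: pmul_def eval2_eq_sum sum_distrib_right mult.assoc)
qed

lemma pcoef_mult: "pcoef (p * q) = pmul p (pcoef q)"
proof (rule has_expansion_unique)
  show "has_expansion (pcoef (p * q)) (\<lambda>z. eval2 p z * eval2 q z)"
    using has_expansion_eval2[of "p * q"] by (simp add: has_expansion_def)
qed (rule has_expansion_pmul[OF has_expansion_eval2])

lemma
  assumes "in_l2 \<beta> a"
  shows in_l2_shift: "in_l2 \<beta> (shift M a)"
    and sqnorm_shift: "sqnorm \<beta> (shift M a) \<le> (real (fst M + snd M) + 1) powr \<bar>\<beta>\<bar> * sqnorm \<beta> a"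
proof -
  let ?C = "(real (fst M + snd M) + 1) powr \<bar>\<beta>\<bar>"
  let ?s = "\<lambda>L. (fst L + fst M, snd L + snd M)"
  define h where "h L = (norm (a L))\<^sup>2 * wt \<beta> (?s L)" for L
  have w: "wt \<beta> (?s L) \<le> ?C * wt \<beta> L" for L
  proof (cases "\<beta> \<ge> 0")
    case True
    have "real (fst (?s L) + snd (?s L)) + 2 \<le> (real (fst M + snd M) + 1) * (real (fst L + snd L) + 2)"
      by (simp add: algebra_simps)
    then have "wt \<beta> (?s L) \<le> ((real (fst M + snd M) + 1) * (real (fst L + snd L) + 2)) powr \<beta>"
      unfolding wt_def using True by (intro powr_mono2) auto
    also have "\<dots> = ?C * wt \<beta> L"
      unfolding wt_def using True by (subst powr_mult) auto
    finally show ?thesis .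
  next
    case False
    have "wt \<beta> (?s L) \<le> 1 * wt \<beta> L"
      unfolding wt_def mult_1 using False by (intro powr_mono2') auto
    also have "\<dots> \<le> ?C * wt \<beta> L"
      by (intro mult_right_mono ge_one_powr_ge_zero) auto
    finally show ?thesis .
  qed
  have ch: "h L \<le> ?C * ((norm (a L))\<^sup>2 * wt \<beta> L)" for L
    using mult_left_mono[OF w[of L], of "(norm (a L))\<^sup>2"] by (simp add: h_def mult_ac)
  have s: "(\<lambda>L. ?C * ((norm (a L))\<^sup>2 * wt \<beta> L)) summable_on UNIV"
    using assms unfolding in_l2_def by (rule summable_on_cmult_right)
  have hs: "h summable_on UNIV"
    by (rule summable_on_comparison_test[OF s]) (use ch in \<open>auto simp: h_def\<close>)
  have *: "((\<lambda>L. (norm (shift M a L))\<^sup>2 * wt \<beta> L) has_sum (infsum h UNIV)) UNIV"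
    by (subst has_sum_shift_iff[where M=M])
       (simp_all add: shift_range, simp add: shift_def h_def[symmetric] hs)
  show "in_l2 \<beta> (shift M a)"
    using * unfolding in_l2_def by (rule has_sum_imp_summable)
  have "sqnorm \<beta> (shift M a) = infsum h UNIV"
    unfolding sqnorm_def using * by (rule infsumI)
  also have "\<dots> \<le> infsum (\<lambda>L. ?C * ((norm (a L))\<^sup>2 * wt \<beta> L)) UNIV"
    by (intro infsum_mono hs s ch)
  also have "\<dots> = ?C * sqnorm \<beta> a"
    unfolding sqnorm_def using assms by (intro infsum_cmult_right) (auto simp: in_l2_def)
  finally show "sqnorm \<beta> (shift M a) \<le> ?C * sqnorm \<beta> a" .
qed

text \<open>
  Multiplication by a monomial multiplies the weights by at most a constant, since
  \<open>|L| + |M| + 2 \<le> (|M| + 1) (|L| + 2)\<close>. A polynomial is a finite sum of monomials.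
\<close>
lemma pmul_bounded:
  "\<exists>C>0. \<forall>a. in_l2 \<beta> a \<longrightarrow> in_l2 \<beta> (pmul p a) \<and> sqnorm \<beta> (pmul p a) \<le> C * sqnorm \<beta> a"
proof -
  have "\<exists>C>0. \<forall>a. in_l2 \<beta> a \<longrightarrow> in_l2 \<beta> (\<lambda>L. \<Sum>M\<in>S. c M * shift M a L) \<and>
      sqnorm \<beta> (\<lambda>L. \<Sum>M\<in>S. c M * shift M a L) \<le> C * sqnorm \<beta> a" if "finite S" for S and c :: "nat \<times> nat \<Rightarrow> complex"
    using that
  proof (induction S)
    case empty
    then show ?case by (auto simp: in_l2_def sqnorm_def intro!: exI[of _ 1] infsum_nonneg)
  next
    case (insert M S)
    then obtain C where C: "C > 0" "\<And>a. in_l2 \<beta> a \<Longrightarrow> in_l2 \<beta> (\<lambda>L. \<Sum>M\<in>S. c M * shift M a L)"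
      "\<And>a. in_l2 \<beta> a \<Longrightarrow> sqnorm \<beta> (\<lambda>L. \<Sum>M\<in>S. c M * shift M a L) \<le> C * sqnorm \<beta> a" by auto
    define D where "D = (norm (c M))\<^sup>2 * (real (fst M + snd M) + 1) powr \<bar>\<beta>\<bar>"
    show ?case
    proof (intro exI[of _ "2 * D + 2 * C"] conjI allI impI)
      show "0 < 2 * D + 2 * C" using C by (simp add: D_def add_nonneg_pos)
      fix a assume a: "in_l2 \<beta> a"
      have 1: "in_l2 \<beta> (\<lambda>L. c M * shift M a L)"
        by (intro in_l2_cmult in_l2_shift a)
      have "sqnorm \<beta> (\<lambda>L. c M * shift M a L) \<le> (norm (c M))\<^sup>2 * sqnorm \<beta> (shift M a)"
        by (intro sqnorm_cmult in_l2_shift a)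
      also have "\<dots> \<le> D * sqnorm \<beta> a"
        unfolding D_def mult.assoc by (intro mult_left_mono sqnorm_shift a) auto
      finally have 2: "sqnorm \<beta> (\<lambda>L. c M * shift M a L) \<le> D * sqnorm \<beta> a" .
      show "in_l2 \<beta> (\<lambda>L. \<Sum>M\<in>insert M S. c M * shift M a L)"
        using in_l2_add[OF 1 C(2)[OF a]] insert by simp
      show "sqnorm \<beta> (\<lambda>L. \<Sum>M\<in>insert M S. c M * shift M a L) \<le> (2 * D + 2 * C) * sqnorm \<beta> a"
        using sqnorm_add_le[OF 1 C(2)[OF a]] 2 C(3)[OF a] insert by (simp add: algebra_simps)
    qed
  qed
  from this[of "supp p" "pcoef p"] show ?thesis
    by (simp add: pmul_def[abs_def])
qed

lemma in_l2_pmul: "in_l2 \<beta> a \<Longrightarrow> in_l2 \<beta> (pmul p a)"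
  using pmul_bounded by blast

lemma pcoef_dense:
  assumes "in_l2 \<beta> a" "\<epsilon> > 0"
  shows "\<exists>p. sqnorm \<beta> (\<lambda>L. a L - pcoef p L) < \<epsilon>"
proof -
  let ?h = "\<lambda>L. (norm (a L))\<^sup>2 * wt \<beta> L"
  have hs: "?h summable_on UNIV" using assms by (simp add: in_l2_def)
  then have "(?h has_sum infsum ?h UNIV) UNIV" by simp
  then have "eventually (\<lambda>S. dist (sum ?h S) (infsum ?h UNIV) < \<epsilon>) (finite_subsets_at_top UNIV)"
    unfolding has_sum_def by (rule tendstoD) fact
  then obtain S where S: "finite S" "dist (sum ?h S) (infsum ?h UNIV) < \<epsilon>"
    unfolding eventually_finite_subsets_at_top by blast
  have "sqnorm \<beta> (\<lambda>L. a L - pcoef (poly_of a S) L) = infsum ?h (- S)"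
    unfolding sqnorm_def by (rule infsum_cong_neutral) (use S in \<open>auto simp: pcoef_poly_of\<close>)
  moreover have "infsum ?h UNIV = infsum ?h S + infsum ?h (-S)"
    using infsum_Un_disjoint[of ?h S "-S"] hs by (simp add: summable_on_subset_banach)
  ultimately have "sqnorm \<beta> (\<lambda>L. a L - pcoef (poly_of a S) L) < \<epsilon>"
    using S by (simp add: dist_real_def)
  then show ?thesis by blast
qed

section \<open>Limits of polynomial multiples\<close>

text \<open>
  The array a lies in the closed subspace generated by the polynomial multiples of f.
\<close>
definition in_closure :: "real \<Rightarrow> complex poly poly \<Rightarrow> (nat \<times> nat \<Rightarrow> complex) \<Rightarrow> bool" where
  "in_closure \<beta> f a \<longleftrightarrow> in_l2 \<beta> a \<and> (\<forall>\<epsilon>>0. \<exists>p. sqnorm \<beta> (\<lambda>L. a L - pcoef (p * f) L) < \<epsilon>)"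

lemma in_closure_closed:
  assumes "in_l2 \<beta> a" "\<And>\<epsilon>. \<epsilon> > 0 \<Longrightarrow> \<exists>b. in_closure \<beta> f b \<and> sqnorm \<beta> (\<lambda>L. a L - b L) < \<epsilon>"
  shows "in_closure \<beta> f a"
  unfolding in_closure_def
proof (intro conjI allI impI)
  fix \<epsilon> :: real assume "\<epsilon> > 0"
  then obtain b where b: "in_closure \<beta> f b" "sqnorm \<beta> (\<lambda>L. a L - b L) < \<epsilon> / 4"
    using assms(2)[of "\<epsilon> / 4"] by auto
  then obtain p where p: "sqnorm \<beta> (\<lambda>L. b L - pcoef (p * f) L) < \<epsilon> / 4"
    unfolding in_closure_def using \<open>\<epsilon> > 0\<close> by (metis divide_pos_pos zero_less_numeral)
  have "sqnorm \<beta> (\<lambda>L. a L - pcoef (p * f) L) < \<epsilon>"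
    using sqnorm_diff_triangle[OF assms(1), of b "pcoef (p * f)"] b p by (auto simp: in_closure_def)
  then show "\<exists>p. sqnorm \<beta> (\<lambda>L. a L - pcoef (p * f) L) < \<epsilon>" by blast
qed fact

lemma in_closure_pmul:
  assumes "in_l2 \<beta> u"
  shows "in_closure \<beta> f (pmul f u)"
  unfolding in_closure_def
proof (intro conjI allI impI)
  show "in_l2 \<beta> (pmul f u)" by (intro in_l2_pmul assms)
  fix \<epsilon> :: real assume e: "\<epsilon> > 0"
  obtain C where C: "C > 0" "\<And>a. in_l2 \<beta> a \<Longrightarrow> sqnorm \<beta> (pmul f a) \<le> C * sqnorm \<beta> a"
    using pmul_bounded by blast
  obtain p where p: "sqnorm \<beta> (\<lambda>L. u L - pcoef p L) < \<epsilon> / C"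
    using pcoef_dense[OF assms, of "\<epsilon> / C"] C e by auto
  have "sqnorm \<beta> (\<lambda>L. pmul f u L - pcoef (p * f) L) = sqnorm \<beta> (pmul f (\<lambda>L. u L - pcoef p L))"
    by (subst mult.commute) (simp add: pcoef_mult pmul_diff[abs_def])
  also have "\<dots> \<le> C * sqnorm \<beta> (\<lambda>L. u L - pcoef p L)"
    by (intro C in_l2_diff assms in_l2_pcoef)
  also have "\<dots> < \<epsilon>" using p C by (simp add: field_simps)
  finally show "\<exists>p. sqnorm \<beta> (\<lambda>L. pmul f u L - pcoef (p * f) L) < \<epsilon>" by blast
qed

text \<open>
  This is how cyclicity is inherited: if q is a limit of multiples of f, then so is every
  limit of multiples of q.
\<close>
lemma in_closure_trans:
  assumes "in_closure \<beta> q a" "in_closure \<beta> f (pcoef q)"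
  shows "in_closure \<beta> f a"
proof (rule in_closure_closed)
  show a: "in_l2 \<beta> a" using assms by (simp add: in_closure_def)
  fix \<epsilon> :: real assume e: "\<epsilon> > 0"
  then obtain t where t: "sqnorm \<beta> (\<lambda>L. a L - pcoef (t * q) L) < \<epsilon>"
    using assms by (auto simp: in_closure_def)
  obtain C where C: "C > 0" "\<And>a. in_l2 \<beta> a \<Longrightarrow> sqnorm \<beta> (pmul t a) \<le> C * sqnorm \<beta> a"
    using pmul_bounded by blast
  have "in_closure \<beta> f (pcoef (t * q))"
    unfolding in_closure_def
  proof (intro conjI allI impI)
    fix \<delta> :: real assume "\<delta> > 0"
    then obtain p where p: "sqnorm \<beta> (\<lambda>L. pcoef q L - pcoef (p * f) L) < \<delta> / C"
      using assms(2) C unfolding in_closure_def by (metis divide_pos_pos)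
    have "sqnorm \<beta> (\<lambda>L. pcoef (t * q) L - pcoef (t * p * f) L) = sqnorm \<beta> (pmul t (\<lambda>L. pcoef q L - pcoef (p * f) L))"
      by (simp add: pcoef_mult pmul_diff[abs_def] mult.assoc)
    also have "\<dots> \<le> C * sqnorm \<beta> (\<lambda>L. pcoef q L - pcoef (p * f) L)"
      by (intro C in_l2_diff in_l2_pcoef)
    also have "\<dots> < \<delta>" using p C by (simp add: field_simps)
    finally show "\<exists>p. sqnorm \<beta> (\<lambda>L. pcoef (t * q) L - pcoef (p * f) L) < \<delta>" by blast
  qed simp
  with t show "\<exists>b. in_closure \<beta> f b \<and> sqnorm \<beta> (\<lambda>L. a L - b L) < \<epsilon>" by blast
qed

lemma in_closure_mult:
  assumes "in_closure \<beta> q (pcoef 1)" "in_closure \<beta> p (pcoef 1)"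
  shows "in_closure \<beta> (p * q) (pcoef 1)"
proof (rule in_closure_trans[OF assms(2)])
  obtain C where C: "C > 0" "\<And>a. in_l2 \<beta> a \<Longrightarrow> sqnorm \<beta> (pmul p a) \<le> C * sqnorm \<beta> a"
    using pmul_bounded by blast
  show "in_closure \<beta> (p * q) (pcoef p)"
    unfolding in_closure_def
  proof (intro conjI allI impI)
    fix \<delta> :: real assume "\<delta> > 0"
    then obtain r where r: "sqnorm \<beta> (\<lambda>L. pcoef 1 L - pcoef (r * q) L) < \<delta> / C"
      using assms(1) C unfolding in_closure_def by (metis divide_pos_pos)
    have "sqnorm \<beta> (\<lambda>L. pcoef (p * 1) L - pcoef (p * (r * q)) L) = sqnorm \<beta> (pmul p (\<lambda>L. pcoef 1 L - pcoef (r * q) L))"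
      by (simp only: pcoef_mult pmul_diff[abs_def])
    also have "\<dots> \<le> C * sqnorm \<beta> (\<lambda>L. pcoef 1 L - pcoef (r * q) L)"
      by (intro C in_l2_diff in_l2_pcoef)
    also have "\<dots> < \<delta>" using r C by (simp add: field_simps)
    finally have "sqnorm \<beta> (\<lambda>L. pcoef p L - pcoef (r * (p * q)) L) < \<delta>" by (simp add: mult_ac)
    then show "\<exists>r. sqnorm \<beta> (\<lambda>L. pcoef p L - pcoef (r * (p * q)) L) < \<delta>" by blast
  qed simp
qed

lemma in_closure_one_one: "in_closure \<beta> 1 (pcoef 1)"
  unfolding in_closure_def by (auto intro!: exI[of _ 1] simp: sqnorm_def)

lemma in_closure_power: "in_closure \<beta> p (pcoef 1) \<Longrightarrow> in_closure \<beta> (p ^ n) (pcoef 1)"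
  by (induction n) (auto intro: in_closure_one_one in_closure_mult)

lemma in_closure_prod: "(\<And>i. i \<in> S \<Longrightarrow> in_closure \<beta> (g i) (pcoef 1)) \<Longrightarrow> in_closure \<beta> (prod g S) (pcoef 1)"
  by (induction S rule: infinite_finite_induct) (auto intro: in_closure_one_one in_closure_mult)

lemma in_closure_one: "in_l2 \<beta> a \<Longrightarrow> in_closure \<beta> 1 a"
  unfolding in_closure_def using pcoef_dense by auto

lemma in_closure_antimono:
  assumes "in_closure \<beta>' f (pcoef q)" "\<beta> \<le> \<beta>'"
  shows "in_closure \<beta> f (pcoef q)"
  unfolding in_closure_def
proof (intro conjI allI impI)
  fix \<epsilon> :: real assume "\<epsilon> > 0"
  then obtain p where "sqnorm \<beta>' (\<lambda>L. pcoef q L - pcoef (p * f) L) < \<epsilon>"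
    using assms by (auto simp: in_closure_def)
  then have "sqnorm \<beta> (\<lambda>L. pcoef q L - pcoef (p * f) L) < \<epsilon>"
    using in_l2_antimono(2)[OF in_l2_diff[OF in_l2_pcoef in_l2_pcoef] assms(2), of q "p * f"] by simp
  then show "\<exists>p. sqnorm \<beta> (\<lambda>L. pcoef q L - pcoef (p * f) L) < \<epsilon>" by blast
qed simp

lemma dirichlet_space_iff:
  assumes "has_expansion a g"
  shows "g \<in> dirichlet_space \<beta> \<longleftrightarrow> in_l2 \<beta> a" "dirichlet_norm \<beta> g = sqrt (sqnorm \<beta> a)"
  using assms by (auto simp: dirichlet_space_def dirichlet_norm_def dirichlet_term_def[abs_def]
      in_l2_def sqnorm_def wt_def power_coeffs_eq)

lemma has_expansion_diff:
  assumes "has_expansion a F" "has_expansion b G"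
  shows "has_expansion (\<lambda>L. a L - b L) (\<lambda>z. F z - G z)"
  unfolding has_expansion_def
proof
  fix z assume "z \<in> bidisk"
  then have "((\<lambda>L. a L * (fst z ^ fst L * snd z ^ snd L) + - (b L * (fst z ^ fst L * snd z ^ snd L)))
      has_sum F z + - G z) UNIV"
    using assms by (intro has_sum_add has_sum_uminusI) (auto simp: has_expansion_def)
  then show "((\<lambda>L. (a L - b L) * (fst z ^ fst L * snd z ^ snd L)) has_sum F z - G z) UNIV"
    by (simp add: algebra_simps)
qed

text \<open>
  Since polynomials are dense and multiplication by a fixed polynomial is bounded, it is enough
  to approximate the constant 1.
\<close>
lemma cyclic_iff_in_closure: "cyclic \<beta> (eval2 f) \<longleftrightarrow> in_closure \<beta> f (pcoef 1)"
proof
  assume c: "cyclic \<beta> (eval2 f)"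
  have 1: "eval2 1 \<in> dirichlet_space \<beta>"
    using dirichlet_space_iff(1)[OF has_expansion_eval2] by simp
  show "in_closure \<beta> f (pcoef 1)"
    unfolding in_closure_def
  proof (intro conjI allI impI)
    fix \<epsilon> :: real assume e: "\<epsilon> > 0"
    have "eval2 1 \<in> dirichlet_closure \<beta> (range (\<lambda>p z. eval2 p z * eval2 f z))"
      using c 1 by (simp add: cyclic_def)
    then obtain p where p: "dirichlet_norm \<beta> (\<lambda>z. eval2 1 z - eval2 p z * eval2 f z) < sqrt \<epsilon>"
      using e unfolding dirichlet_closure_def by (fastforce simp del: eval2_1 dest: spec[of _ "sqrt \<epsilon>"])
    have "dirichlet_norm \<beta> (\<lambda>z. eval2 1 z - eval2 (p * f) z) = sqrt (sqnorm \<beta> (\<lambda>L. pcoef 1 L - pcoef (p * f) L))"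
      by (intro dirichlet_space_iff has_expansion_diff has_expansion_eval2)
    then show "\<exists>p. sqnorm \<beta> (\<lambda>L. pcoef 1 L - pcoef (p * f) L) < \<epsilon>"
      using p by (auto simp del: eval2_1)
  qed simp
next
  assume r: "in_closure \<beta> f (pcoef 1)"
  have "g \<in> dirichlet_closure \<beta> (range (\<lambda>p z. eval2 p z * eval2 f z))" if g: "g \<in> dirichlet_space \<beta>" for g
    unfolding dirichlet_closure_def
  proof (clarsimp simp: g)
    fix \<epsilon> :: real assume e: "\<epsilon> > 0"
    from g obtain a where a: "has_expansion a g" by (auto simp: dirichlet_space_def)
    with g have "in_l2 \<beta> a" using dirichlet_space_iff by blast
    then have "in_closure \<beta> f a" by (intro in_closure_trans[OF in_closure_one r])
    then obtain p where p: "sqnorm \<beta> (\<lambda>L. a L - pcoef (p * f) L) < \<epsilon>\<^sup>2"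
      using e unfolding in_closure_def by (meson zero_less_power)
    have "dirichlet_norm \<beta> (\<lambda>z. g z - eval2 (p * f) z) = sqrt (sqnorm \<beta> (\<lambda>L. a L - pcoef (p * f) L))"
      by (intro dirichlet_space_iff has_expansion_diff has_expansion_eval2 a)
    also have "\<dots> < \<epsilon>" using p e by (intro real_less_lsqrt) auto
    finally have *: "dirichlet_norm \<beta> (\<lambda>z. g z - eval2 p z * eval2 f z) < \<epsilon>" by simp
    have "eval2 (p * f) \<in> dirichlet_space \<beta>"
      using dirichlet_space_iff(1)[OF has_expansion_eval2] by simp
    moreover have "eval2 (p * f) = (\<lambda>z. eval2 p z * eval2 f z)" by auto
    ultimately show "\<exists>h\<in>range (\<lambda>p z. eval2 p z * eval2 f z) \<inter> dirichlet_space \<beta>. dirichlet_norm \<beta> (\<lambda>z. g z - h z) < \<epsilon>"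
      using * by (intro bexI[of _ "\<lambda>z. eval2 p z * eval2 f z"]) auto
  qed
  moreover have "dirichlet_closure \<beta> S \<subseteq> dirichlet_space \<beta>" for S
    by (auto simp: dirichlet_closure_def)
  ultimately show "cyclic \<beta> (eval2 f)"
    unfolding cyclic_def using dirichlet_space_iff(1)[OF has_expansion_eval2] by auto
qed

section \<open>Power series on the bidisk\<close>

text \<open>
  Taylor expansion in the first variable, followed by Taylor expansion of each coefficient in the
  second one. Cauchy's inequality, used twice on a smaller polydisc, makes the double series absolutely
  convergent there.
\<close>
lemma has_expansion_holomorphic:
  fixes F :: "complex \<times> complex \<Rightarrow> complex"
  assumes cont: "continuous_on bidisk F"
    and hol1: "\<And>w. norm w < 1 \<Longrightarrow> (\<lambda>z. F (z, w)) holomorphic_on ball 0 1"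
    and holb: "\<And>k. (\<lambda>w. (deriv ^^ k) (\<lambda>z. F (z, w)) 0 / fact k) holomorphic_on ball 0 1"
  shows "\<exists>a. has_expansion a F"
proof -
  define b where "b k w = (deriv ^^ k) (\<lambda>z. F (z, w)) 0 / fact k" for k w
  define a where "a L = (deriv ^^ snd L) (b (fst L)) 0 / fact (snd L)" for L
  have hb: "b k holomorphic_on ball 0 1" for k
    using holb[of k] by (simp add: b_def[abs_def])
  have "has_expansion a F"
    unfolding has_expansion_def
  proof
    fix z0 :: "complex \<times> complex" assume z0: "z0 \<in> bidisk"
    obtain z w where zw: "z0 = (z, w)" "norm z < 1" "norm w < 1"
      using z0 by (cases z0) (auto simp: bidisk_def)
    obtain r where r: "0 < r" "r < 1" "norm z < r" "norm w < r"
    proof -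
      obtain r where "max (norm z) (norm w) < r" "r < 1"
        using dense[of "max (norm z) (norm w)" 1] zw by auto
      then show ?thesis using that[of r] norm_ge_zero[of z] by (auto simp del: norm_ge_zero)
    qed
    have sub: "cball 0 r \<times> cball 0 r \<subseteq> bidisk"
      using r by (auto simp: bidisk_def)
    have "compact (F ` (cball 0 r \<times> cball 0 r))"
      by (intro compact_continuous_image continuous_on_subset[OF cont sub] compact_Times compact_cball)
    then obtain M where M: "\<And>z w. norm z \<le> r \<Longrightarrow> norm w \<le> r \<Longrightarrow> norm (F (z, w)) \<le> M"
      using compact_imp_bounded by (fastforce simp: bounded_iff)
    have bB: "norm (b k v) \<le> M / r ^ k" if v: "norm v \<le> r" for k v
    proof -
      have h: "(\<lambda>z. F (z, v)) holomorphic_on ball 0 1" using hol1 v r by auto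
      have "norm ((deriv ^^ k) (\<lambda>z. F (z, v)) 0) \<le> fact k * M / r ^ k"
      proof (rule Cauchy_inequality)
        show "(\<lambda>z. F (z, v)) holomorphic_on ball 0 r"
          by (rule holomorphic_on_subset[OF h]) (use r in auto)
        show "continuous_on (cball 0 r) (\<lambda>z. F (z, v))"
          by (rule continuous_on_subset[OF holomorphic_on_imp_continuous_on[OF h]]) (use r in auto)
      qed (use r M v in auto)
      then show ?thesis using r by (simp add: b_def norm_divide field_simps)
    qed
    have aB: "norm (a (k, l)) \<le> M / r ^ k / r ^ l" for k l
    proof -
      have "norm ((deriv ^^ l) (b k) 0) \<le> fact l * (M / r ^ k) / r ^ l"
      proof (rule Cauchy_inequality)
        show "b k holomorphic_on ball 0 r"
          by (rule holomorphic_on_subset[OF hb]) (use r in auto)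
        show "continuous_on (cball 0 r) (b k)"
          by (rule continuous_on_subset[OF holomorphic_on_imp_continuous_on[OF hb]]) (use r in auto)
      qed (use r bB in auto)
      then show ?thesis using r by (simp add: a_def norm_divide field_simps)
    qed
    have s1: "((\<lambda>k. b k w * z ^ k) sums F (z, w))"
      using holomorphic_power_series[OF hol1[OF zw(3)], of z] zw by (simp add: b_def)
    have s2: "(\<lambda>l. a (k, l) * w ^ l) sums b k w" for k
      using holomorphic_power_series[OF hb, of w k] zw by (simp add: a_def)
    have q: "norm z / r < 1" "norm w / r < 1" using r by auto
    have M0: "M \<ge> 0" using order_trans[OF norm_ge_zero M[of 0 0]] r by simp
    have as: "(\<lambda>L. norm (a L * (z ^ fst L * w ^ snd L))) summable_on UNIV"
    proof (rule summable_on_comparison_test)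
      have g: "(\<lambda>k. x ^ k) summable_on (UNIV :: nat set)" if "0 \<le> x" "x < 1" for x :: real
        using that summable_geometric[of x] by (subst summable_on_UNIV_nonneg_real_iff) auto
      have "(\<lambda>(k, l). (norm z / r) ^ k * (norm w / r) ^ l) summable_on UNIV \<times> UNIV"
        by (rule summable_on_SigmaI[where g = "\<lambda>k. (norm z / r) ^ k * (\<Sum>\<^sub>\<infinity>l. (norm w / r) ^ l)"])
          (use g q r in \<open>auto intro!: has_sum_cmult_right summable_on_cmult_left\<close>)
      then have "(\<lambda>(k, l). (norm z / r) ^ k * (norm w / r) ^ l) summable_on UNIV" by simp
      then show "(\<lambda>L. M * ((norm z / r) ^ fst L * (norm w / r) ^ snd L)) summable_on UNIV"
        by (intro summable_on_cmult_right) (simp add: case_prod_unfold)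
      fix L :: "nat \<times> nat"
      have "norm (a L * (z ^ fst L * w ^ snd L)) \<le> M / r ^ fst L / r ^ snd L * (norm z ^ fst L * norm w ^ snd L)"
        unfolding norm_mult norm_power using aB[of "fst L" "snd L"] by (intro mult_right_mono) auto
      then show "norm (a L * (z ^ fst L * w ^ snd L)) \<le> M * ((norm z / r) ^ fst L * (norm w / r) ^ snd L)"
        by (simp add: power_divide)
    qed auto
    have "(\<lambda>L. a L * (z ^ fst L * w ^ snd L)) summable_on UNIV"
      using as by (rule abs_summable_summable)
    then have hs: "((\<lambda>(k, l). a (k, l) * (z ^ k * w ^ l)) has_sum (infsum (\<lambda>L. a L * (z ^ fst L * w ^ snd L)) UNIV)) (UNIV \<times> UNIV)"
      by (simp add: case_prod_unfold)
    have "((\<lambda>k. z ^ k * b k w) has_sum (infsum (\<lambda>L. a L * (z ^ fst L * w ^ snd L)) UNIV)) UNIV"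
    proof (rule has_sum_SigmaD[OF hs])
      fix k
      have "summable (\<lambda>l. norm (a (k, l) * w ^ l))"
      proof (rule summable_comparison_test')
        show "summable (\<lambda>l. M / r ^ k * (norm w / r) ^ l)"
          using q r by (intro summable_mult summable_geometric) auto
        show "norm (norm (a (k, l) * w ^ l)) \<le> M / r ^ k * (norm w / r) ^ l" if "l \<ge> 0" for l
          using mult_right_mono[OF aB[of k l], of "norm w ^ l"] by (simp add: norm_mult norm_power power_divide)
      qed
      then have "((\<lambda>l. a (k, l) * w ^ l) has_sum b k w) UNIV"
        using s2[of k] by (rule norm_summable_imp_has_sum)
      then have "((\<lambda>l. z ^ k * (a (k, l) * w ^ l)) has_sum z ^ k * b k w) UNIV"
        by (rule has_sum_cmult_right)
      then show "((\<lambda>l. case (k, l) of (k, l) \<Rightarrow> a (k, l) * (z ^ k * w ^ l)) has_sum z ^ k * b k w) UNIV"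
        by (simp add: mult_ac)
    qed
    then have "(\<lambda>k. z ^ k * b k w) sums (infsum (\<lambda>L. a L * (z ^ fst L * w ^ snd L)) UNIV)"
      by (rule has_sum_imp_sums)
    with s1 have "infsum (\<lambda>L. a L * (z ^ fst L * w ^ snd L)) UNIV = F (z, w)"
      by (simp add: mult.commute sums_iff)
    then show "((\<lambda>L. a L * (fst z0 ^ fst L * snd z0 ^ snd L)) has_sum F z0) UNIV"
      using hs zw by (simp add: case_prod_unfold)
  qed
  then show ?thesis by blast
qed

lemma continuous_eval2 [continuous_intros]: "continuous_on S g \<Longrightarrow> continuous_on S (\<lambda>x. eval2 f (g x))"
  unfolding eval2_eq_sum by (intro continuous_intros)

lemma has_fps_expansion_poly: "poly p has_fps_expansion fps_of_poly (p :: complex poly)"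
  by (simp add: has_fps_expansion_def)

text \<open>
  The Taylor coefficients in the first variable of \<open>1 / f\<close> are holomorphic in the second
  one, because the product with f determines them recursively, dividing only by the function
  \<open>f(0, w)\<close>, which has no zeros.
\<close>
lemma has_expansion_inverse:
  assumes nz: "\<And>z. z \<in> bidisk \<Longrightarrow> eval2 f z \<noteq> 0"
  shows "\<exists>a. has_expansion a (\<lambda>z. 1 / eval2 f z)"
proof (rule has_expansion_holomorphic)
  define q where "q w = poly f [:w:]" for w
  have qe: "eval2 f (z, w) = poly (q w) z" for z w by (simp add: eval2_def q_def)
  have nz': "poly (q w) z \<noteq> 0" if "norm z < 1" "norm w < 1" for z w
    using nz[of "(z, w)"] that by (simp add: bidisk_def qe)
  show "continuous_on bidisk (\<lambda>z. 1 / eval2 f z)"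
    by (intro continuous_intros) (use nz in auto)
  show hol: "(\<lambda>z. 1 / eval2 f (z, w)) holomorphic_on ball 0 1" if "norm w < 1" for w
    unfolding qe using nz' that by (intro holomorphic_intros) auto
  define b where "b k w = (deriv ^^ k) (\<lambda>z. 1 / eval2 f (z, w)) 0 / fact k" for k w
  define c where "c s w = coeff (q w) s" for s w
  have hc: "c s holomorphic_on UNIV" for s
  proof -
    have "c s = (\<lambda>w. \<Sum>i\<le>degree f. coeff (coeff f i) s * w ^ i)"
    proof
      fix w
      have "q w = (\<Sum>i\<le>degree f. smult (w ^ i) (coeff f i))"
        unfolding q_def poly_altdef by (intro sum.cong refl) (simp add: poly_const_pow mult.commute)
      then show "c s w = (\<Sum>i\<le>degree f. coeff (coeff f i) s * w ^ i)"
        by (simp add: c_def coeff_sum mult.commute)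
    qed
    then show ?thesis by (auto intro!: holomorphic_intros)
  qed
  have rec: "(\<Sum>s\<le>k. c s w * b (k - s) w) = (if k = 0 then 1 else 0)" if w: "norm w < 1" for k w
  proof -
    have e1: "(\<lambda>z. 1 / eval2 f (z, w)) has_fps_expansion fps_expansion (\<lambda>z. 1 / eval2 f (z, w)) 0"
      by (rule has_fps_expansion_fps_expansion[of "ball 0 1"]) (use hol[OF w] in auto)
    then have "(\<lambda>z. poly (q w) z * (1 / eval2 f (z, w))) has_fps_expansion
        fps_of_poly (q w) * fps_expansion (\<lambda>z. 1 / eval2 f (z, w)) 0"
      by (intro has_fps_expansion_mult has_fps_expansion_poly)
    also have "?this \<longleftrightarrow> (\<lambda>_. 1) has_fps_expansion
        fps_of_poly (q w) * fps_expansion (\<lambda>z. 1 / eval2 f (z, w)) 0"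
    proof (rule has_fps_expansion_cong)
      have "eventually (\<lambda>z::complex. z \<in> ball 0 1) (nhds 0)" by (intro eventually_nhds_in_open) auto
      then show "eventually (\<lambda>z. poly (q w) z * (1 / eval2 f (z, w)) = 1) (nhds 0)"
        by eventually_elim (use nz' w in \<open>auto simp: qe\<close>)
    qed simp
    finally have "fps_of_poly (q w) * fps_expansion (\<lambda>z. 1 / eval2 f (z, w)) 0 = 1"
      using fps_expansion_unique_complex has_fps_expansion_1 by blast
    then have "fps_nth (fps_of_poly (q w) * fps_expansion (\<lambda>z. 1 / eval2 f (z, w)) 0) k = fps_nth 1 k" by simp
    then show ?thesis by (simp add: fps_mult_nth fps_expansion_def b_def c_def atMost_atLeast0)
  qed
  have c0: "c 0 w \<noteq> 0" if "norm w < 1" for w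
    using nz'[of 0 w] that by (simp add: c_def poly_0_coeff_0)
  have "b k holomorphic_on ball 0 1" for k
  proof (induction k rule: less_induct)
    case (less k)
    have "(\<lambda>w. ((if k = 0 then 1 else 0) - (\<Sum>s\<in>{1..k}. c s w * b (k - s) w)) / c 0 w) holomorphic_on ball 0 1"
      by (intro holomorphic_intros holomorphic_on_subset[OF hc] less) (use c0 in auto)
    moreover have "((if k = 0 then 1 else 0) - (\<Sum>s\<in>{1..k}. c s w * b (k - s) w)) / c 0 w = b k w" if w: "w \<in> ball 0 1" for w
    proof -
      have "{..k} = insert 0 {1..k}" by auto
      then have "c 0 w * b k w + (\<Sum>s\<in>{1..k}. c s w * b (k - s) w) = (if k = 0 then 1 else 0)"
        using rec[of w k] w by simp
      then show ?thesis using c0[of w] w by (simp add: field_simps)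
    qed
    ultimately show ?case
      by (subst holomorphic_cong[OF refl]) (auto intro: sym)
  qed
  then show "(\<lambda>w. (deriv ^^ k) (\<lambda>z. 1 / eval2 f (z, w)) 0 / fact k) holomorphic_on ball 0 1" for k
    by (simp add: b_def[abs_def])
qed

text \<open>
  The terms of the series are summable on the torus of any radius \<open>s < 1\<close>. For
  \<open>r < s\<close> the geometric factor \<open>r / s\<close> absorbs the polynomial weight.
\<close>
lemma in_l2_dilation:
  assumes a: "has_expansion a F" and r: "0 < r" "r < 1"
  shows "in_l2 \<beta> (\<lambda>L. a L * of_real (r ^ (fst L + snd L)))"
proof -
  obtain s where s: "r < s" "s < 1" using dense[OF r(2)] by auto
  have s0: "s > 0" using r s by linarith
  define A :: "nat \<times> nat \<Rightarrow> real" where "A L = norm (a L) * s ^ (fst L + snd L)" for L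
  have "(of_real s, of_real s) \<in> bidisk"
    using s s0 by (simp add: bidisk_def)
  then have "((\<lambda>L. a L * ((of_real s) ^ fst L * (of_real s) ^ snd L)) has_sum F (of_real s, of_real s)) UNIV"
    using a unfolding has_expansion_def by fastforce
  then have "(\<lambda>L. a L * ((of_real s) ^ fst L * (of_real s) ^ snd L)) summable_on UNIV"
    by (rule has_sum_imp_summable)
  then have "(\<lambda>L::nat \<times> nat. norm (a L * ((of_real s) ^ fst L * (of_real s) ^ snd L))) summable_on UNIV"
    by (rule summable_on_iff_abs_summable_on_complex[THEN iffD1])
  then have A: "A summable_on UNIV"
    using s0 by (simp add: A_def[abs_def] norm_mult norm_power power_add)
  then have AB: "A L \<le> infsum A UNIV" for L
    using finite_sum_le_infsum[OF A, of "{L}"] s0 by (simp add: A_def)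
  have "(\<lambda>n. (real n + 2) powr \<beta> * (r / s) ^ (2 * n)) \<longlonglongrightarrow> 0"
  proof -
    define q where "q = (r / s)\<^sup>2"
    have "0 < q" "q < 1" using r s s0 by (auto simp: q_def power_less_one_iff)
    then have "(\<lambda>n. (real n + 2) powr \<beta> * q ^ n) \<longlonglongrightarrow> 0" by real_asymp
    then show ?thesis by (simp add: q_def power_mult)
  qed
  then have "Bseq (\<lambda>n. (real n + 2) powr \<beta> * (r / s) ^ (2 * n))"
    by (intro convergent_imp_Bseq convergentI)
  then obtain D where "\<And>n. norm ((real n + 2) powr \<beta> * (r / s) ^ (2 * n)) \<le> D"
    unfolding Bseq_def by blast
  then have D: "(real n + 2) powr \<beta> * (r / s) ^ (2 * n) \<le> D" for n
    by (metis abs_ge_self order_trans real_norm_def)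
  show ?thesis
    unfolding in_l2_def
  proof (rule summable_on_comparison_test)
    show "(\<lambda>L. infsum A UNIV * D * A L) summable_on UNIV"
      by (intro summable_on_cmult_right A)
    fix L :: "nat \<times> nat"
    let ?n = "fst L + snd L"
    have "(r / s) ^ (2 * ?n) = (r ^ ?n)\<^sup>2 / (s ^ ?n)\<^sup>2"
      by (simp only: power_divide power_even_eq)
    moreover have "norm (a L * of_real (r ^ ?n)) = norm (a L) * r ^ ?n"
      using r by (simp add: norm_mult norm_power)
    ultimately have "(norm (a L * of_real (r ^ ?n)))\<^sup>2 * wt \<beta> L = A L * ((real ?n + 2) powr \<beta> * (r / s) ^ (2 * ?n)) * A L"
      using s0 unfolding A_def wt_def by (simp only:) (simp add: power2_eq_square)
    also have "\<dots> \<le> infsum A UNIV * D * A L"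
      by (intro mult_right_mono mult_mono AB D) (use s0 r in \<open>auto simp: A_def intro!: infsum_nonneg\<close>)
    finally show "(norm (a L * of_real (r ^ ?n)))\<^sup>2 * wt \<beta> L \<le> infsum A UNIV * D * A L" .
  qed auto
qed

lemma has_expansion_dilation:
  assumes "has_expansion a F" "norm r \<le> 1"
  shows "has_expansion (\<lambda>L. a L * r ^ (fst L + snd L)) (\<lambda>z. F (r * fst z, r * snd z))"
  unfolding has_expansion_def
proof
  fix z assume z: "z \<in> bidisk"
  have "norm (r * x) < 1" if "norm x < 1" for x
    using mult_left_le_one_le[of "norm x" "norm r"] assms(2) that by (simp add: norm_mult)
  then have "(r * fst z, r * snd z) \<in> bidisk" using z by (auto simp: bidisk_def)
  then show "((\<lambda>L. a L * r ^ (fst L + snd L) * (fst z ^ fst L * snd z ^ snd L)) has_sum F (r * fst z, r * snd z)) UNIV"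
    using assms(1) by (auto simp: has_expansion_def power_mult_distrib power_add mult_ac)
qed

definition dilate :: "complex \<Rightarrow> complex poly poly \<Rightarrow> complex poly poly" where
  "dilate r f = poly_of (\<lambda>L. pcoef f L * r ^ (fst L + snd L)) (supp f)"

lemma eval2_dilate: "eval2 (dilate r f) z = eval2 f (r * fst z, r * snd z)"
  unfolding dilate_def eval2_poly_of eval2_eq_sum[of f]
  by (simp add: power_mult_distrib power_add mult_ac)

definition swap_poly :: "complex poly poly \<Rightarrow> complex poly poly" where
  "swap_poly f = poly_of (\<lambda>L. pcoef f (prod.swap L)) (prod.swap ` supp f)"

lemma eval2_swap_poly: "eval2 (swap_poly f) z = eval2 f (prod.swap z)"
  unfolding swap_poly_def eval2_poly_of eval2_eq_sum[of f]
  by (subst sum.reindex) (auto simp: mult_ac)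

lemma has_expansion_swap:
  assumes "has_expansion a F"
  shows "has_expansion (a \<circ> prod.swap) (F \<circ> prod.swap)"
  unfolding has_expansion_def
proof
  fix z assume "z \<in> bidisk"
  then have "prod.swap z \<in> bidisk" by (auto simp: bidisk_def)
  then have "((\<lambda>L. a L * (snd z ^ fst L * fst z ^ snd L)) has_sum F (prod.swap z)) (range prod.swap)"
    using assms by (auto simp: has_expansion_def)
  then show "((\<lambda>L. (a \<circ> prod.swap) L * (fst z ^ fst L * snd z ^ snd L)) has_sum (F \<circ> prod.swap) z) UNIV"
    by (subst (asm) has_sum_reindex) (auto simp: o_def mult_ac)
qed

section \<open>Polynomials without zeros on the closed bidisk\<close>

lemma nonvanishing_larger_bidisk:
  assumes "zero_set f \<inter> closed_bidisk = {}"
  shows "\<exists>R>1. \<forall>z. norm (fst z) < R \<longrightarrow> norm (snd z) < R \<longrightarrow> eval2 f z \<noteq> 0"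
proof (cases "zero_set f \<inter> cball 0 2 \<times> cball 0 2 = {}")
  case True
  then show ?thesis
    by (intro exI[of _ 2]) (auto simp: zero_set_def mem_Times_iff)
next
  case False
  define K where "K = zero_set f \<inter> cball 0 2 \<times> cball 0 2"
  have "closed (zero_set f)"
    unfolding zero_set_def by (intro closed_Collect_eq continuous_intros)
  then have K: "compact K"
    unfolding K_def by (intro closed_Int_compact compact_Times compact_cball)
  have "continuous_on K (\<lambda>z. max (norm (fst z)) (norm (snd z)))" by (intro continuous_intros)
  from continuous_attains_inf[OF K _ this] False
  obtain z0 where z0: "z0 \<in> K" "\<And>z. z \<in> K \<Longrightarrow> max (norm (fst z0)) (norm (snd z0)) \<le> max (norm (fst z)) (norm (snd z))"
    unfolding K_def by blast
  define R where "R = max (norm (fst z0)) (norm (snd z0))"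
  have "R > 1"
  proof (rule ccontr)
    assume "\<not> R > 1"
    then have "z0 \<in> zero_set f \<inter> closed_bidisk"
      using z0(1) by (auto simp: R_def K_def closed_bidisk_def mem_Times_iff)
    with assms show False by auto
  qed
  moreover have "R \<le> 2" using z0(1) by (auto simp: R_def K_def mem_Times_iff)
  ultimately show ?thesis
    using z0(2) by (intro exI[of _ R]) (fastforce simp: R_def[symmetric] K_def mem_Times_iff zero_set_def)
qed

text \<open>
  By compactness f has no zeros on a larger bidisk. There \<open>1 / f\<close> is holomorphic, so its
  coefficients decay geometrically, and 1 is f times an element of the space.
\<close>
lemma in_closure_if_nonvanishing_closed_bidisk:
  assumes "zero_set f \<inter> closed_bidisk = {}"
  shows "in_closure \<beta> f (pcoef 1)"
proof -
  obtain R where R: "R > 1" "\<And>z. norm (fst z) < R \<Longrightarrow> norm (snd z) < R \<Longrightarrow> eval2 f z \<noteq> 0"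
    using nonvanishing_larger_bidisk[OF assms] by blast
  have "eval2 (dilate (of_real R) f) z \<noteq> 0" if "z \<in> bidisk" for z
    unfolding eval2_dilate using that R(1) by (intro R(2)) (auto simp: bidisk_def norm_mult mem_Times_iff)
  then obtain a where a: "has_expansion a (\<lambda>z. 1 / eval2 (dilate (of_real R) f) z)"
    using has_expansion_inverse by blast
  define u where "u = (\<lambda>L. a L * of_real ((1 / R) ^ (fst L + snd L)))"
  have u: "in_l2 \<beta> u"
    unfolding u_def by (rule in_l2_dilation[OF a]) (use R in auto)
  have "has_expansion u (\<lambda>z. 1 / eval2 f z)"
  proof -
    have "norm (of_real (1 / R) :: complex) \<le> 1" using R(1) by (subst norm_of_real) simp
    from has_expansion_dilation[OF a this] show ?thesis
      using R(1) by (simp add: u_def eval2_dilate)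
  qed
  then have "has_expansion (pmul f u) (\<lambda>z. eval2 f z * (1 / eval2 f z))"
    by (rule has_expansion_pmul)
  moreover have "has_expansion (pcoef 1) (\<lambda>z. eval2 f z * (1 / eval2 f z))"
    using has_expansion_eval2[of 1] R by (auto simp: has_expansion_def bidisk_def)
  ultimately have "pcoef 1 = pmul f u" by (rule has_expansion_unique[rotated])
  then show ?thesis using in_closure_pmul[OF u] by simp
qed

section \<open>Fourier coefficients on the circle\<close>

abbreviation circle_measure :: "real measure" where
  "circle_measure \<equiv> lebesgue_on {0..2 * pi}"

definition fourier_coeff :: "(real \<Rightarrow> complex) \<Rightarrow> int \<Rightarrow> complex" where
  "fourier_coeff G k = (LINT t|circle_measure. G t * cis (- (of_int k * t))) / (2 * pi)"

lemma finite_measure_circle: "finite_measure circle_measure"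
  by (intro finite_measure_lebesgue_on) auto

lemma integrable_circle:
  fixes G :: "real \<Rightarrow> 'a::{banach, second_countable_topology}"
  assumes "G \<in> borel_measurable circle_measure" "\<And>t. norm (G t) \<le> B"
  shows "integrable circle_measure G"
  using assms by (intro finite_measure.integrable_const_bound[OF finite_measure_circle, of _ B]) auto

lemma measurable_circle_continuous:
  fixes G :: "real \<Rightarrow> 'a::euclidean_space"
  shows "continuous_on UNIV G \<Longrightarrow> G \<in> borel_measurable circle_measure"
  by (intro continuous_imp_measurable_on_sets_lebesgue) (auto intro: continuous_on_subset)

lemma measurable_cis [measurable]: "(\<lambda>t. cis (c * t)) \<in> borel_measurable circle_measure"
  "(\<lambda>t. cis (- (c * t))) \<in> borel_measurable circle_measure"
  by (intro measurable_circle_continuous continuous_intros)+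

lemma integral_cis: "(LINT t|circle_measure. cis (of_int k * t)) = (if k = 0 then 2 * pi else 0)"
proof -
  have "integrable circle_measure (\<lambda>t. cis (of_int k * t))"
    by (rule integrable_circle[of _ 1]) auto
  then have "(LINT t|circle_measure. cis (of_int k * t)) = integral {0..2 * pi} (\<lambda>t. cis (of_int k * t))"
    by (rule lebesgue_integral_eq_integral) auto
  also have "\<dots> = (if k = 0 then 2 * pi else 0)"
  proof (cases "k = 0")
    case False
    have "((\<lambda>t. cis (of_int k * t)) has_integral
        (cis (of_int k * (2 * pi)) / (\<i> * of_int k) - cis (of_int k * 0) / (\<i> * of_int k))) {0..2 * pi}"
    proof (rule fundamental_theorem_of_calculus)
      fix t :: real
      show "((\<lambda>t. cis (of_int k * t) / (\<i> * of_int k)) has_vector_derivative cis (of_int k * t)) (at t within {0..2 * pi})"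
      proof -
        have "((\<lambda>z. exp (\<i> * of_int k * z) / (\<i> * of_int k)) has_field_derivative
            exp (\<i> * of_int k * of_real t)) (at (of_real t))"
          using False by (auto intro!: derivative_eq_intros)
        from has_vector_derivative_real_field[OF this] show ?thesis
          by (simp add: cis_conv_exp mult.assoc)
      qed
    qed simp
    moreover have "cis (of_int k * (2 * pi)) = 1"
      using cis_multiple_2pi[of "of_int k"] by (simp add: mult_ac)
    ultimately show ?thesis using False by (simp add: integral_unique)
  qed (simp add: scaleR_conv_of_real)
  finally show ?thesis .
qed

lemma cis_int_diff: "cis (of_int (k - j) * t) = cis (of_int k * t) * cis (- (of_int j * t))"
  by (simp add: cis_mult algebra_simps)

lemma trig_poly_norm_sq:
  assumes S: "finite S"
  shows "(LINT t|circle_measure. (norm (\<Sum>k\<in>S. y k * cis (of_int k * t)))\<^sup>2) = 2 * pi * (\<Sum>k\<in>S. (norm (y k))\<^sup>2)"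
proof -
  define P where "P t = (\<Sum>k\<in>S. y k * cis (of_int k * t))" for t
  have "complex_of_real (LINT t|circle_measure. (norm (P t))\<^sup>2) = (LINT t|circle_measure. P t * cnj (P t))"
    by (subst integral_complex_of_real[symmetric]) (simp only: complex_norm_square)
  also have "(\<lambda>t. P t * cnj (P t)) = (\<lambda>t. \<Sum>k\<in>S. \<Sum>j\<in>S. y k * cnj (y j) * cis (of_int (k - j) * t))"
    unfolding P_def cnj_sum sum_product cis_int_diff
    by (intro ext sum.cong refl) (simp add: cis_cnj)
  also have "(LINT t|circle_measure. (\<Sum>k\<in>S. \<Sum>j\<in>S. y k * cnj (y j) * cis (of_int (k - j) * t)))
      = (\<Sum>k\<in>S. \<Sum>j\<in>S. y k * cnj (y j) * (if k = j then 2 * pi else 0))"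
  proof -
    have i: "integrable circle_measure (\<lambda>t. c * cis (of_int (k - j) * t))" for c k j
      by (rule integrable_circle[of _ "norm c"]) (auto simp: norm_mult)
    have e: "(LINT t|circle_measure. c * cis (of_int (k - j) * t)) = c * (if k = j then 2 * pi else 0)" for c k j
    proof -
      have "(LINT t|circle_measure. c * cis (of_int (k - j) * t)) = c * (LINT t|circle_measure. cis (of_int (k - j) * t))"
        by (rule integral_mult_right_zero)
      then show ?thesis by (simp only: integral_cis) auto
    qed
    show ?thesis
      apply (subst Bochner_Integration.integral_sum)
       apply (intro Bochner_Integration.integrable_sum i)
      apply (intro sum.cong refl)
      apply (subst Bochner_Integration.integral_sum)
       apply (rule i)
      apply (intro sum.cong refl e)
      done
  qed
  also have "\<dots> = complex_of_real (2 * pi * (\<Sum>k\<in>S. (norm (y k))\<^sup>2))"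
  proof -
    have "(\<Sum>j\<in>S. y k * cnj (y j) * (if k = j then 2 * pi else 0)) = complex_of_real (2 * pi * (norm (y k))\<^sup>2)"
      if "k \<in> S" for k
    proof -
      have "(\<Sum>j\<in>S. y k * cnj (y j) * complex_of_real (if k = j then 2 * pi else 0)) = (\<Sum>j\<in>S. if k = j then y k * cnj (y k) * (2 * pi) else 0)"
        by (intro sum.cong) auto
      also have "\<dots> = y k * cnj (y k) * (2 * pi)" using S that by simp
      finally show ?thesis by (simp only: of_real_mult complex_norm_square mult_ac)
    qed
    then show ?thesis by (simp add: sum_distrib_left)
  qed
  finally show ?thesis by (simp only: of_real_eq_iff P_def)
qed

lemma bessel:
  assumes G [measurable]: "G \<in> borel_measurable circle_measure" and B: "\<And>t. norm (G t) \<le> B" and S: "finite S"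
  shows "(\<Sum>k\<in>S. (norm (fourier_coeff G k))\<^sup>2) \<le> (LINT t|circle_measure. (norm (G t))\<^sup>2) / (2 * pi)"
proof -
  define P where "P t = (\<Sum>k\<in>S. fourier_coeff G k * cis (of_int k * t))" for t
  define Q where "Q = (\<Sum>k\<in>S. (norm (fourier_coeff G k))\<^sup>2)"
  have [measurable]: "cnj \<in> borel_measurable borel"
    by (intro borel_measurable_continuous_onI continuous_intros)
  have PB: "norm (P t) \<le> (\<Sum>k\<in>S. norm (fourier_coeff G k))" for t
    unfolding P_def by (rule order_trans[OF norm_sum]) (simp add: norm_mult)
  have P [measurable]: "P \<in> borel_measurable circle_measure"
    unfolding P_def by measurable
  have iGc: "integrable circle_measure (\<lambda>t. G t * cis (- (of_int k * t)))" for k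
    by (rule integrable_circle[of _ B]) (auto simp: norm_mult B)
  have B0: "B \<ge> 0" using order_trans[OF norm_ge_zero B] .
  have iGP: "integrable circle_measure (\<lambda>t. G t * cnj (P t))"
    by (rule integrable_circle[of _ "B * (\<Sum>k\<in>S. norm (fourier_coeff G k))"]) (auto simp: norm_mult intro!: mult_mono B PB B0)
  have iGG: "integrable circle_measure (\<lambda>t. (norm (G t))\<^sup>2)"
    by (rule integrable_circle[of _ "B\<^sup>2"]) (auto intro!: power_mono B)
  have iPP: "integrable circle_measure (\<lambda>t. (norm (P t))\<^sup>2)"
    by (rule integrable_circle[of _ "(\<Sum>k\<in>S. norm (fourier_coeff G k))\<^sup>2"]) (auto intro!: power_mono PB)
  have GP: "(LINT t|circle_measure. G t * cnj (P t)) = 2 * pi * Q"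
  proof -
    have "(LINT t|circle_measure. G t * cnj (P t)) = (LINT t|circle_measure. (\<Sum>k\<in>S. cnj (fourier_coeff G k) * (G t * cis (- (of_int k * t)))))"
      by (intro Bochner_Integration.integral_cong) (auto simp: P_def cnj_sum sum_distrib_left cis_cnj intro!: sum.cong)
    also have "\<dots> = (\<Sum>k\<in>S. cnj (fourier_coeff G k) * (2 * pi * fourier_coeff G k))"
      by (subst Bochner_Integration.integral_sum) (auto simp: iGc fourier_coeff_def)
    also have "\<dots> = 2 * pi * Q"
      unfolding Q_def of_real_sum of_real_mult sum_distrib_left
      by (intro sum.cong) (auto simp: complex_norm_square mult_ac simp del: of_real_power)
    finally show ?thesis .
  qed
  have PP: "(LINT t|circle_measure. (norm (P t))\<^sup>2) = 2 * pi * Q"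
    unfolding P_def Q_def by (rule trig_poly_norm_sq[OF S])
  define R where "R t = Re (G t * cnj (P t))" for t
  have iR: "integrable circle_measure R"
    unfolding R_def using iGP by (rule integrable_Re)
  have R: "(LINT t|circle_measure. R t) = 2 * pi * Q"
    unfolding R_def using integral_Re[OF iGP] GP by simp
  have "0 \<le> (LINT t|circle_measure. (norm (G t - P t))\<^sup>2)" by simp
  also have "(\<lambda>t. (norm (G t - P t))\<^sup>2) = (\<lambda>t. (norm (G t))\<^sup>2 + (norm (P t))\<^sup>2 - 2 * R t)"
    by (auto simp: fun_eq_iff cmod_power2 R_def) (auto simp: power2_eq_square algebra_simps)
  also have "(LINT t|circle_measure. \<dots> t) = (LINT t|circle_measure. (norm (G t))\<^sup>2) + 2 * pi * Q - 2 * (2 * pi * Q)"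
    using iGG iPP iR PP R by simp
  finally show ?thesis by (simp add: Q_def[symmetric] field_simps)
qed

lemma fourier_coeff_shift: "fourier_coeff (\<lambda>t. G t * cis (- (of_int j * t))) k = fourier_coeff G (k + j)"
proof -
  have "cis (- (of_int j * t)) * cis (- (of_int k * t)) = cis (- (of_int (k + j) * t))" for t
    by (simp add: cis_mult algebra_simps)
  then show ?thesis by (simp only: fourier_coeff_def mult.assoc)
qed

lemma fourier_coeff_sum:
  assumes "\<And>i. i \<in> I \<Longrightarrow> H i \<in> borel_measurable circle_measure" "\<And>i t. i \<in> I \<Longrightarrow> norm (H i t) \<le> B"
  shows "fourier_coeff (\<lambda>t. \<Sum>i\<in>I. y i * H i t) k = (\<Sum>i\<in>I. y i * fourier_coeff (H i) k)"
proof -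
  have "integrable circle_measure (\<lambda>t. H i t * cis (- (of_int k * t)))" if "i \<in> I" for i
    by (rule integrable_circle[of _ B]) (use assms that in \<open>auto simp: norm_mult\<close>)
  then show ?thesis
    unfolding fourier_coeff_def sum_distrib_right
    by (subst Bochner_Integration.integral_sum) (auto simp: sum_divide_distrib mult.assoc)
qed

lemma continuous_trig_series:
  assumes c: "summable (\<lambda>n. norm (c n))"
  shows "continuous_on UNIV (\<lambda>t. \<Sum>n. c n * cis (of_nat n * t))"
proof -
  have "uniform_limit UNIV (\<lambda>m t. \<Sum>n<m. c n * cis (of_nat n * t)) (\<lambda>t. \<Sum>n. c n * cis (of_nat n * t)) sequentially"
    by (rule Weierstrass_m_test[OF _ c]) (auto simp: norm_mult)
  then show ?thesis
    by (rule uniform_limit_theorem[rotated]) (auto intro!: always_eventually continuous_intros)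
qed

lemma norm_trig_series_le:
  assumes c: "summable (\<lambda>n. norm (c n))"
  shows "norm (\<Sum>n. c n * cis (of_nat n * t)) \<le> (\<Sum>n. norm (c n))"
  using summable_norm[of "\<lambda>n. c n * cis (of_nat n * t)"] c by (simp add: norm_mult)

lemma fourier_coeff_trig_series:
  assumes c: "summable (\<lambda>n. norm (c n))"
  shows "fourier_coeff (\<lambda>t. \<Sum>n. c n * cis (of_nat n * t)) (int k) = c k"
proof -
  define G where "G t = (\<Sum>n. c n * cis (of_nat n * t))" for t
  have sm: "summable (\<lambda>n. norm (c n * cis (of_nat n * t)))" for t using c by (simp add: norm_mult)
  have int: "integrable circle_measure (\<lambda>t. c n * cis (of_int (int n - int k) * t))" for n
    by (rule integrable_circle[of _ "norm (c n)"]) (auto simp: norm_mult)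
  have i1: "(LINT t|circle_measure. norm (c n * cis (of_int (int n - int k) * t))) = 2 * pi * norm (c n)" for n
    by (simp add: norm_mult measure_restrict_space)
  have "(LINT t|circle_measure. G t * cis (- (of_int (int k) * t))) = (LINT t|circle_measure. (\<Sum>n. c n * cis (of_int (int n - int k) * t)))"
  proof (rule Bochner_Integration.integral_cong[OF refl])
    fix t
    have "G t * cis (- (of_int (int k) * t)) = (\<Sum>n. c n * cis (of_nat n * t) * cis (- (of_int (int k) * t)))"
      unfolding G_def by (rule suminf_mult2[OF summable_norm_cancel[OF sm]])
    also have "\<dots> = (\<Sum>n. c n * cis (of_int (int n - int k) * t))"
      by (simp add: mult.assoc cis_mult algebra_simps)
    finally show "G t * cis (- (of_int (int k) * t)) = (\<Sum>n. c n * cis (of_int (int n - int k) * t))" .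
  qed
  also have "\<dots> = (\<Sum>n. LINT t|circle_measure. c n * cis (of_int (int n - int k) * t))"
  proof (rule integral_suminf[OF int])
    show "AE t in circle_measure. summable (\<lambda>n. norm (c n * cis (of_int (int n - int k) * t)))"
      using c by (simp add: norm_mult)
    show "summable (\<lambda>n. LINT t|circle_measure. norm (c n * cis (of_int (int n - int k) * t)))"
      unfolding i1 by (intro summable_mult c)
  qed
  also have "(\<lambda>n. LINT t|circle_measure. c n * cis (of_int (int n - int k) * t)) = (\<lambda>n. if n = k then c k * (2 * pi) else 0)"
  proof
    fix n
    show "(LINT t|circle_measure. c n * cis (of_int (int n - int k) * t)) = (if n = k then c k * (2 * pi) else 0)"
      using integral_cis[of "int n - int k"] by (auto simp del: of_int_diff)
  qed
  also have "suminf \<dots> = c k * (2 * pi)"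
    using sums_single[of k "\<lambda>_. c k * (2 * pi)"] by (simp add: sums_iff)
  finally have "fourier_coeff G (int k) = c k" by (simp add: fourier_coeff_def)
  then show ?thesis by (simp only: G_def[abs_def])
qed

text \<open>
  The matrix \<open>c (i + j)\<close> maps y to Fourier coefficients of the product of the series c with
  the trigonometric polynomial \<open>Y t = (\<Sum>i. y i * cis (- i t))\<close>. So Bessel's inequality bounds
  its operator norm by the supremum of the series.
\<close>
lemma hankel_operator_bound:
  assumes c: "summable (\<lambda>n. norm (c n))"
    and M: "\<And>t. norm (\<Sum>n. c n * cis (of_nat n * t)) \<le> M"
  shows "(\<Sum>j<K. (norm (\<Sum>i<K'. c (i + j) * y i))\<^sup>2) \<le> M\<^sup>2 * (\<Sum>i<K'. (norm (y i))\<^sup>2)"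
proof -
  define G where "G t = (\<Sum>n. c n * cis (of_nat n * t))" for t
  have G: "continuous_on UNIV G" "\<And>k. fourier_coeff G (int k) = c k"
    unfolding G_def[abs_def] by (rule continuous_trig_series[OF c], rule fourier_coeff_trig_series[OF c])
  define Y where "Y t = (\<Sum>i<K'. y i * cis (- (of_nat i * t)))" for t
  have M': "norm (G t) \<le> M" for t using M by (simp add: G_def)
  have M0: "M \<ge> 0" using order_trans[OF norm_ge_zero M] .
  have Gm [measurable]: "G \<in> borel_measurable circle_measure" by (intro measurable_circle_continuous G)
  have Ym [measurable]: "Y \<in> borel_measurable circle_measure" unfolding Y_def by measurable
  have YB: "norm (Y t) \<le> (\<Sum>i<K'. norm (y i))" for t
    unfolding Y_def by (rule order_trans[OF norm_sum]) (simp add: norm_mult)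
  define H where "H t = G t * Y t" for t
  have HB: "norm (H t) \<le> M * (\<Sum>i<K'. norm (y i))" for t
    unfolding H_def norm_mult by (intro mult_mono M' YB M0) auto
  have Hm [measurable]: "H \<in> borel_measurable circle_measure" unfolding H_def by measurable
  have fcH: "fourier_coeff H (int j) = (\<Sum>i<K'. c (i + j) * y i)" for j
  proof -
    have "H = (\<lambda>t. \<Sum>i<K'. y i * (G t * cis (- (of_int (int i) * t))))"
      by (auto simp: H_def Y_def fun_eq_iff sum_distrib_left intro!: sum.cong)
    moreover have "fourier_coeff \<dots> (int j) = (\<Sum>i<K'. y i * fourier_coeff (\<lambda>t. G t * cis (- (of_int (int i) * t))) (int j))"
      by (rule fourier_coeff_sum[where B = M]) (auto simp: norm_mult M')
    moreover have "\<dots> = (\<Sum>i<K'. c (i + j) * y i)"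
      unfolding fourier_coeff_shift of_nat_add[symmetric] G(2) by (intro sum.cong) (auto simp: mult.commute add.commute)
    ultimately show ?thesis by simp
  qed
  have YY: "(LINT t|circle_measure. (norm (Y t))\<^sup>2) = 2 * pi * (\<Sum>i<K'. (norm (y i))\<^sup>2)"
  proof -
    have "(LINT t|circle_measure. (norm (Y t))\<^sup>2) =
        (LINT t|circle_measure. (norm (\<Sum>k\<in>(\<lambda>i. - int i) ` {..<K'}. y (nat (- k)) * cis (of_int k * t)))\<^sup>2)"
      unfolding Y_def by (subst sum.reindex) (auto simp: inj_on_def)
    also have "\<dots> = 2 * pi * (\<Sum>k\<in>(\<lambda>i. - int i) ` {..<K'}. (norm (y (nat (- k))))\<^sup>2)"
      by (rule trig_poly_norm_sq) auto
    also have "\<dots> = 2 * pi * (\<Sum>i<K'. (norm (y i))\<^sup>2)"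
      by (subst sum.reindex) (auto simp: inj_on_def)
    finally show ?thesis .
  qed
  have "(\<Sum>j<K. (norm (\<Sum>i<K'. c (i + j) * y i))\<^sup>2) = (\<Sum>k\<in>int ` {..<K}. (norm (fourier_coeff H k))\<^sup>2)"
    by (subst sum.reindex) (auto simp: fcH)
  also have "\<dots> \<le> (LINT t|circle_measure. (norm (H t))\<^sup>2) / (2 * pi)"
    by (rule bessel[OF Hm HB]) auto
  also have "\<dots> \<le> (LINT t|circle_measure. M\<^sup>2 * (norm (Y t))\<^sup>2) / (2 * pi)"
  proof (intro divide_right_mono integral_mono)
    show "integrable circle_measure (\<lambda>t. (norm (H t))\<^sup>2)"
      by (rule integrable_circle[of _ "(M * (\<Sum>i<K'. norm (y i)))\<^sup>2"]) (auto intro!: power_mono HB)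
    show "integrable circle_measure (\<lambda>t. M\<^sup>2 * (norm (Y t))\<^sup>2)"
      by (rule integrable_circle[of _ "M\<^sup>2 * (\<Sum>i<K'. norm (y i))\<^sup>2"])
        (auto intro!: mult_left_mono power_mono YB)
    show "(norm (H t))\<^sup>2 \<le> M\<^sup>2 * (norm (Y t))\<^sup>2" for t
      unfolding H_def norm_mult power_mult_distrib by (intro mult_right_mono power_mono M') auto
  qed auto
  also have "\<dots> = M\<^sup>2 * (\<Sum>i<K'. (norm (y i))\<^sup>2)"
    by (simp add: YY)
  finally show ?thesis .
qed

text \<open>
  A bound that holds pointwise on the circle for a weighted sum of squares of several series
  passes to the coefficients, after integration.
\<close>
lemma bessel_average:
  assumes c: "\<And>k. k < K \<Longrightarrow> summable (\<lambda>n. norm (c k n))" and w: "\<And>k. w k \<ge> (0::real)"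
    and M: "\<And>t. (\<Sum>k<K. w k * (norm (\<Sum>n. c k n * cis (of_nat n * t)))\<^sup>2) \<le> M"
  shows "(\<Sum>k<K. w k * (\<Sum>l<N. (norm (c k l))\<^sup>2)) \<le> M"
proof -
  define G where "G k t = (\<Sum>n. c k n * cis (of_nat n * t))" for k t
  have G: "G k \<in> borel_measurable circle_measure" "\<And>t. norm (G k t) \<le> (\<Sum>n. norm (c k n))"
    "fourier_coeff (G k) (int l) = c k l" if "k < K" for k l
    using continuous_trig_series[OF c[OF that]] fourier_coeff_trig_series[OF c[OF that]] norm_trig_series_le[OF c[OF that]]
    by (auto simp: G_def[abs_def] intro: measurable_circle_continuous)
  have i: "integrable circle_measure (\<lambda>t. (norm (G k t))\<^sup>2)" if "k < K" for k
    by (rule integrable_circle[of _ "(\<Sum>n. norm (c k n))\<^sup>2"]) (use G(1,2)[OF that] in \<open>auto intro!: power_mono\<close>)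
  have "(\<Sum>k<K. w k * (\<Sum>l<N. (norm (c k l))\<^sup>2)) \<le> (\<Sum>k<K. w k * ((LINT t|circle_measure. (norm (G k t))\<^sup>2) / (2 * pi)))"
  proof (intro sum_mono mult_left_mono w)
    fix k assume k: "k \<in> {..<K}"
    have "(\<Sum>l<N. (norm (c k l))\<^sup>2) = (\<Sum>l\<in>int ` {..<N}. (norm (fourier_coeff (G k) l))\<^sup>2)"
      using k by (subst sum.reindex) (auto simp: G)
    also have "\<dots> \<le> (LINT t|circle_measure. (norm (G k t))\<^sup>2) / (2 * pi)"
      by (rule bessel) (use G k in auto)
    finally show "(\<Sum>l<N. (norm (c k l))\<^sup>2) \<le> (LINT t|circle_measure. (norm (G k t))\<^sup>2) / (2 * pi)" .
  qed
  also have "\<dots> = (LINT t|circle_measure. (\<Sum>k<K. w k * (norm (G k t))\<^sup>2)) / (2 * pi)"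
    by (subst Bochner_Integration.integral_sum) (auto simp: i sum_divide_distrib)
  also have "\<dots> \<le> (LINT t|circle_measure. M) / (2 * pi)"
    by (intro divide_right_mono integral_mono)
       (use i M in \<open>auto simp: G_def finite_measure.integrable_const[OF finite_measure_circle]\<close>)
  also have "\<dots> = M" by (simp add: measure_restrict_space)
  finally show ?thesis .
qed

section \<open>Hankel matrices of rational functions\<close>

text \<open>
  The squared Hilbert-Schmidt norm is the sum, over an orthonormal basis of the span of the rows,
  of squared lengths that are each at most the squared operator norm B. The induction splits off one
  spanning vector V at a time: P is the orthogonal projection onto the complement of V, applying it to
  the rows leaves d spanning vectors, and it does not increase the operator norm.
\<close>
lemma hilbert_schmidt_le_rank:
  fixes h :: "nat \<Rightarrow> nat \<Rightarrow> complex"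
  assumes "\<And>j i. j < K \<Longrightarrow> i < K \<Longrightarrow> h j i = (\<Sum>t<d. x j t * v t i)"
    and "\<And>y. (\<Sum>j<K. (norm (\<Sum>i<K. h j i * y i))\<^sup>2) \<le> B * (\<Sum>i<K. (norm (y i))\<^sup>2)"
    and "B \<ge> 0"
  shows "(\<Sum>j<K. \<Sum>i<K. (norm (h j i))\<^sup>2) \<le> real d * B"
  using assms(1,2)
proof (induction d arbitrary: h v)
  case 0
  then show ?case by simp
next
  case (Suc d)
  define V where "V = v d"
  define s where "s = (\<Sum>i<K. (norm (V i))\<^sup>2)"
  show ?case
  proof (cases "s = 0")
    case True
    then have V0: "V i = 0" if "i < K" for i
      using that unfolding s_def by (subst (asm) sum_nonneg_eq_0_iff) auto
    have "(\<Sum>j<K. \<Sum>i<K. (norm (h j i))\<^sup>2) \<le> real d * B"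
      by (rule Suc.IH[of h v]) (use Suc.prems V0 in \<open>auto simp: V_def\<close>)
    then show ?thesis using assms(3) by (simp add: algebra_simps)
  next
    case False
    then have s: "s > 0"
      unfolding s_def by (simp add: less_le sum_nonneg)
    have VV: "(\<Sum>i<K. V i * cnj (V i)) = of_real s"
      unfolding s_def of_real_sum by (intro sum.cong refl) (simp only: complex_norm_square)
    define \<alpha> where "\<alpha> u = (\<Sum>i<K. u i * cnj (V i)) / of_real s" for u
    define P where "P u i = u i - \<alpha> u * V i" for u i
    have orth: "(\<Sum>i<K. P u i * cnj (V i)) = 0" for u
      using s VV by (simp add: P_def left_diff_distrib sum_subtractf mult.assoc flip: sum_distrib_left)
        (simp add: \<alpha>_def)
    have pyth: "(\<Sum>i<K. (norm (u i))\<^sup>2) = (\<Sum>i<K. (norm (P u i))\<^sup>2) + (norm (\<alpha> u))\<^sup>2 * s" for u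
    proof -
      have "complex_of_real (\<Sum>i<K. (norm (u i))\<^sup>2) = (\<Sum>i<K. (P u i + \<alpha> u * V i) * cnj (P u i + \<alpha> u * V i))"
        unfolding of_real_sum by (intro sum.cong refl) (simp only: complex_norm_square P_def diff_add_cancel)
      also have "\<dots> = (\<Sum>i<K. P u i * cnj (P u i)) + cnj (\<alpha> u) * (\<Sum>i<K. P u i * cnj (V i))
          + \<alpha> u * cnj (\<Sum>i<K. P u i * cnj (V i)) + \<alpha> u * cnj (\<alpha> u) * (\<Sum>i<K. V i * cnj (V i))"
        by (simp add: cnj_sum sum_distrib_left sum.distrib ring_distribs mult_ac)
      also have "\<dots> = complex_of_real ((\<Sum>i<K. (norm (P u i))\<^sup>2) + (norm (\<alpha> u))\<^sup>2 * s)"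
        by (simp only: orth VV of_real_add of_real_sum of_real_mult complex_norm_square) simp
      finally show ?thesis by (simp only: of_real_eq_iff)
    qed
    have linear_form: "\<alpha> (h j) = (\<Sum>t<d. x j t * \<alpha> (v t)) + x j d" if j: "j < K" for j
    proof -
      have "(\<Sum>i<K. h j i * cnj (V i)) = (\<Sum>i<K. \<Sum>t<Suc d. x j t * (v t i * cnj (V i)))"
        using Suc.prems(1)[OF j] by (intro sum.cong) (auto simp: sum_distrib_right mult.assoc ring_distribs)
      also have "\<dots> = (\<Sum>t<Suc d. x j t * (\<Sum>i<K. v t i * cnj (V i)))"
        by (subst sum.swap) (simp add: sum_distrib_left)
      also have "\<dots> = (\<Sum>t<d. x j t * (\<Sum>i<K. v t i * cnj (V i))) + x j d * of_real s"
        using VV by (simp add: V_def)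
      finally show ?thesis using s by (simp add: \<alpha>_def add_divide_distrib flip: sum_divide_distrib)
    qed
    have "(\<Sum>j<K. \<Sum>i<K. (norm (P (h j) i))\<^sup>2) \<le> real d * B"
    proof (rule Suc.IH[of "\<lambda>j. P (h j)" "\<lambda>t. P (v t)"])
      fix j i assume ji: "j < K" "i < K"
      show "P (h j) i = (\<Sum>t<d. x j t * P (v t) i)"
        unfolding P_def linear_form[OF ji(1)] Suc.prems(1)[OF ji]
        by (simp add: V_def algebra_simps sum_subtractf sum_distrib_left)
    next
      fix y :: "nat \<Rightarrow> complex"
      define y' where "y' i = cnj (P (\<lambda>i. cnj (y i)) i)" for i
      have "(\<Sum>i<K. P (h j) i * y i) = (\<Sum>i<K. h j i * y' i)" for j
      proof -
        have a: "(\<Sum>i<K. P (h j) i * y i) = (\<Sum>i<K. h j i * y i) - \<alpha> (h j) * (\<Sum>i<K. V i * y i)"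
          by (simp add: P_def left_diff_distrib sum_subtractf mult.assoc flip: sum_distrib_left)
        have b: "cnj (\<alpha> (\<lambda>i. cnj (y i))) = (\<Sum>i<K. V i * y i) / of_real s"
          by (simp add: \<alpha>_def cnj_sum mult.commute)
        have "(\<Sum>i<K. h j i * y' i) = (\<Sum>i<K. h j i * y i) - cnj (\<alpha> (\<lambda>i. cnj (y i))) * (\<Sum>i<K. h j i * cnj (V i))"
          by (simp add: y'_def P_def right_diff_distrib sum_subtractf mult_ac sum_distrib_left)
        also have "\<dots> = (\<Sum>i<K. h j i * y i) - \<alpha> (h j) * (\<Sum>i<K. V i * y i)"
          unfolding b by (simp add: \<alpha>_def)
        finally show ?thesis using a by simp
      qed
      then have "(\<Sum>j<K. (norm (\<Sum>i<K. P (h j) i * y i))\<^sup>2) \<le> B * (\<Sum>i<K. (norm (y' i))\<^sup>2)"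
        using Suc.prems(2)[of y'] by simp
      also have "(\<Sum>i<K. (norm (y' i))\<^sup>2) \<le> (\<Sum>i<K. (norm (y i))\<^sup>2)"
        using pyth[of "\<lambda>i. cnj (y i)"] s by (simp add: y'_def)
      finally show "(\<Sum>j<K. (norm (\<Sum>i<K. P (h j) i * y i))\<^sup>2) \<le> B * (\<Sum>i<K. (norm (y i))\<^sup>2)"
        using assms(3) by (simp add: mult_left_mono)
    qed
    moreover have "(\<Sum>j<K. (norm (\<alpha> (h j)))\<^sup>2 * s) \<le> B"
    proof -
      have "(\<Sum>j<K. (norm (\<alpha> (h j)))\<^sup>2 * s) = (\<Sum>j<K. (norm (\<Sum>i<K. h j i * cnj (V i)))\<^sup>2) / s"
        unfolding sum_divide_distrib[of "\<lambda>j. (norm (\<Sum>i<K. h j i * cnj (V i)))\<^sup>2"]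
        by (intro sum.cong refl) (use s in \<open>simp add: \<alpha>_def norm_divide power2_eq_square\<close>)
      also have "\<dots> \<le> (B * (\<Sum>i<K. (norm (cnj (V i)))\<^sup>2)) / s"
        by (intro divide_right_mono Suc.prems(2)) (use s in auto)
      also have "\<dots> = B" using s by (simp add: s_def)
      finally show ?thesis .
    qed
    ultimately show ?thesis
      by (subst pyth) (simp add: sum.distrib algebra_simps)
  qed
qed

text \<open>
  Kronecker's observation: if b satisfies a linear recurrence, then all its shifts are
  linear combinations of finitely many of them.
\<close>
lemma recurrence_span:
  fixes b c :: "nat \<Rightarrow> complex"
  assumes rec: "\<And>k. k > n \<Longrightarrow> (\<Sum>s\<le>k. c s * b (k - s)) = 0"
    and c0: "c 0 \<noteq> 0" and cn: "\<And>s. s > n \<Longrightarrow> c s = 0"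
  shows "\<exists>x. \<forall>i. b (i + j) = (\<Sum>t<Suc n. x t * b (i + t))"
proof (induction j rule: less_induct)
  case (less j)
  show ?case
  proof (cases "j \<le> n")
    case True
    then show ?thesis
      by (intro exI[of _ "\<lambda>t. if t = j then 1 else 0"]) (simp add: if_distrib[of "\<lambda>z. z * _"] cong: if_cong)
  next
    case False
    from less have "\<forall>m. \<exists>x. m < j \<longrightarrow> (\<forall>i. b (i + m) = (\<Sum>t<Suc n. x t * b (i + t)))" by blast
    then obtain X where X: "\<And>m i. m < j \<Longrightarrow> b (i + m) = (\<Sum>t<Suc n. X m t * b (i + t))" by metis
    define A where "A t = (\<Sum>s\<in>{1..n}. c s * X (j - s) t)" for t
    show ?thesis
    proof (intro exI[of _ "\<lambda>t. - A t / c 0"] allI)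
      fix i
      have "0 = (\<Sum>s\<le>i + j. c s * b (i + j - s))"
        using rec[of "i + j"] False by simp
      also have "\<dots> = (\<Sum>s\<in>insert 0 {1..n}. c s * b (i + j - s))"
        by (rule sum.mono_neutral_right) (use False cn in auto)
      also have "\<dots> = c 0 * b (i + j) + (\<Sum>s\<in>{1..n}. c s * b (i + j - s))" by simp
      also have "(\<Sum>s\<in>{1..n}. c s * b (i + j - s)) = (\<Sum>s\<in>{1..n}. c s * (\<Sum>t<Suc n. X (j - s) t * b (i + t)))"
      proof (intro sum.cong refl)
        fix s assume s: "s \<in> {1..n}"
        then have "i + j - s = i + (j - s)" "j - s < j" using False by auto
        then show "c s * b (i + j - s) = c s * (\<Sum>t<Suc n. X (j - s) t * b (i + t))"
          using X by simp
      qed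
      also have "\<dots> = (\<Sum>t<Suc n. A t * b (i + t))"
        unfolding A_def sum_distrib_left sum_distrib_right by (subst sum.swap) (simp add: mult.assoc)
      finally have "c 0 * b (i + j) = - (\<Sum>t<Suc n. A t * b (i + t))"
        by (metis eq_neg_iff_add_eq_0)
      then have "b (i + j) = - (\<Sum>t<Suc n. A t * b (i + t)) / c 0"
        using c0 by (simp add: field_simps)
      then show "b (i + j) = (\<Sum>t<Suc n. - A t / c 0 * b (i + t))"
        by (simp add: sum_divide_distrib sum_negf del: sum.lessThan_Suc)
    qed
  qed
qed

section \<open>Estimates on fibers\<close>

lemma le_at_one_if_le_below:
  fixes f :: "real \<Rightarrow> real"
  assumes "isCont f 1" "\<And>\<rho>. 0 < \<rho> \<Longrightarrow> \<rho> < 1 \<Longrightarrow> f \<rho> \<le> C"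
  shows "f 1 \<le> C"
proof (rule tendsto_upperbound)
  show "(f \<longlongrightarrow> f 1) (at_left 1)"
    using assms(1) unfolding continuous_at by (rule tendsto_within_subset) simp
  have "eventually (\<lambda>\<rho>. \<rho> \<in> {0<..<1}) (at_left (1::real))"
    by (rule eventually_at_leftI[of 0]) auto
  then show "eventually (\<lambda>\<rho>. f \<rho> \<le> C) (at_left 1)"
    by eventually_elim (use assms(2) in auto)
qed auto

lemma polar_cis: "(of_real \<rho> * cis t) ^ n = of_real (\<rho> ^ n) * cis (of_nat n * t)"
  by (simp add: power_mult_distrib Complex.DeMoivre)

text \<open>
  With c the coefficients of \<open>F(\<rho> z)\<close>, the value \<open>|c k|^2\<close> occurs
  \<open>k + 1\<close> times in the Hankel matrix \<open>c (i + j)\<close>. The equation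
  \<open>q F = p\<close> is a recurrence for b, so the rank is at most \<open>n + 1\<close>, and the operator
  norm is at most M. This replaces the area of the image, counted with multiplicity.
\<close>
lemma rational_dirichlet_bound:
  fixes b :: "nat \<Rightarrow> complex"
  assumes sums: "\<And>z. norm z < 1 \<Longrightarrow> (\<lambda>k. b k * z ^ k) sums F z"
    and eq: "\<And>z. norm z < 1 \<Longrightarrow> poly q z * F z = poly p z"
    and deg: "degree p \<le> n" "degree q \<le> n" and q0: "poly q 0 \<noteq> 0"
    and M: "\<And>z. norm z < 1 \<Longrightarrow> norm (F z) \<le> M"
  shows "(\<Sum>k<K. real (k + 1) * (norm (b k))\<^sup>2) \<le> real (n + 1) * M\<^sup>2"
proof -
  have rad: "fps_conv_radius (Abs_fps b) \<ge> 1"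
    unfolding fps_conv_radius_def
  proof (rule conv_radius_geI_ex')
    fix r :: real assume "0 < r" "ereal r < 1"
    then show "summable (\<lambda>n. fps_nth (Abs_fps b) n * of_real r ^ n)"
      using sums_summable[OF sums[of "of_real r"]] by simp
  qed
  have "F has_fps_expansion Abs_fps b"
    unfolding has_fps_expansion_def
  proof
    show "fps_conv_radius (Abs_fps b) > 0" using rad by (rule less_le_trans[rotated]) auto
    have "eventually (\<lambda>z::complex. z \<in> ball 0 1) (nhds 0)" by (intro eventually_nhds_in_open) auto
    then show "eventually (\<lambda>z. eval_fps (Abs_fps b) z = F z) (nhds 0)"
      by eventually_elim (use sums in \<open>auto simp: eval_fps_def sums_iff\<close>)
  qed
  then have "(\<lambda>z. poly q z * F z) has_fps_expansion fps_of_poly q * Abs_fps b"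
    by (intro has_fps_expansion_mult has_fps_expansion_poly)
  also have "?this \<longleftrightarrow> poly p has_fps_expansion fps_of_poly q * Abs_fps b"
  proof (rule has_fps_expansion_cong)
    have "eventually (\<lambda>z::complex. z \<in> ball 0 1) (nhds 0)" by (intro eventually_nhds_in_open) auto
    then show "eventually (\<lambda>z. poly q z * F z = poly p z) (nhds 0)"
      by eventually_elim (use eq in auto)
  qed simp
  finally have "fps_of_poly q * Abs_fps b = fps_of_poly p"
    using fps_expansion_unique_complex has_fps_expansion_poly by blast
  have conv: "(\<Sum>s\<le>k. coeff q s * b (k - s)) = coeff p k" for k
  proof -
    have "fps_nth (fps_of_poly q * Abs_fps b) k = coeff p k"
      using \<open>fps_of_poly q * Abs_fps b = fps_of_poly p\<close> by simp
    then show ?thesis by (simp add: fps_mult_nth atMost_atLeast0)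
  qed
  have "\<exists>x. \<forall>i. b (i + j) = (\<Sum>t<Suc n. x t * b (i + t))" for j
  proof (rule recurrence_span)
    show "(\<Sum>s\<le>k. coeff q s * b (k - s)) = 0" if "k > n" for k
      using conv[of k] deg(1) that by (simp add: coeff_eq_0)
    show "coeff q s = 0" if "s > n" for s using deg(2) that by (simp add: coeff_eq_0)
  qed (use q0 in \<open>simp add: poly_0_coeff_0\<close>)
  then obtain X where X: "\<And>j i. b (i + j) = (\<Sum>t<Suc n. X j t * b (i + t))" by metis
  have "(\<Sum>k<K. real (k + 1) * ((norm (b k))\<^sup>2 * \<rho> ^ (2 * k))) \<le> real (n + 1) * M\<^sup>2"
    if \<rho>: "0 < \<rho>" "\<rho> < 1" for \<rho>
  proof -
    define c where "c k = b k * of_real (\<rho> ^ k)" for k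
    have c_summable: "summable (\<lambda>k. norm (c k))"
    proof -
      have "summable (\<lambda>k. b k * (of_real ((1 + \<rho>) / 2)) ^ k)"
        by (rule sums_summable[OF sums]) (subst norm_of_real, use \<rho> in simp)
      moreover have "norm (of_real \<rho> :: complex) < norm (of_real ((1 + \<rho>) / 2) :: complex)"
        unfolding norm_of_real using \<rho> by simp
      ultimately have "summable (\<lambda>k. norm (b k * of_real \<rho> ^ k))"
        by (rule powser_insidea)
      then show ?thesis by (simp add: c_def)
    qed
    have cM: "norm (\<Sum>k. c k * cis (of_nat k * t)) \<le> M" for t
    proof -
      have "(\<lambda>k. b k * (of_real \<rho> * cis t) ^ k) sums F (of_real \<rho> * cis t)"
        by (rule sums) (use \<rho> in \<open>simp add: norm_mult\<close>)
      then have "(\<Sum>k. c k * cis (of_nat k * t)) = F (of_real \<rho> * cis t)"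
        by (simp add: sums_iff c_def polar_cis mult.assoc)
      then show ?thesis using M[of "of_real \<rho> * cis t"] \<rho> by (simp add: norm_mult)
    qed
    have "(\<Sum>j<K. \<Sum>i<K. (norm (c (i + j)))\<^sup>2) \<le> real (Suc n) * M\<^sup>2"
    proof (rule hilbert_schmidt_le_rank)
      fix j i
      show "c (i + j) = (\<Sum>t<Suc n. (X j t * of_real (\<rho> ^ j)) * (b (i + t) * of_real (\<rho> ^ i)))"
        unfolding c_def X[of i j] sum_distrib_right by (intro sum.cong) (auto simp: power_add mult_ac)
    qed (use hankel_operator_bound[OF c_summable cM] in auto)
    moreover have "(\<Sum>k<K. real (k + 1) * ((norm (b k))\<^sup>2 * \<rho> ^ (2 * k))) = (\<Sum>k<K. \<Sum>i\<le>k. (norm (c (i + (k - i))))\<^sup>2)"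
    proof (intro sum.cong refl)
      fix k
      have "(norm (c k))\<^sup>2 = (norm (b k))\<^sup>2 * \<rho> ^ (2 * k)"
        using \<rho> by (simp add: c_def norm_mult norm_power power_mult_distrib power_even_eq)
      moreover have "(\<Sum>i\<le>k. (norm (c (i + (k - i))))\<^sup>2) = (\<Sum>i\<le>k. (norm (c k))\<^sup>2)"
        by (intro sum.cong) auto
      ultimately show "real (k + 1) * ((norm (b k))\<^sup>2 * \<rho> ^ (2 * k)) = (\<Sum>i\<le>k. (norm (c (i + (k - i))))\<^sup>2)"
        by simp
    qed
    moreover have "\<dots> = (\<Sum>(i, j)\<in>{(i, j). i + j < K}. (norm (c (i + j)))\<^sup>2)"
      by (rule sum.triangle_reindex[symmetric])
    moreover have "\<dots> \<le> (\<Sum>(i, j)\<in>{..<K} \<times> {..<K}. (norm (c (i + j)))\<^sup>2)"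
      by (rule sum_mono2) auto
    moreover have "\<dots> = (\<Sum>j<K. \<Sum>i<K. (norm (c (i + j)))\<^sup>2)"
      by (subst sum.cartesian_product[symmetric]) (rule sum.swap)
    ultimately show ?thesis by simp
  qed
  from le_at_one_if_le_below[of "\<lambda>\<rho>. (\<Sum>k<K. real (k + 1) * ((norm (b k))\<^sup>2 * \<rho> ^ (2 * k)))", OF _ this]
  show ?thesis by simp
qed

lemma derivative_bessel:
  fixes b :: "nat \<Rightarrow> complex"
  assumes sums: "\<And>z. norm z < 1 \<Longrightarrow> (\<lambda>k. b k * z ^ k) sums F z"
    and der: "\<And>z. norm z < 1 \<Longrightarrow> (F has_field_derivative D z) (at z)"
    and \<rho>: "0 < \<rho>" "\<rho> < 1" and M: "\<And>z. norm z = \<rho> \<Longrightarrow> norm (z * D z) \<le> M"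
  shows "(\<Sum>k<K. (real k)\<^sup>2 * \<rho> ^ (2 * k) * (norm (b k))\<^sup>2) \<le> M\<^sup>2"
proof -
  define c where "c k = of_nat k * b k * of_real (\<rho> ^ k)" for k
  have zD: "(\<lambda>k. of_nat k * b k * z ^ k) sums (z * D z)" if z: "norm z < 1" for z
  proof -
    have sm: "summable (\<lambda>k. b k * z ^ k)" if "norm z < 1" for z
      using sums[OF that] by (rule sums_summable)
    have "((\<lambda>z. \<Sum>k. b k * z ^ k) has_field_derivative (\<Sum>k. diffs b k * z ^ k)) (at z)"
      by (rule termdiffs_strong'[OF sm z])
    moreover have "((\<lambda>z. \<Sum>k. b k * z ^ k) has_field_derivative D z) (at z)"
      by (rule has_field_derivative_transform_within_open[OF der[OF z], of "ball 0 1"])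
         (use z sums in \<open>auto simp: sums_iff\<close>)
    ultimately have "D z = (\<Sum>k. diffs b k * z ^ k)" by (rule DERIV_unique[symmetric])
    moreover have "summable (\<lambda>k. diffs b k * z ^ k)"
      by (rule termdiff_converges[OF z sm])
    ultimately have "(\<lambda>k. of_nat k * b k * z ^ (k - Suc 0)) sums D z"
      using diffs_equiv by metis
    then have "(\<lambda>k. z * (of_nat k * b k * z ^ (k - Suc 0))) sums (z * D z)"
      by (rule sums_mult)
    moreover have "z * (of_nat k * b k * z ^ (k - Suc 0)) = of_nat k * b k * z ^ k" for k
      by (cases k) auto
    ultimately show ?thesis by simp
  qed
  have c_summable: "summable (\<lambda>k. norm (c k))"
  proof -
    have "summable (\<lambda>k. (of_nat k * b k) * (of_real ((1 + \<rho>) / 2)) ^ k)"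
      by (rule sums_summable[OF zD]) (subst norm_of_real, use \<rho> in simp)
    moreover have "norm (of_real \<rho> :: complex) < norm (of_real ((1 + \<rho>) / 2) :: complex)"
      unfolding norm_of_real using \<rho> by simp
    ultimately have "summable (\<lambda>k. norm (of_nat k * b k * of_real \<rho> ^ k))"
      by (rule powser_insidea)
    then show ?thesis by (simp add: c_def)
  qed
  have cM: "norm (\<Sum>k. c k * cis (of_nat k * t)) \<le> M" for t
  proof -
    have "(\<lambda>k. of_nat k * b k * (of_real \<rho> * cis t) ^ k) sums (of_real \<rho> * cis t * D (of_real \<rho> * cis t))"
      by (rule zD) (use \<rho> in \<open>simp add: norm_mult\<close>)
    then have "(\<Sum>k. c k * cis (of_nat k * t)) = of_real \<rho> * cis t * D (of_real \<rho> * cis t)"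
      by (simp add: sums_iff c_def polar_cis mult.assoc)
    then show ?thesis using M[of "of_real \<rho> * cis t"] \<rho> by (simp add: norm_mult)
  qed
  have "(\<Sum>k<K. (norm (c k))\<^sup>2) \<le> M\<^sup>2"
    using hankel_operator_bound[OF c_summable cM, where K = K and K' = 1 and y = "\<lambda>_. 1"] by simp
  then show ?thesis
    using \<rho> by (simp add: c_def norm_mult norm_power power_mult_distrib power_even_eq mult.assoc)
      (simp add: mult.commute mult.left_commute)
qed

lemma
  assumes a: "has_expansion a F"
  shows expansion_fiber_sums: "\<lbrakk>norm z < 1; norm w < 1\<rbrakk> \<Longrightarrow> (\<lambda>k. (\<Sum>l. a (k, l) * w ^ l) * z ^ k) sums F (z, w)"
    and expansion_fiber_summable: "norm w < 1 \<Longrightarrow> summable (\<lambda>l. norm (a (k, l) * w ^ l))"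
proof -
  have S: "((\<lambda>(k, l). z ^ k * (a (k, l) * w ^ l)) has_sum F (z, w)) (UNIV \<times> UNIV)" if "norm z < 1" "norm w < 1" for z w
  proof -
    have "(z, w) \<in> bidisk" using that by (simp add: bidisk_def)
    then show ?thesis using a by (auto simp: has_expansion_def case_prod_unfold mult_ac)
  qed
  have inner: "(\<lambda>l. a (k, l) * w ^ l) summable_on UNIV" if w: "norm w < 1" for w k
  proof -
    have "(\<lambda>(k, l). (1 / 2) ^ k * (a (k, l) * w ^ l)) summable_on (UNIV \<times> UNIV)"
      using S[of "1 / 2" w] w by (auto simp: summable_on_def norm_divide)
    from summable_on_SigmaD1[OF this, of k]
    have "(\<lambda>l. (1 / 2) ^ k * (a (k, l) * w ^ l)) summable_on UNIV" by simp
    then have "(\<lambda>l. 2 ^ k * ((1 / 2) ^ k * (a (k, l) * w ^ l))) summable_on UNIV"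
      by (rule summable_on_cmult_right)
    then show ?thesis by (simp add: power_divide)
  qed
  have inner_sum: "((\<lambda>l. a (k, l) * w ^ l) has_sum (\<Sum>l. a (k, l) * w ^ l)) UNIV" if "norm w < 1" for w k
    using has_sum_infsum[OF inner[OF that, of k]] has_sum_imp_sums sums_unique by metis
  show "summable (\<lambda>l. norm (a (k, l) * w ^ l))" if "norm w < 1"
    using inner[OF that, of k] summable_on_iff_abs_summable_on_complex
    by (metis summable_on_UNIV_nonneg_real_iff norm_ge_zero)
  assume z: "norm z < 1" and w: "norm w < 1"
  have "((\<lambda>k. z ^ k * (\<Sum>l. a (k, l) * w ^ l)) has_sum F (z, w)) UNIV"
    by (rule has_sum_SigmaD[OF S[OF z w]]) (use inner_sum[OF w] in \<open>auto intro: has_sum_cmult_right\<close>)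
  then show "(\<lambda>k. (\<Sum>l. a (k, l) * w ^ l) * z ^ k) sums F (z, w)"
    using has_sum_imp_sums by (simp add: mult.commute)
qed

text \<open>
  Estimates in the first variable that are uniform in the second one give estimates for the double
  series. The same radius is used for both variables, because the
  derivatives of the quotients that occur below are estimated on tori of equal radii.
\<close>
lemma fiber_average:
  assumes a: "has_expansion a F" and w: "\<And>k. w k \<ge> 0"
    and C: "\<And>\<rho> z. \<lbrakk>0 < \<rho>; \<rho> < 1; norm z = \<rho>\<rbrakk> \<Longrightarrow>
              (\<Sum>k<K. w k * \<rho> ^ (2 * k) * (norm (\<Sum>l. a (k, l) * z ^ l))\<^sup>2) \<le> C"
  shows "(\<Sum>k<K. w k * (\<Sum>l<N. (norm (a (k, l)))\<^sup>2)) \<le> C"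
proof -
  have "(\<Sum>k<K. w k * \<rho> ^ (2 * k) * (\<Sum>l<N. (norm (a (k, l)))\<^sup>2 * \<rho> ^ (2 * l))) \<le> C" if \<rho>: "0 < \<rho>" "\<rho> < 1" for \<rho>
  proof -
    have "(\<Sum>k<K. (w k * \<rho> ^ (2 * k)) * (\<Sum>l<N. (norm (a (k, l) * of_real (\<rho> ^ l)))\<^sup>2)) \<le> C"
    proof (rule bessel_average)
      show "summable (\<lambda>l. norm (a (k, l) * of_real (\<rho> ^ l)))" for k
        using expansion_fiber_summable[OF a, of "of_real \<rho>" k] \<rho> by simp
      show "w k * \<rho> ^ (2 * k) \<ge> 0" for k using w \<rho> by simp
      show "(\<Sum>k<K. w k * \<rho> ^ (2 * k) * (norm (\<Sum>l. a (k, l) * of_real (\<rho> ^ l) * cis (of_nat l * t)))\<^sup>2) \<le> C" for t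
        using C[OF \<rho>, of "of_real \<rho> * cis t"] \<rho> by (simp add: norm_mult polar_cis mult.assoc)
    qed
    then show ?thesis
      using \<rho> by (simp add: norm_mult norm_power power_mult_distrib power_even_eq)
  qed
  from le_at_one_if_le_below[of "\<lambda>\<rho>. (\<Sum>k<K. w k * \<rho> ^ (2 * k) * (\<Sum>l<N. (norm (a (k, l)))\<^sup>2 * \<rho> ^ (2 * l)))", OF _ this]
  show ?thesis by simp
qed

section \<open>Weak limits\<close>

lemma in_closure_add:
  assumes "in_closure \<beta> f a" "in_closure \<beta> f b"
  shows "in_closure \<beta> f (\<lambda>L. a L + b L)"
  unfolding in_closure_def
proof (intro conjI allI impI)
  have ab: "in_l2 \<beta> a" "in_l2 \<beta> b" using assms by (auto simp: in_closure_def)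
  then show "in_l2 \<beta> (\<lambda>L. a L + b L)" by (rule in_l2_add)
  fix \<epsilon> :: real assume "\<epsilon> > 0"
  then have "\<epsilon> / 4 > 0" by simp
  then obtain p q where p: "sqnorm \<beta> (\<lambda>L. a L - pcoef (p * f) L) < \<epsilon> / 4"
    and q: "sqnorm \<beta> (\<lambda>L. b L - pcoef (q * f) L) < \<epsilon> / 4"
    using assms unfolding in_closure_def by metis
  have "sqnorm \<beta> (\<lambda>L. (a L - pcoef (p * f) L) + (b L - pcoef (q * f) L))
      \<le> 2 * sqnorm \<beta> (\<lambda>L. a L - pcoef (p * f) L) + 2 * sqnorm \<beta> (\<lambda>L. b L - pcoef (q * f) L)"
    by (intro sqnorm_add_le in_l2_diff ab in_l2_pcoef)
  also have "(\<lambda>L. (a L - pcoef (p * f) L) + (b L - pcoef (q * f) L)) = (\<lambda>L. a L + b L - pcoef ((p + q) * f) L)"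
    by (simp add: fun_eq_iff distrib_right pcoef_add)
  finally show "\<exists>p. sqnorm \<beta> (\<lambda>L. a L + b L - pcoef (p * f) L) < \<epsilon>"
    using p q by (intro exI[of _ "p + q"]) linarith
qed

lemma in_closure_cmult:
  assumes "in_closure \<beta> f a"
  shows "in_closure \<beta> f (\<lambda>L. c * a L)"
  unfolding in_closure_def
proof (intro conjI allI impI)
  have a: "in_l2 \<beta> a" using assms by (auto simp: in_closure_def)
  then show "in_l2 \<beta> (\<lambda>L. c * a L)" by (rule in_l2_cmult)
  fix \<epsilon> :: real assume e: "\<epsilon> > 0"
  have C: "(norm c)\<^sup>2 + 1 > 0" by (simp add: add_nonneg_pos)
  obtain p where p: "sqnorm \<beta> (\<lambda>L. a L - pcoef (p * f) L) < \<epsilon> / ((norm c)\<^sup>2 + 1)"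
    using assms e C unfolding in_closure_def by (metis divide_pos_pos)
  have "sqnorm \<beta> (\<lambda>L. c * (a L - pcoef (p * f) L)) \<le> (norm c)\<^sup>2 * sqnorm \<beta> (\<lambda>L. a L - pcoef (p * f) L)"
    by (intro sqnorm_cmult in_l2_diff a in_l2_pcoef)
  also have "\<dots> \<le> ((norm c)\<^sup>2 + 1) * sqnorm \<beta> (\<lambda>L. a L - pcoef (p * f) L)"
    by (intro mult_right_mono) auto
  also have "\<dots> < \<epsilon>" using p C by (simp add: field_simps)
  also have "(\<lambda>L. c * (a L - pcoef (p * f) L)) = (\<lambda>L. c * a L - pcoef (poly_of (\<lambda>_. c) {(0, 0)} * p * f) L)"
  proof -
    have "pcoef (poly_of (\<lambda>_. c) {(0, 0)} * (p * f)) L = c * pcoef (p * f) L" for L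
    proof -
      have "poly_of (\<lambda>_. c) {(0, 0)} = [:[:c:]:]" by (simp add: poly_of_def monom_0)
      then show ?thesis by (simp add: pcoef_def)
    qed
    then show ?thesis by (simp add: fun_eq_iff right_diff_distrib mult.assoc)
  qed
  finally show "\<exists>p. sqnorm \<beta> (\<lambda>L. c * a L - pcoef (p * f) L) < \<epsilon>" by blast
qed

text \<open>
  A weakly null sequence is asymptotically orthogonal to u. The mixed terms are small on a finite
  set S by coefficientwise convergence. Outside S they are at most
  \<open>|u|^2 / \<delta> + \<delta> |v|^2\<close>, where S is chosen so large that the tail of u
  compensates for the factor \<open>1 / \<delta>\<close>.
\<close>
lemma sqnorm_add_weakly_null:
  assumes u: "in_l2 \<beta> u" and v: "\<And>n. in_l2 \<beta> (v n)" "\<And>n. sqnorm \<beta> (v n) \<le> D"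
    and lim: "\<And>L. (\<lambda>n. v n L) \<longlonglongrightarrow> 0" and \<epsilon>: "\<epsilon> > 0"
  shows "\<exists>n. sqnorm \<beta> (\<lambda>L. u L + v n L) \<le> sqnorm \<beta> u + D + \<epsilon>"
proof -
  let ?h = "\<lambda>L. (norm (u L))\<^sup>2 * wt \<beta> L"
  have D: "D \<ge> 0" using order_trans[OF sqnorm_nonneg v(2)[of 0]] .
  define \<delta> where "\<delta> = \<epsilon> / (3 * (D + 1))"
  have \<delta>: "\<delta> > 0" "\<delta> * D \<le> \<epsilon> / 3" using \<epsilon> D by (auto simp: \<delta>_def field_simps)
  have hs: "?h summable_on UNIV" using u by (simp add: in_l2_def)
  then have "(?h has_sum infsum ?h UNIV) UNIV" by simp
  then have "eventually (\<lambda>S. dist (sum ?h S) (infsum ?h UNIV) < \<epsilon> * \<delta> / 3) (finite_subsets_at_top UNIV)"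
    unfolding has_sum_def by (rule tendstoD) (use \<epsilon> \<delta> in auto)
  then obtain S where S: "finite S" "dist (sum ?h S) (infsum ?h UNIV) < \<epsilon> * \<delta> / 3"
    unfolding eventually_finite_subsets_at_top by blast
  have "infsum ?h UNIV = infsum ?h S + infsum ?h (-S)"
    using infsum_Un_disjoint[of ?h S "-S"] hs by (simp add: summable_on_subset_banach)
  then have tail: "infsum ?h (-S) < \<epsilon> * \<delta> / 3" using S by (simp add: dist_real_def)
  have "(\<lambda>n. \<Sum>L\<in>S. 2 * norm (u L) * norm (v n L) * wt \<beta> L) \<longlonglongrightarrow> (\<Sum>L\<in>S. 2 * norm (u L) * norm (0::complex) * wt \<beta> L)"
    by (intro tendsto_intros lim)
  then have "eventually (\<lambda>n. (\<Sum>L\<in>S. 2 * norm (u L) * norm (v n L) * wt \<beta> L) < \<epsilon> / 3) sequentially"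
    using \<epsilon> by (intro order_tendstoD) auto
  then obtain n where n: "(\<Sum>L\<in>S. 2 * norm (u L) * norm (v n L) * wt \<beta> L) < \<epsilon> / 3"
    by (auto simp: eventually_sequentially)
  have le: "(norm (u L + v n L))\<^sup>2 * wt \<beta> L \<le> ?h L + (1 + \<delta>) * ((norm (v n L))\<^sup>2 * wt \<beta> L)
      + (if L \<in> S then 2 * norm (u L) * norm (v n L) * wt \<beta> L else 1 / \<delta> * ?h L)" (is "_ \<le> ?g L") for L
  proof -
    define x y where "x = norm (u L)" and "y = norm (v n L)"
    have "(norm (u L + v n L))\<^sup>2 \<le> (x + y)\<^sup>2"
      unfolding x_def y_def by (intro power_mono norm_triangle_ineq) auto
    moreover have "2 * x * y \<le> 1 / \<delta> * x\<^sup>2 + \<delta> * y\<^sup>2"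
    proof -
      have "0 \<le> (x - \<delta> * y)\<^sup>2 / \<delta>" using \<delta> by simp
      also have "\<dots> = 1 / \<delta> * x\<^sup>2 + \<delta> * y\<^sup>2 - 2 * x * y"
        using \<delta> by (simp add: power2_eq_square field_simps)
      finally show ?thesis by simp
    qed
    moreover have "0 \<le> \<delta> * y\<^sup>2" using \<delta> by simp
    ultimately have "(norm (u L + v n L))\<^sup>2 \<le> x\<^sup>2 + (1 + \<delta>) * y\<^sup>2 + (if L \<in> S then 2 * x * y else 1 / \<delta> * x\<^sup>2)"
      by (simp add: power2_sum algebra_simps)
    from mult_right_mono[OF this, of "wt \<beta> L"] show ?thesis
      by (simp add: x_def y_def algebra_simps split: if_splits)
  qed
  have g: "(?g has_sum (sqnorm \<beta> u + (1 + \<delta>) * sqnorm \<beta> (v n) +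
      ((\<Sum>L\<in>S. 2 * norm (u L) * norm (v n L) * wt \<beta> L) + 1 / \<delta> * infsum ?h (-S)))) UNIV"
  proof (intro has_sum_add has_sum_cmult_right)
    show "(?h has_sum sqnorm \<beta> u) UNIV" "((\<lambda>L. (norm (v n L))\<^sup>2 * wt \<beta> L) has_sum sqnorm \<beta> (v n)) UNIV"
      using u v(1)[of n] by (simp_all add: in_l2_def sqnorm_def)
    let ?k = "\<lambda>L. if L \<in> S then 2 * norm (u L) * norm (v n L) * wt \<beta> L else 1 / \<delta> * ?h L"
    have 1: "(?k has_sum (\<Sum>L\<in>S. 2 * norm (u L) * norm (v n L) * wt \<beta> L)) S"
      by (rule has_sum_finiteI) (use S in auto)
    have "((\<lambda>L. 1 / \<delta> * ?h L) has_sum (1 / \<delta> * infsum ?h (-S))) (-S)"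
      by (intro has_sum_cmult_right has_sum_infsum summable_on_subset_banach[OF hs]) auto
    then have 2: "(?k has_sum (1 / \<delta> * infsum ?h (-S))) (-S)"
      by (rule has_sum_cong[THEN iffD1, rotated]) auto
    from has_sum_Un_disjoint[OF 1 2]
    show "(?k has_sum ((\<Sum>L\<in>S. 2 * norm (u L) * norm (v n L) * wt \<beta> L) + 1 / \<delta> * infsum ?h (-S))) UNIV" by simp
  qed
  have "sqnorm \<beta> (\<lambda>L. u L + v n L) \<le> infsum ?g UNIV"
    unfolding sqnorm_def
    by (intro infsum_mono le) (use in_l2_add[OF u v(1)[of n]] g in \<open>auto simp: in_l2_def intro: has_sum_imp_summable\<close>)
  also have "\<dots> = sqnorm \<beta> u + (1 + \<delta>) * sqnorm \<beta> (v n) +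
      ((\<Sum>L\<in>S. 2 * norm (u L) * norm (v n L) * wt \<beta> L) + 1 / \<delta> * infsum ?h (-S))"
    using g by (rule infsumI)
  also have "\<dots> \<le> sqnorm \<beta> u + (D + \<epsilon> / 3) + (\<epsilon> / 3 + \<epsilon> / 3)"
  proof (intro add_mono order_refl)
    have "(1 + \<delta>) * sqnorm \<beta> (v n) \<le> (1 + \<delta>) * D" using v(2) \<delta> by (intro mult_left_mono) auto
    also have "\<dots> \<le> D + \<epsilon> / 3" using \<delta>(2) by (simp add: algebra_simps)
    finally show "(1 + \<delta>) * sqnorm \<beta> (v n) \<le> D + \<epsilon> / 3" .
    show "1 / \<delta> * infsum ?h (- S) \<le> \<epsilon> / 3" using tail \<delta>(1) by (simp add: field_simps)
  qed (use n in auto)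
  finally show ?thesis by (intro exI[of _ n]) simp
qed

text \<open>
  Let q be the squared distance of a from the arrays in the closed subspace. Replacing a nearly optimal x by
  \<open>(1 - t) x + t h\<close> with h far out in the sequence makes the squared distance at most about
  \<open>(1 - t)^2 q + t^2 D\<close>. If q were positive, this would be less than q for small t.
\<close>
lemma in_closure_weak_limit:
  assumes h: "\<And>n. in_closure \<beta> f (h n)" "\<And>n. sqnorm \<beta> (h n) \<le> C"
    and lim: "\<And>L. (\<lambda>n. h n L) \<longlonglongrightarrow> a L" and a: "in_l2 \<beta> a"
  shows "in_closure \<beta> f a"
proof -
  define D where "D = 2 * C + 2 * sqnorm \<beta> a"
  have hl: "in_l2 \<beta> (h n)" for n using h(1) by (simp add: in_closure_def)
  define v where "v n L = h n L - a L" for n L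
  have v: "in_l2 \<beta> (v n)" "sqnorm \<beta> (v n) \<le> D" for n
    using in_l2_diff[OF hl a, of n] sqnorm_diff_le[OF hl a, of n] h(2)[of n] unfolding v_def D_def by auto
  have D: "D \<ge> 0" using order_trans[OF sqnorm_nonneg v(2)[of 0]] .
  define Q where "Q = {sqnorm \<beta> (\<lambda>L. x L - a L) | x. in_closure \<beta> f x}"
  define q where "q = Inf Q"
  have bdd: "bdd_below Q" by (rule bdd_belowI[of _ 0]) (auto simp: Q_def)
  have ne: "Q \<noteq> {}" using h(1)[of 0] by (auto simp: Q_def)
  have q0: "q \<ge> 0" unfolding q_def by (rule cInf_greatest[OF ne]) (auto simp: Q_def)
  have "q = 0"
  proof (rule ccontr)
    assume "q \<noteq> 0"
    then have q: "q > 0" using q0 by simp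
    \<comment> \<open>The choice of t makes \<open>t D\<close> at most half of q.\<close>
    define t where "t = min (1 / 2) (q / (2 * (D + 1)))"
    have "0 < q / (2 * (D + 1))" using q D by (intro divide_pos_pos) auto
    then have t0: "0 < t" unfolding t_def by simp
    have t: "0 < t" "t \<le> 1 / 2" by (fact t0, unfold t_def, rule min.cobounded1)
    have tD: "t * D \<le> q / 2"
    proof -
      have "t * D \<le> q / (2 * (D + 1)) * D" unfolding t_def using D by (intro mult_right_mono) auto
      also have "\<dots> \<le> q / 2" using D q by (simp add: field_simps)
      finally show ?thesis .
    qed
    define \<eta> where "\<eta> = q - ((1 - t)\<^sup>2 * q + t\<^sup>2 * D)"
    have "\<eta> = t * ((2 - t) * q - t * D)" by (simp add: \<eta>_def power2_eq_square algebra_simps)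
    moreover have "(2 - t) * q \<ge> 1 * q" using t q by (intro mult_right_mono) auto
    then have "(2 - t) * q - t * D > 0" using tD q by linarith
    ultimately have \<eta>: "\<eta> > 0" using t by simp
    have "q < q + \<eta> / 2" using \<eta> by simp
    then obtain x where x: "in_closure \<beta> f x" "sqnorm \<beta> (\<lambda>L. x L - a L) < q + \<eta> / 2"
      using cInf_less_iff[OF ne bdd] unfolding q_def Q_def by blast
    have xl: "in_l2 \<beta> x" using x by (simp add: in_closure_def)
    define u where "u L = of_real (1 - t) * (x L - a L)" for L
    have u: "in_l2 \<beta> u" unfolding u_def by (intro in_l2_cmult in_l2_diff xl a)
    have un: "sqnorm \<beta> u \<le> (1 - t)\<^sup>2 * sqnorm \<beta> (\<lambda>L. x L - a L)"
      using sqnorm_cmult[OF in_l2_diff[OF xl a], of "of_real (1 - t)"] unfolding u_def norm_of_real by simp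
    have tv: "in_l2 \<beta> (\<lambda>L. of_real t * v n L)" "sqnorm \<beta> (\<lambda>L. of_real t * v n L) \<le> t\<^sup>2 * D" for n
    proof -
      show "in_l2 \<beta> (\<lambda>L. of_real t * v n L)" by (intro in_l2_cmult v)
      have "sqnorm \<beta> (\<lambda>L. of_real t * v n L) \<le> (norm (of_real t :: complex))\<^sup>2 * sqnorm \<beta> (v n)"
        by (intro sqnorm_cmult v)
      also have "\<dots> \<le> t\<^sup>2 * D" using v(2)[of n] by (auto intro!: mult_left_mono)
      finally show "sqnorm \<beta> (\<lambda>L. of_real t * v n L) \<le> t\<^sup>2 * D" .
    qed
    have "(\<lambda>n. of_real t * v n L) \<longlonglongrightarrow> 0" for L
      using tendsto_mult_right_zero[OF LIM_zero[OF lim[of L]], of "of_real t"] by (simp add: v_def)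
    then have "\<exists>n. sqnorm \<beta> (\<lambda>L. u L + of_real t * v n L) \<le> sqnorm \<beta> u + t\<^sup>2 * D + \<eta> / 4"
      by (rule sqnorm_add_weakly_null[OF u tv]) (use \<eta> in simp)
    then obtain n where n: "sqnorm \<beta> (\<lambda>L. u L + of_real t * v n L) \<le> sqnorm \<beta> u + t\<^sup>2 * D + \<eta> / 4" ..
    have "in_closure \<beta> f (\<lambda>L. of_real (1 - t) * x L + of_real t * h n L)"
      by (intro in_closure_add in_closure_cmult x h)
    then have "sqnorm \<beta> (\<lambda>L. (of_real (1 - t) * x L + of_real t * h n L) - a L) \<in> Q"
      unfolding Q_def by (intro CollectI exI[of _ "\<lambda>L. of_real (1 - t) * x L + of_real t * h n L"]) simp
    then have "q \<le> sqnorm \<beta> (\<lambda>L. (of_real (1 - t) * x L + of_real t * h n L) - a L)"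
      unfolding q_def by (rule cInf_lower[OF _ bdd])
    also have "(\<lambda>L. (of_real (1 - t) * x L + of_real t * h n L) - a L) = (\<lambda>L. u L + of_real t * v n L)"
      by (simp add: fun_eq_iff u_def v_def algebra_simps)
    also have "sqnorm \<beta> \<dots> \<le> (1 - t)\<^sup>2 * (q + \<eta> / 2) + t\<^sup>2 * D + \<eta> / 4"
      using n un mult_left_mono[OF less_imp_le[OF x(2)], of "(1 - t)\<^sup>2"] by simp
    also have "\<dots> = q - \<eta> + (1 - t)\<^sup>2 * (\<eta> / 2) + \<eta> / 4"
      by (simp add: \<eta>_def algebra_simps)
    also have "\<dots> \<le> q - \<eta> + 1 * (\<eta> / 2) + \<eta> / 4"
      using t \<eta> by (intro add_mono mult_right_mono) (auto simp: power_le_one)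
    also have "\<dots> < q" using \<eta> by simp
    finally show False by simp
  qed
  show ?thesis
  proof (rule in_closure_closed[OF a])
    fix \<epsilon> :: real assume "\<epsilon> > 0"
    then have "Inf Q < \<epsilon>" using \<open>q = 0\<close> by (simp add: q_def)
    then obtain x where "in_closure \<beta> f x" "sqnorm \<beta> (\<lambda>L. x L - a L) < \<epsilon>"
      using cInf_less_iff[OF ne bdd] unfolding Q_def by blast
    then show "\<exists>b. in_closure \<beta> f b \<and> sqnorm \<beta> (\<lambda>L. a L - b L) < \<epsilon>"
      by (auto simp: sqnorm_diff_commute[of _ a])
  qed
qed

section \<open>Dilation quotients\<close>

text \<open>
  For a single factor \<open>x - \<zeta>\<close> with \<open>|\<zeta>| \<ge> 1\<close> one has
  \<open>|1 - \<zeta>| \<le> (1 - r) + |r - \<zeta>| \<le> 2 |r - \<zeta>|\<close> and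
  \<open>|\<zeta>| (1 - r) \<le> |\<zeta>| - r \<le> |r - \<zeta>|\<close>.
\<close>
lemma poly_radial_bounds:
  fixes p :: "complex poly" and r :: real
  assumes "\<And>x. norm x < 1 \<Longrightarrow> poly p x \<noteq> 0" "0 \<le> r" "r < 1"
  shows "norm (poly p 1) \<le> 2 ^ degree p * norm (poly p (of_real r)) \<and>
         norm (poly p 0) * (1 - r) ^ degree p \<le> norm (poly p (of_real r))"
  using assms(1)
proof (induction "degree p" arbitrary: p)
  case 0
  then obtain c where "p = [:c:]" by (metis degree_eq_zeroE)
  then show ?case by simp
next
  case (Suc n)
  then have "\<not> constant (poly p)" by (simp add: constant_degree)
  then obtain \<zeta> where \<zeta>: "poly p \<zeta> = 0" using fundamental_theorem_of_algebra by blast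
  then obtain q where q: "p = [:-\<zeta>, 1:] * q" by (metis dvdE poly_eq_0_iff_dvd)
  have z1: "norm \<zeta> \<ge> 1" using Suc.prems \<zeta> by (meson not_le)
  have qn: "q \<noteq> 0" using q Suc.hyps by auto
  then have dp: "degree p = Suc (degree q)" unfolding q by (subst degree_mult_eq) auto
  have "norm (poly q 1) \<le> 2 ^ degree q * norm (poly q (of_real r)) \<and>
         norm (poly q 0) * (1 - r) ^ degree q \<le> norm (poly q (of_real r))"
    by (rule Suc.hyps(1)) (use dp Suc.hyps(2) Suc.prems in \<open>auto simp: q\<close>)
  then have IH: "norm (poly q 1) \<le> 2 ^ degree q * norm (poly q (of_real r))"
    "norm (poly q 0) * (1 - r) ^ degree q \<le> norm (poly q (of_real r))" by auto
  have b: "norm (of_real r - \<zeta>) \<ge> norm \<zeta> - r"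
    using norm_triangle_ineq2[of \<zeta> "of_real r"] assms(2) by (simp add: norm_minus_commute)
  have "norm (1 - \<zeta>) \<le> norm (1 - of_real r :: complex) + norm (of_real r - \<zeta>)"
    using norm_triangle_ineq[of "1 - of_real r" "of_real r - \<zeta>"] by simp
  moreover have "norm (1 - of_real r :: complex) = 1 - r"
    using assms(3) by (metis abs_of_pos diff_gt_0_iff_gt norm_of_real of_real_1 of_real_diff)
  ultimately have 1: "norm (1 - \<zeta>) \<le> 2 * norm (of_real r - \<zeta>)" using b z1 by simp
  have "norm \<zeta> * (1 - r) \<le> norm \<zeta> - r"
    using mult_right_mono[OF z1 assms(2)] by (simp add: algebra_simps)
  then have 2: "norm \<zeta> * (1 - r) \<le> norm (of_real r - \<zeta>)" using b by simp
  have pm: "norm (poly p x) = norm (x - \<zeta>) * norm (poly q x)" for x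
    unfolding norm_mult[symmetric] by (simp add: q algebra_simps)
  have "norm (poly p 1) = norm (1 - \<zeta>) * norm (poly q 1)" by (rule pm)
  also have "\<dots> \<le> (2 * norm (of_real r - \<zeta>)) * (2 ^ degree q * norm (poly q (of_real r)))"
    by (intro mult_mono 1 IH) auto
  also have "\<dots> = 2 ^ degree p * norm (poly p (of_real r))"
    by (simp add: dp pm)
  finally have "norm (poly p 1) \<le> 2 ^ degree p * norm (poly p (of_real r))" .
  moreover have "norm (poly p 0) * (1 - r) ^ degree p = (norm \<zeta> * (1 - r)) * (norm (poly q 0) * (1 - r) ^ degree q)"
    by (simp add: dp pm mult_ac)
  moreover have "\<dots> \<le> norm (of_real r - \<zeta>) * norm (poly q (of_real r))"
    by (intro mult_mono 2 IH) (use assms in auto)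
  moreover have "\<dots> = norm (poly p (of_real r))" by (simp add: pm)
  ultimately show ?case by simp
qed

text \<open>
  A crude upper bound for the degree in each variable and for the total degree.
\<close>
definition degree_bound :: "complex poly poly \<Rightarrow> nat" where
  "degree_bound f = (\<Sum>L\<in>supp f. fst L + snd L)"

lemma le_degree_bound: "L \<in> supp f \<Longrightarrow> fst L + snd L \<le> degree_bound f"
  unfolding degree_bound_def by (rule member_le_sum) auto

text \<open>
  The restriction of f to the complex line through 0 and z.
\<close>
definition slice :: "complex poly poly \<Rightarrow> complex \<times> complex \<Rightarrow> complex poly" where
  "slice f z = (\<Sum>L\<in>supp f. monom (pcoef f L * (fst z ^ fst L * snd z ^ snd L)) (fst L + snd L))"

lemma poly_slice: "poly (slice f z) x = eval2 f (x * fst z, x * snd z)"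
  unfolding slice_def eval2_eq_sum
  by (simp add: poly_sum poly_monom power_mult_distrib power_add mult_ac)

lemma degree_slice: "degree (slice f z) \<le> degree_bound f"
  unfolding slice_def using le_degree_bound
  by (intro degree_sum_le) (auto intro: order_trans[OF degree_monom_le])

lemma radial_bounds:
  assumes nz: "\<And>z. z \<in> bidisk \<Longrightarrow> eval2 f z \<noteq> 0" and z: "z \<in> closed_bidisk" and r: "0 \<le> r" "r < 1"
  shows "norm (eval2 f z) \<le> 2 ^ degree_bound f * norm (eval2 f (of_real r * fst z, of_real r * snd z))"
    and "norm (eval2 f (0, 0)) * (1 - r) ^ degree_bound f \<le> norm (eval2 f (of_real r * fst z, of_real r * snd z))"
proof -
  have *: "poly (slice f z) x \<noteq> 0" if "norm x < 1" for x
  proof -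
    have "norm x * norm y < 1" if "norm y \<le> 1" for y :: complex
      using mult_left_mono[OF that, of "norm x"] \<open>norm x < 1\<close> by simp
    then have "(x * fst z, x * snd z) \<in> bidisk"
      using z by (auto simp: bidisk_def closed_bidisk_def norm_mult mem_Times_iff)
    then show ?thesis using nz by (simp add: poly_slice)
  qed
  note B = poly_radial_bounds[of "slice f z" r, OF * r]
  have "norm (eval2 f z) \<le> 2 ^ degree (slice f z) * norm (eval2 f (of_real r * fst z, of_real r * snd z))"
    using B by (simp add: poly_slice)
  also have "\<dots> \<le> 2 ^ degree_bound f * norm (eval2 f (of_real r * fst z, of_real r * snd z))"
    by (intro mult_right_mono power_increasing degree_slice) auto
  finally show "norm (eval2 f z) \<le> 2 ^ degree_bound f * norm (eval2 f (of_real r * fst z, of_real r * snd z))" .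
  have "norm (eval2 f (0, 0)) * (1 - r) ^ degree_bound f \<le> norm (eval2 f (0, 0)) * (1 - r) ^ degree (slice f z)"
    using r by (intro mult_left_mono power_decreasing degree_slice) auto
  also have "\<dots> \<le> norm (eval2 f (of_real r * fst z, of_real r * snd z))"
    using B by (simp add: poly_slice)
  finally show "norm (eval2 f (0, 0)) * (1 - r) ^ degree_bound f \<le> norm (eval2 f (of_real r * fst z, of_real r * snd z))" .
qed

lemma degree_fiber:
  assumes "\<And>L. L \<in> supp f \<Longrightarrow> fst L \<le> n"
  shows "degree (poly f [:w:]) \<le> n"
proof (rule degree_le, intro allI impI)
  fix m assume "n < m"
  then have "pcoef f (m, i) = 0" for i using assms[of "(m, i)"] by (auto simp: supp_def)
  then have c: "coeff (coeff f i) m = 0" for i by (simp add: pcoef_def)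
  have "coeff (poly f [:w:]) m = (\<Sum>i\<le>degree f. coeff (coeff f i * [:w:] ^ i) m)"
    by (simp add: poly_altdef coeff_sum)
  also have "\<dots> = 0" by (intro sum.neutral) (simp add: poly_const_pow mult.commute[of _ "[:_:]"] c)
  finally show "coeff (poly f [:w:]) m = 0" .
qed

lemma supp_dilate: "supp (dilate r f) \<subseteq> supp f"
proof
  fix L assume "L \<in> supp (dilate r f)"
  then have "pcoef (dilate r f) L \<noteq> 0" by (simp add: supp_def)
  then show "L \<in> supp f" by (simp add: dilate_def pcoef_poly_of split: if_splits)
qed

text \<open>
  On each fiber the quotient is rational of degree at most \<open>degree_bound f\<close>, and it is bounded by
  \<open>2 ^ degree_bound f\<close>.
\<close>
lemma dilation_quotient_bound:
  assumes nz: "\<And>z. z \<in> bidisk \<Longrightarrow> eval2 f z \<noteq> 0" and r: "0 < r" "r < 1"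
    and h: "has_expansion h (\<lambda>z. eval2 f z / eval2 f (of_real r * fst z, of_real r * snd z))"
  shows "(\<Sum>k<K. real (k + 1) * (\<Sum>l<N. (norm (h (k, l)))\<^sup>2)) \<le> real (degree_bound f + 1) * (2 ^ degree_bound f)\<^sup>2"
proof (rule fiber_average[OF h])
  define F where "F z = eval2 f z / eval2 f (of_real r * fst z, of_real r * snd z)" for z
  have F2: "norm (F z) \<le> 2 ^ degree_bound f" and dn: "eval2 f (of_real r * fst z, of_real r * snd z) \<noteq> 0" if "z \<in> bidisk" for z
  proof -
    have z: "z \<in> closed_bidisk" using that by (auto simp: bidisk_def closed_bidisk_def)
    show "eval2 f (of_real r * fst z, of_real r * snd z) \<noteq> 0"
      using radial_bounds(1)[OF nz z, of r] nz[OF that] r by auto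
    then show "norm (F z) \<le> 2 ^ degree_bound f"
      using radial_bounds(1)[OF nz z, of r] r by (simp add: F_def norm_divide field_simps)
  qed
  fix \<rho> :: real and w :: complex assume \<rho>: "0 < \<rho>" "\<rho> < 1" "norm w = \<rho>"
  define b where "b k = (\<Sum>l. h (k, l) * w ^ l)" for k
  have w: "norm w < 1" using \<rho> by simp
  have bd: "(z, w) \<in> bidisk" if "norm z < 1" for z using that w by (simp add: bidisk_def)
  have ev: "poly (poly p [:w:]) z = eval2 p (z, w)" for p z by (simp add: eval2_def)
  have "(\<Sum>k<K. real (k + 1) * (norm (b k))\<^sup>2) \<le> real (degree_bound f + 1) * (2 ^ degree_bound f)\<^sup>2"
  proof (rule rational_dirichlet_bound)
    show "(\<lambda>k. b k * z ^ k) sums F (z, w)" if "norm z < 1" for z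
      unfolding b_def F_def by (rule expansion_fiber_sums[OF h that w])
    show "poly (poly (dilate (of_real r) f) [:w:]) z * F (z, w) = poly (poly f [:w:]) z" if "norm z < 1" for z
      using dn[OF bd[OF that]] by (simp add: ev eval2_dilate F_def)
    have "fst L \<le> degree_bound f" if "L \<in> supp f" for L using le_degree_bound[OF that] by simp
    then show "degree (poly f [:w:]) \<le> degree_bound f" "degree (poly (dilate (of_real r) f) [:w:]) \<le> degree_bound f"
      using supp_dilate by (intro degree_fiber; blast)+
    show "poly (poly (dilate (of_real r) f) [:w:]) 0 \<noteq> 0"
      using dn[OF bd[of 0]] by (simp add: ev eval2_dilate)
    show "norm (F (z, w)) \<le> 2 ^ degree_bound f" if "norm z < 1" for z by (rule F2[OF bd[OF that]])
  qed
  moreover have "(\<Sum>k<K. real (k + 1) * \<rho> ^ (2 * k) * (norm (b k))\<^sup>2) \<le> (\<Sum>k<K. real (k + 1) * 1 * (norm (b k))\<^sup>2)"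
    using \<rho> by (intro sum_mono mult_right_mono mult_left_mono power_le_one) auto
  ultimately show "(\<Sum>k<K. real (k + 1) * \<rho> ^ (2 * k) * (norm (\<Sum>l. h (k, l) * w ^ l))\<^sup>2) \<le> real (degree_bound f + 1) * (2 ^ degree_bound f)\<^sup>2"
    by (simp add: b_def)
qed auto

lemma finite_subset_square:
  assumes "finite (S :: (nat \<times> nat) set)"
  obtains K where "S \<subseteq> {..<K} \<times> {..<K}"
proof -
  obtain K where "fst ` S \<union> snd ` S \<subseteq> {..<K}"
    using finite_nat_iff_bounded[of "fst ` S \<union> snd ` S"] assms by auto
  then have "S \<subseteq> {..<K} \<times> {..<K}" by (auto simp: image_subset_iff)
  then show thesis by (rule that)
qed

lemma sum_square: "(\<Sum>L\<in>{..<K} \<times> {..<N}. g L) = (\<Sum>k<K. \<Sum>l<N. g (k, l))"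
  by (simp add: sum.cartesian_product')

text \<open>
  The weight \<open>k + l + 2\<close> splits into \<open>k + 1\<close> and \<open>l + 1\<close>, so that the bound for
  the quotients \<open>f(z) / f(r z)\<close> follows from the fiber estimates in both variables. Their
  coefficients converge to those of 1, since \<open>1 / f(r z)\<close> has coefficients
  \<open>a L r ^ |L|\<close>, where a belongs to \<open>1 / f\<close>.
\<close>
theorem in_closure_beta_one:
  assumes nz: "\<And>z. z \<in> bidisk \<Longrightarrow> eval2 f z \<noteq> 0"
  shows "in_closure 1 f (pcoef 1)"
proof -
  obtain a where a: "has_expansion a (\<lambda>z. 1 / eval2 f z)" using has_expansion_inverse[OF nz] by blast
  define r where "r n = 1 - 1 / (real n + 2)" for n
  have r: "0 < r n" "r n < 1" for n by (auto simp: r_def)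
  define u where "u n L = a L * of_real (r n ^ (fst L + snd L))" for n L
  have u: "in_l2 1 (u n)" for n unfolding u_def[abs_def] by (rule in_l2_dilation[OF a r])
  define h where "h n = pmul f (u n)" for n
  have hF: "has_expansion (h n) (\<lambda>z. eval2 f z / eval2 f (of_real (r n) * fst z, of_real (r n) * snd z))" for n
  proof -
    have "norm (of_real (r n) :: complex) \<le> 1" using r[of n] by simp
    from has_expansion_pmul[OF has_expansion_dilation[OF a this], of f] show ?thesis
      by (simp add: h_def u_def[abs_def])
  qed
  let ?g = "swap_poly f"
  have nz': "eval2 ?g z \<noteq> 0" if "z \<in> bidisk" for z
    unfolding eval2_swap_poly using that by (intro nz) (auto simp: bidisk_def)
  define C where "C = real (degree_bound f + 1) * (2 ^ degree_bound f)\<^sup>2"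
  define C' where "C' = real (degree_bound ?g + 1) * (2 ^ degree_bound ?g)\<^sup>2"
  have B1: "(\<Sum>k<K. real (k + 1) * (\<Sum>l<N. (norm (h n (k, l)))\<^sup>2)) \<le> C" for n K N
    unfolding C_def by (rule dilation_quotient_bound[OF nz r hF])
  have B2: "(\<Sum>l<K. real (l + 1) * (\<Sum>k<N. (norm (h n (k, l)))\<^sup>2)) \<le> C'" for n K N
  proof -
    have "has_expansion (h n \<circ> prod.swap) (\<lambda>z. eval2 ?g z / eval2 ?g (of_real (r n) * fst z, of_real (r n) * snd z))"
      using has_expansion_swap[OF hF[of n]] by (simp add: o_def eval2_swap_poly)
    from dilation_quotient_bound[OF nz' r this, of N K] show ?thesis by (simp add: C'_def)
  qed
  have hB: "sqnorm 1 (h n) \<le> C + C'" for n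
  proof (rule in_l2_bounded_sums(2))
    fix S :: "(nat \<times> nat) set" assume "finite S"
    then obtain K where K: "S \<subseteq> {..<K} \<times> {..<K}" by (rule finite_subset_square)
    have "(\<Sum>L\<in>S. (norm (h n L))\<^sup>2 * wt 1 L) \<le> (\<Sum>L\<in>{..<K} \<times> {..<K}. (norm (h n L))\<^sup>2 * wt 1 L)"
      by (intro sum_mono2 K) auto
    also have "\<dots> = (\<Sum>k<K. \<Sum>l<K. (norm (h n (k, l)))\<^sup>2 * real (k + 1)) + (\<Sum>k<K. \<Sum>l<K. (norm (h n (k, l)))\<^sup>2 * real (l + 1))"
      unfolding sum_square sum.distrib[symmetric] by (intro sum.cong) (auto simp: wt_def algebra_simps)
    also have "(\<Sum>k<K. \<Sum>l<K. (norm (h n (k, l)))\<^sup>2 * real (k + 1)) = (\<Sum>k<K. real (k + 1) * (\<Sum>l<K. (norm (h n (k, l)))\<^sup>2))"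
      by (simp add: sum_distrib_left mult.commute)
    also have "(\<Sum>k<K. \<Sum>l<K. (norm (h n (k, l)))\<^sup>2 * real (l + 1)) = (\<Sum>l<K. real (l + 1) * (\<Sum>k<K. (norm (h n (k, l)))\<^sup>2))"
      by (subst sum.swap) (simp add: sum_distrib_left mult.commute)
    finally show "(\<Sum>L\<in>S. (norm (h n L))\<^sup>2 * wt 1 L) \<le> C + C'"
      using B1[of n K K] B2[of n K K] by linarith
  qed
  have rl: "r \<longlonglongrightarrow> 1" unfolding r_def by real_asymp
  have ul: "(\<lambda>n. u n L) \<longlonglongrightarrow> a L" for L
  proof -
    have "(\<lambda>n. u n L) \<longlonglongrightarrow> a L * of_real (1 ^ (fst L + snd L))"
      unfolding u_def by (intro tendsto_intros rl)
    then show ?thesis by simp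
  qed
  have "pmul f a = pcoef 1"
  proof (rule has_expansion_unique)
    have "has_expansion (pmul f a) (\<lambda>z. eval2 f z * (1 / eval2 f z))" by (rule has_expansion_pmul[OF a])
    then show "has_expansion (pmul f a) (eval2 1)" using nz by (auto simp: has_expansion_def)
  qed (rule has_expansion_eval2)
  moreover have "(\<lambda>n. h n L) \<longlonglongrightarrow> pmul f a L" for L
    unfolding h_def pmul_def by (intro tendsto_intros) (auto simp: shift_def ul)
  ultimately have hl: "(\<lambda>n. h n L) \<longlonglongrightarrow> pcoef 1 L" for L by simp
  show ?thesis
    by (rule in_closure_weak_limit[OF _ hB hl]) (simp_all add: h_def in_closure_pmul u)
qed

section \<open>Non-cyclicity by annihilating functionals\<close>

definition pairing :: "complex poly poly \<Rightarrow> (nat \<times> nat \<Rightarrow> complex) \<Rightarrow> complex" where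
  "pairing q \<nu> = (\<Sum>L\<in>supp q. pcoef q L * \<nu> L)"

lemma pairing_superset:
  assumes "finite S" "supp q \<subseteq> S"
  shows "pairing q \<nu> = (\<Sum>L\<in>S. pcoef q L * \<nu> L)"
  unfolding pairing_def by (rule sum.mono_neutral_left) (use assms in \<open>auto simp: supp_def\<close>)

lemma pairing_diff: "pairing (p - q) \<nu> = pairing p \<nu> - pairing q \<nu>"
proof -
  let ?S = "supp p \<union> supp q \<union> supp (p - q)"
  show ?thesis
    by (subst (1 2 3) pairing_superset[where S = ?S]) (auto simp: pcoef_diff sum_subtractf[symmetric] algebra_simps)
qed

lemma pairing_1: "pairing 1 \<nu> = \<nu> (0, 0)"
  by (subst pairing_superset[where S = "{(0, 0)}"]) (auto simp: supp_def pcoef_1)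

lemma wt_minus: "wt (- \<beta>) L = 1 / wt \<beta> L"
  by (simp add: wt_def powr_minus_divide)

lemma norm_pairing_le:
  assumes "in_l2 (- \<beta>) \<nu>"
  shows "(norm (pairing q \<nu>))\<^sup>2 \<le> sqnorm \<beta> (pcoef q) * sqnorm (- \<beta>) \<nu>"
proof -
  let ?x = "\<lambda>L. norm (pcoef q L) * sqrt (wt \<beta> L)" and ?y = "\<lambda>L. norm (\<nu> L) * sqrt (wt (- \<beta>) L)"
  have xy: "norm (pcoef q L * \<nu> L) = ?x L * ?y L" for L
  proof -
    have "sqrt (wt \<beta> L) * sqrt (wt (- \<beta>) L) = 1"
      by (simp add: wt_minus real_sqrt_divide less_imp_neq[symmetric])
    then show ?thesis by (simp add: norm_mult mult_ac)
  qed
  have "norm (pairing q \<nu>) \<le> (\<Sum>L\<in>supp q. ?x L * ?y L)"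
    unfolding pairing_def xy[symmetric] by (rule norm_sum)
  then have "(norm (pairing q \<nu>))\<^sup>2 \<le> (\<Sum>L\<in>supp q. ?x L * ?y L)\<^sup>2"
    by (intro power_mono) auto
  also have "\<dots> \<le> (\<Sum>L\<in>supp q. (?x L)\<^sup>2) * (\<Sum>L\<in>supp q. (?y L)\<^sup>2)"
    by (rule Cauchy_Schwarz_ineq_sum)
  also have "\<dots> \<le> sqnorm \<beta> (pcoef q) * sqnorm (- \<beta>) \<nu>"
    unfolding sqnorm_def power_mult_distrib
    using assms in_l2_pcoef[of \<beta> q] unfolding in_l2_def
    by (intro mult_mono) (auto intro!: finite_sum_le_infsum sum_nonneg infsum_nonneg)
  finally show ?thesis .
qed

lemma not_in_closure_if_annihilated:
  assumes \<nu>: "in_l2 (- \<beta>) \<nu>" "\<nu> (0, 0) \<noteq> 0" and ann: "\<And>p. pairing (p * f) \<nu> = 0"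
  shows "\<not> in_closure \<beta> f (pcoef 1)"
proof
  assume r: "in_closure \<beta> f (pcoef 1)"
  define A where "A = sqnorm (- \<beta>) \<nu>"
  have A: "A \<ge> 0" by (simp add: A_def)
  define \<epsilon> where "\<epsilon> = (norm (\<nu> (0, 0)))\<^sup>2 / (A + 1)"
  have "\<epsilon> > 0" using A \<nu>(2) by (simp add: \<epsilon>_def add_nonneg_pos)
  then obtain p where p: "sqnorm \<beta> (\<lambda>L. pcoef 1 L - pcoef (p * f) L) < \<epsilon>"
    using r by (auto simp: in_closure_def)
  have "(norm (\<nu> (0, 0)))\<^sup>2 = (norm (pairing (1 - p * f) \<nu>))\<^sup>2"
    by (simp add: pairing_diff pairing_1 ann)
  also have "\<dots> \<le> sqnorm \<beta> (pcoef (1 - p * f)) * A"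
    unfolding A_def by (rule norm_pairing_le[OF \<nu>(1)])
  also have "pcoef (1 - p * f) = (\<lambda>L. pcoef 1 L - pcoef (p * f) L)"
    by (simp add: fun_eq_iff pcoef_diff)
  also have "sqnorm \<beta> \<dots> * A \<le> \<epsilon> * A"
    using p A by (intro mult_right_mono) auto
  also have "\<dots> < \<epsilon> * (A + 1)" using \<open>\<epsilon> > 0\<close> by simp
  also have "\<dots> = (norm (\<nu> (0, 0)))\<^sup>2" using A by (simp add: \<epsilon>_def)
  finally show False by simp
qed

lemma summable_on_powr:
  assumes "s > 1" "c \<ge> 1"
  shows "(\<lambda>n. (real n + c) powr (- s)) summable_on (UNIV :: nat set)"
proof -
  have "summable (\<lambda>n. real n powr (- s))" using assms by (simp add: summable_real_powr_iff)
  then have "summable (\<lambda>n. real (n + 1) powr (- s))" by (rule summable_ignore_initial_segment)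
  then have "summable (\<lambda>n. (real n + c) powr (- s))"
    by (rule summable_comparison_test'[where N = 0]) (use assms in \<open>auto intro!: powr_mono2'\<close>)
  then show ?thesis by (subst summable_on_UNIV_nonneg_real_iff) auto
qed

lemma not_in_closure_if_zero_in_closed_bidisk:
  assumes "\<beta> > 2" and z: "z \<in> closed_bidisk" "eval2 f z = 0"
  shows "\<not> in_closure \<beta> f (pcoef 1)"
proof (rule not_in_closure_if_annihilated)
  let ?\<nu> = "\<lambda>L :: nat \<times> nat. fst z ^ fst L * snd z ^ snd L"
  show "?\<nu> (0, 0) \<noteq> 0" by simp
  show "pairing (p * f) ?\<nu> = 0" for p
    using z(2) by (simp add: pairing_def flip: eval2_eq_sum)
  let ?h = "\<lambda>k. (real k + 1) powr (- (\<beta> / 2))"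
  have h: "?h summable_on UNIV" using assms by (intro summable_on_powr) auto
  have "(\<lambda>(k, l). ?h k * ?h l) summable_on UNIV \<times> UNIV"
    by (rule summable_on_SigmaI[where g = "\<lambda>k. ?h k * infsum ?h UNIV"])
       (use h in \<open>auto intro!: has_sum_cmult_right summable_on_cmult_left\<close>)
  then have s: "(\<lambda>(k, l). ?h k * ?h l) summable_on UNIV" by simp
  show "in_l2 (- \<beta>) ?\<nu>"
    unfolding in_l2_def
  proof (rule summable_on_comparison_test[OF s])
    fix L :: "nat \<times> nat"
    obtain k l where L: "L = (k, l)" by (cases L)
    have "norm (?\<nu> L) \<le> 1 * 1"
      unfolding norm_mult norm_power using z(1)
      by (intro mult_mono power_le_one) (auto simp: closed_bidisk_def mem_Times_iff)
    then have "(norm (?\<nu> L))\<^sup>2 \<le> 1" by (simp add: power_le_one)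
    then have "(norm (?\<nu> L))\<^sup>2 * wt (- \<beta>) L \<le> 1 * wt (- \<beta>) L" by (intro mult_right_mono) auto
    also have "1 * wt (- \<beta>) L = ((real (k + l) + 2)\<^sup>2) powr (- (\<beta> / 2))"
      by (simp add: wt_def L powr_powr flip: powr_numeral)
    also have "\<dots> \<le> ((real k + 1) * (real l + 1)) powr (- (\<beta> / 2))"
      using assms(1) by (intro powr_mono2') (auto simp: power2_eq_square algebra_simps intro!: add_pos_nonneg)
    also have "\<dots> = ?h k * ?h l" by (simp add: powr_mult)
    finally show "(norm (?\<nu> L))\<^sup>2 * wt (- \<beta>) L \<le> (case L of (k, l) \<Rightarrow> ?h k * ?h l)" by (simp add: L)
  qed auto
qed

text \<open>
  The weight is at most \<open>(l + 2) powr (- \<beta>)\<close>, whose sum over l converges.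
\<close>
lemma in_l2_if_row_bounds:
  assumes C: "\<And>K l. (\<Sum>k<K. (norm (\<nu> (k, l)))\<^sup>2) \<le> C" and "\<beta> > 1"
  shows "in_l2 (- \<beta>) \<nu>"
proof -
  have C0: "C \<ge> 0" using C[of 0 0] by simp
  let ?h = "\<lambda>l. (real l + 2) powr (- \<beta>)"
  have h: "?h summable_on UNIV" using assms by (intro summable_on_powr) auto
  show ?thesis
  proof (rule in_l2_bounded_sums)
    fix S :: "(nat \<times> nat) set" assume S: "finite S"
    obtain K where "fst ` S \<subseteq> {..<K}" using finite_nat_iff_bounded[of "fst ` S"] S by auto
    obtain N where "snd ` S \<subseteq> {..<N}" using finite_nat_iff_bounded[of "snd ` S"] S by auto
    then have sub: "S \<subseteq> {..<K} \<times> {..<N}" using \<open>fst ` S \<subseteq> {..<K}\<close> by (auto simp: image_subset_iff)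
    have "(\<Sum>L\<in>S. (norm (\<nu> L))\<^sup>2 * wt (- \<beta>) L) \<le> (\<Sum>L\<in>S. (norm (\<nu> L))\<^sup>2 * ?h (snd L))"
      using assms(2) unfolding wt_def by (intro sum_mono mult_left_mono powr_mono2') auto
    also have "\<dots> \<le> (\<Sum>L\<in>{..<K} \<times> {..<N}. (norm (\<nu> L))\<^sup>2 * ?h (snd L))"
      by (intro sum_mono2 sub) auto
    also have "\<dots> = (\<Sum>l<N. (\<Sum>k<K. (norm (\<nu> (k, l)))\<^sup>2) * ?h l)"
      by (simp add: sum.cartesian_product' sum.swap[of _ "{..<K}"] sum_distrib_right)
    also have "\<dots> \<le> (\<Sum>l<N. C * ?h l)"
      by (intro sum_mono mult_right_mono C) auto
    also have "\<dots> = C * (\<Sum>l<N. ?h l)" by (simp add: sum_distrib_left)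
    also have "\<dots> \<le> C * infsum ?h UNIV"
      by (intro mult_left_mono finite_sum_le_infsum h C0) auto
    finally show "(\<Sum>L\<in>S. (norm (\<nu> L))\<^sup>2 * wt (- \<beta>) L) \<le> C * infsum ?h UNIV" .
  qed
qed

definition angles :: "(complex \<times> complex) set \<Rightarrow> real set" where
  "angles E = {s \<in> {0..2 * pi}. \<exists>t\<in>{0..2 * pi}. (cis s, cis t) \<in> E}"

text \<open>
  Over each angle the point of E with the smallest second angle \<open>\<phi> s\<close> is selected. The
  function \<open>\<phi>\<close> is lower semicontinuous on the angles, hence measurable: its sublevel sets
  are projections of compact sets. The functional integrates a polynomial over the selected points.
\<close>
lemma annihilating_sequence_if_curve:
  assumes E: "closed E" and pos: "\<not> negligible (angles E)" and \<beta>: "\<beta> > 1"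
  shows "\<exists>\<nu>. in_l2 (- \<beta>) \<nu> \<and> \<nu> (0, 0) \<noteq> 0 \<and> (\<forall>q. (\<forall>z\<in>E. eval2 q z = 0) \<longrightarrow> pairing q \<nu> = 0)"
proof -
  define F where "F c s = {t \<in> {0..min c (2 * pi)}. (cis s, cis t) \<in> E}" for c s
  \<comment> \<open>The value \<open>2 * pi + 1\<close> marks angles without a point of E. Any value above \<open>2 * pi\<close> would do.\<close>
  define \<phi> where "\<phi> s = (if s \<in> angles E then Inf (F (2 * pi) s) else 2 * pi + 1)" for s
  have cl: "closed {(s, t). s \<in> {0..2 * pi} \<and> t \<in> {0..c} \<and> (cis s, cis t) \<in> E}" for c
  proof -
    have "closed ((\<lambda>(s, t). (cis s, cis t)) -` E)"
      by (intro closed_vimage E) (auto intro!: continuous_intros simp: case_prod_unfold)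
    moreover have "{(s, t). s \<in> {0..2 * pi} \<and> t \<in> {0..c} \<and> (cis s, cis t) \<in> E} =
        ({0..2 * pi} \<times> {0..c}) \<inter> ((\<lambda>(s, t). (cis s, cis t)) -` E)" by auto
    ultimately show ?thesis by (simp add: closed_Times closed_Int)
  qed
  have proj: "closed {s \<in> {0..2 * pi}. F c s \<noteq> {}}" for c
  proof -
    have "compact {(s, t). s \<in> {0..2 * pi} \<and> t \<in> {0..min c (2 * pi)} \<and> (cis s, cis t) \<in> E}"
    proof -
      let ?A = "{(s, t). s \<in> {0..2 * pi} \<and> t \<in> {0..min c (2 * pi)} \<and> (cis s, cis t) \<in> E}"
      have "compact (({0..2 * pi} \<times> {0..min c (2 * pi)}) \<inter> ?A)"
        by (intro compact_Int_closed compact_Times compact_Icc cl)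
      moreover have "({0..2 * pi} \<times> {0..min c (2 * pi)}) \<inter> ?A = ?A" by auto
      ultimately show ?thesis by simp
    qed
    then have "compact (fst ` {(s, t). s \<in> {0..2 * pi} \<and> t \<in> {0..min c (2 * pi)} \<and> (cis s, cis t) \<in> E})"
      by (intro compact_continuous_image continuous_intros)
    moreover have "fst ` {(s, t). s \<in> {0..2 * pi} \<and> t \<in> {0..min c (2 * pi)} \<and> (cis s, cis t) \<in> E} = {s \<in> {0..2 * pi}. F c s \<noteq> {}}"
      by (force simp: F_def)
    ultimately show ?thesis by (simp add: compact_imp_closed)
  qed
  have angles_eq: "angles E = {s \<in> {0..2 * pi}. F (2 * pi) s \<noteq> {}}"
    by (auto simp: angles_def F_def)
  then have angles_closed: "closed (angles E)" using proj by simp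
  have InfF: "Inf (F (2 * pi) s) \<in> F (2 * pi) s" if "s \<in> angles E" for s
  proof (rule closed_contains_Inf)
    show "F (2 * pi) s \<noteq> {}" using that angles_eq by auto
    show "bdd_below (F (2 * pi) s)" by (rule bdd_belowI[of _ 0]) (auto simp: F_def)
    have "closed ((\<lambda>t. (cis s, cis t)) -` E)"
      by (intro closed_vimage E) (auto intro!: continuous_intros)
    moreover have "F (2 * pi) s = {0..2 * pi} \<inter> (\<lambda>t. (cis s, cis t)) -` E" by (auto simp: F_def)
    ultimately show "closed (F (2 * pi) s)" by (simp add: closed_Int)
  qed
  have in_E: "(cis s, cis (\<phi> s)) \<in> E" if "s \<in> angles E" for s
    using InfF[OF that] that by (auto simp: \<phi>_def F_def)
  have "\<phi> \<in> borel_measurable borel"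
  proof (rule borel_measurableI_le)
    fix c
    have "{s \<in> space borel. \<phi> s \<le> c} \<in> sets borel"
    proof (cases "c < 2 * pi + 1")
      case True
      have "{s. \<phi> s \<le> c} = {s \<in> {0..2 * pi}. F c s \<noteq> {}}"
      proof (intro equalityI subsetI)
        fix s assume "s \<in> {s. \<phi> s \<le> c}"
        then have s: "s \<in> angles E" "Inf (F (2 * pi) s) \<le> c"
          using True by (auto simp: \<phi>_def split: if_splits)
        then have "Inf (F (2 * pi) s) \<in> F c s" using InfF[of s] by (auto simp: F_def)
        then show "s \<in> {s \<in> {0..2 * pi}. F c s \<noteq> {}}" using s by (auto simp: angles_def)
      next
        fix s assume "s \<in> {s \<in> {0..2 * pi}. F c s \<noteq> {}}"
        then obtain t where t: "s \<in> {0..2 * pi}" "t \<in> F c s" by blast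
        then have "t \<in> F (2 * pi) s" "t \<le> c" by (auto simp: F_def)
        moreover have "bdd_below (F (2 * pi) s)" by (rule bdd_belowI[of _ 0]) (auto simp: F_def)
        ultimately have "Inf (F (2 * pi) s) \<le> c" using cInf_lower by force
        moreover have "s \<in> angles E" using t angles_eq \<open>t \<in> F (2 * pi) s\<close> by blast
        ultimately show "s \<in> {s. \<phi> s \<le> c}" by (simp add: \<phi>_def)
      qed
      then show ?thesis using proj[of c] by simp
    next
      case False
      have "\<phi> s \<le> 2 * pi + 1" for s using InfF[of s] by (auto simp: \<phi>_def F_def)
      then have "\<phi> s \<le> c" for s using False by (meson leI order_trans)
      then show ?thesis by simp
    qed
    then show "{s \<in> space borel. \<phi> s \<le> c} \<in> sets borel" .
  qed
  then have \<phi>m [measurable]: "\<phi> \<in> borel_measurable circle_measure"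
    by (intro measurable_restrict_space1 measurable_completion) simp
  have am: "(indicator (angles E) :: real \<Rightarrow> complex) \<in> borel_measurable circle_measure"
  proof -
    have "(indicator (angles E) :: real \<Rightarrow> complex) \<in> borel_measurable borel" using angles_closed by simp
    then show ?thesis by (intro measurable_restrict_space1 measurable_completion) simp
  qed
  define G where "G l s = (indicator (angles E) s * cis (real l * \<phi> s) :: complex)" for l s
  have cism [measurable]: "cis \<in> borel_measurable borel"
    by (intro borel_measurable_continuous_onI continuous_intros)
  have Gm [measurable]: "G l \<in> borel_measurable circle_measure" for l
    unfolding G_def using am by measurable
  have G1: "norm (G l s) \<le> 1" for l s by (simp add: G_def norm_mult indicator_def)
  define \<nu> where "\<nu> L = fourier_coeff (G (snd L)) (- int (fst L))" for L
  have iG: "integrable circle_measure (\<lambda>s. G l s * cis (real k * s))" for k l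
    by (rule integrable_circle[of _ 1]) (use G1 in \<open>auto simp: norm_mult\<close>)
  have "in_l2 (- \<beta>) \<nu>"
  proof (rule in_l2_if_row_bounds[OF _ \<beta>])
    fix K l
    have "(\<Sum>k<K. (norm (\<nu> (k, l)))\<^sup>2) = (\<Sum>k\<in>(\<lambda>k. - int k) ` {..<K}. (norm (fourier_coeff (G l) k))\<^sup>2)"
      by (subst sum.reindex) (auto simp: inj_on_def \<nu>_def)
    also have "\<dots> \<le> (LINT s|circle_measure. (norm (G l s))\<^sup>2) / (2 * pi)"
      by (rule bessel[OF Gm G1]) auto
    also have "\<dots> \<le> (LINT s|circle_measure. 1) / (2 * pi)"
    proof (intro divide_right_mono integral_mono)
      show "integrable circle_measure (\<lambda>s. (norm (G l s))\<^sup>2)"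
        by (rule integrable_circle[of _ 1]) (use G1 in \<open>auto simp: power_le_one\<close>)
      show "(norm (G l s))\<^sup>2 \<le> 1" for s using G1[of l s] by (simp add: power_le_one)
    qed (auto simp: finite_measure.integrable_const[OF finite_measure_circle])
    also have "\<dots> = 1" by (simp add: measure_restrict_space)
    finally show "(\<Sum>k<K. (norm (\<nu> (k, l)))\<^sup>2) \<le> 1" .
  qed
  moreover have "\<nu> (0, 0) \<noteq> 0"
  proof -
    have "\<nu> (0, 0) = (LINT s|circle_measure. (indicator (angles E) s :: complex)) / (2 * pi)"
      by (simp add: \<nu>_def fourier_coeff_def G_def)
    also have "(LINT s|circle_measure. indicator (angles E) s :: complex) = (LINT s|circle_measure. of_real (indicator (angles E) s))"
      by (intro Bochner_Integration.integral_cong) (auto simp: indicator_def)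
    also have "\<dots> = of_real (LINT s|circle_measure. indicator (angles E) s)"
      by (rule integral_complex_of_real)
    also have "(LINT s|circle_measure. indicator (angles E) s :: real) = measure lebesgue (angles E)"
    proof -
      have sub: "angles E \<subseteq> {0..2 * pi}" by (auto simp: angles_def)
      have "angles E \<in> sets lebesgue" using angles_closed by (simp add: borel_closed)
      then have "(LINT s|circle_measure. indicator (angles E) s :: real) = measure circle_measure (angles E)"
        using sub by (simp add: sets_restrict_space_iff inf_absorb1)
      also have "\<dots> = measure lebesgue (angles E)"
        using sub by (subst measure_restrict_space) auto
      finally show ?thesis .
    qed
    finally have e: "\<nu> (0, 0) = complex_of_real (measure lebesgue (angles E)) / complex_of_real (2 * pi)" .
    have "angles E \<in> lmeasurable"
      using angles_closed by (intro lmeasurable_compact) (auto simp: compact_eq_bounded_closed angles_def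
          intro: bounded_subset[OF bounded_closed_interval[of 0 "2 * pi"]])
    then have "measure lebesgue (angles E) \<noteq> 0" using pos negligible_iff_measure by blast
    then show ?thesis by (simp add: e)
  qed
  moreover have "pairing q \<nu> = 0" if q: "\<forall>z\<in>E. eval2 q z = 0" for q
  proof -
    have "pairing q \<nu> = (\<Sum>L\<in>supp q. pcoef q L * ((LINT s|circle_measure. G (snd L) s * cis (real (fst L) * s)) / (2 * pi)))"
      by (simp add: pairing_def \<nu>_def fourier_coeff_def)
    also have "\<dots> = (LINT s|circle_measure. (\<Sum>L\<in>supp q. pcoef q L * (G (snd L) s * cis (real (fst L) * s)))) / (2 * pi)"
      by (subst Bochner_Integration.integral_sum) (auto simp: iG sum_divide_distrib)
    also have "(\<lambda>s. \<Sum>L\<in>supp q. pcoef q L * (G (snd L) s * cis (real (fst L) * s))) = (\<lambda>s. 0)"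
    proof
      fix s
      have "(\<Sum>L\<in>supp q. pcoef q L * (G (snd L) s * cis (real (fst L) * s))) = indicator (angles E) s * eval2 q (cis s, cis (\<phi> s))"
        by (simp add: eval2_eq_sum G_def sum_distrib_left Complex.DeMoivre mult_ac)
      also have "\<dots> = 0" using in_E[of s] q by (auto simp: indicator_def)
      finally show "(\<Sum>L\<in>supp q. pcoef q L * (G (snd L) s * cis (real (fst L) * s))) = 0" .
    qed
    finally show ?thesis by simp
  qed
  ultimately show ?thesis by blast
qed

lemma pcoef_swap_poly: "pcoef (swap_poly q) L = pcoef q (prod.swap L)"
proof -
  have "L \<in> prod.swap ` supp q \<longleftrightarrow> prod.swap L \<in> supp q"
    by (metis imageE imageI swap_swap)
  then show ?thesis by (simp add: swap_poly_def pcoef_poly_of) (simp add: supp_def)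
qed

lemma pairing_swap: "pairing (swap_poly q) \<nu> = pairing q (\<nu> \<circ> prod.swap)"
proof -
  have "supp (swap_poly q) = prod.swap ` supp q"
    by (auto simp: supp_def pcoef_swap_poly image_iff)
  then show ?thesis
    unfolding pairing_def by (simp add: sum.reindex pcoef_swap_poly)
qed

lemma not_in_closure_if_curve:
  assumes E: "closed E" "\<And>z. z \<in> E \<Longrightarrow> eval2 f z = 0" and \<beta>: "\<beta> > 1"
    and pos: "\<not> negligible (angles E) \<or> \<not> negligible (angles (prod.swap ` E))"
  shows "\<not> in_closure \<beta> f (pcoef 1)"
  using pos
proof
  assume "\<not> negligible (angles E)"
  from annihilating_sequence_if_curve[OF E(1) this \<beta>] obtain \<nu> where
    "in_l2 (- \<beta>) \<nu>" "\<nu> (0, 0) \<noteq> 0" "\<And>q. (\<forall>z\<in>E. eval2 q z = 0) \<Longrightarrow> pairing q \<nu> = 0" by blast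
  then show ?thesis using E(2) by (intro not_in_closure_if_annihilated[of \<beta> \<nu>]) auto
next
  assume *: "\<not> negligible (angles (prod.swap ` E))"
  have "x \<in> prod.swap ` E \<longleftrightarrow> prod.swap x \<in> E" for x
    by (metis imageE imageI swap_swap)
  then have "prod.swap ` E = prod.swap -` E" by auto
  then have "closed (prod.swap ` E)"
    using E(1) by (auto intro!: closed_vimage continuous_intros simp: prod.swap_def)
  from annihilating_sequence_if_curve[OF this * \<beta>] obtain \<nu> where
    \<nu>: "in_l2 (- \<beta>) \<nu>" "\<nu> (0, 0) \<noteq> 0" "\<And>q. (\<forall>z\<in>prod.swap ` E. eval2 q z = 0) \<Longrightarrow> pairing q \<nu> = 0" by blast
  show ?thesis
  proof (rule not_in_closure_if_annihilated)
    show "in_l2 (- \<beta>) (\<nu> \<circ> prod.swap)"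
    proof -
      have "(\<lambda>L. (norm (\<nu> L))\<^sup>2 * wt (- \<beta>) L) summable_on range prod.swap" using \<nu>(1) by (simp add: in_l2_def)
      then show ?thesis
        unfolding in_l2_def by (subst (asm) summable_on_reindex) (auto simp: o_def wt_def add.commute)
    qed
    show "(\<nu> \<circ> prod.swap) (0, 0) \<noteq> 0" using \<nu>(2) by simp
    show "pairing (p * f) (\<nu> \<circ> prod.swap) = 0" for p
      unfolding pairing_swap[symmetric] by (rule \<nu>(3)) (auto simp: eval2_swap_poly E(2))
  qed
qed

text \<open>
  The maximum that defines \<open>real_dim\<close> is attained, because the dimensions of subspaces are
  bounded. So the set contains a homeomorphic copy of an open interval.
\<close>
lemma real_dim_one_arc:
  assumes "real_dim (S :: 'a::euclidean_space set) = 1"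
  obtains T p q where "connected T" "T \<subseteq> S" "p \<in> T" "q \<in> T" "p \<noteq> q"
proof -
  define D where "D = insert (-1) {int (dim V) | (V :: 'a set) T. subspace V \<and> T \<subseteq> S \<and> (V \<inter> ball 0 1) homeomorphic T}"
  have "D \<subseteq> {-1..int (DIM('a))}"
    unfolding D_def by (auto simp: dim_subset_UNIV)
  then have "finite D" by (rule finite_subset) simp
  then have "Max D \<in> D" by (intro Max_in) (auto simp: D_def)
  moreover have "Max D = 1" using assms by (simp add: real_dim_def D_def)
  ultimately have "1 \<in> D" by simp
  then obtain V T where V: "int (dim V) = 1" "subspace V" "T \<subseteq> S" "(V \<inter> ball (0::'a) 1) homeomorphic T"
    unfolding D_def by auto
  then obtain h g where hg: "homeomorphism (V \<inter> ball 0 1) T h g" by (auto simp: homeomorphic_def)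
  have "\<not> V \<subseteq> {0}" using V(1) dim_eq_0[of V] by auto
  then obtain v where v: "v \<in> V" "v \<noteq> 0" by auto
  define u where "u = (1 / (2 * norm v)) *\<^sub>R v"
  have u: "u \<in> V \<inter> ball 0 1" "u \<noteq> 0"
    using v V(2) by (auto simp: u_def subspace_mul)
  have 0: "0 \<in> V \<inter> ball 0 1" using V(2) by (auto simp: subspace_0)
  show thesis
  proof
    have "connected (V \<inter> ball 0 1)"
      using V(2) by (intro convex_connected convex_Int convex_ball subspace_imp_convex)
    then show "connected T"
      using hg by (metis connected_continuous_image homeomorphism_cont1 homeomorphism_image1)
    show "h 0 \<in> T" "h u \<in> T" using hg 0 u homeomorphism_image1 by blast+
    show "h 0 \<noteq> h u" using hg 0 u by (metis homeomorphism_apply1)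
  qed (rule V(3))
qed

text \<open>
  The real parts of the first coordinates form a connected set. It has more than one point,
  since only two points of the circle have a given real part, and so it contains an interval. It is
  covered by the image of the angles under the cosine, which maps null sets to null sets.
\<close>
lemma angles_not_negligible:
  assumes T: "connected T" "T \<subseteq> E" "T \<subseteq> torus2" and pq: "p \<in> T" "q \<in> T" "fst p \<noteq> fst q"
  shows "\<not> negligible (angles E)"
proof
  assume neg: "negligible (angles E)"
  have C: "connected (fst ` T)" by (rule connected_continuous_image[OF _ T(1)]) (intro continuous_intros)
  then have R: "connected (Re ` fst ` T)" by (rule connected_continuous_image[rotated]) (intro continuous_intros)
  have "\<exists>a\<in>Re ` fst ` T. \<exists>b\<in>Re ` fst ` T. a < b"
  proof (rule ccontr)
    assume "\<not> ?thesis"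
    then have const: "Re x = Re (fst p)" if "x \<in> fst ` T" for x
      using that pq(1) by (metis imageI linorder_neqE_linordered_idom)
    have "fst ` T \<subseteq> {Complex (Re (fst p)) (sqrt (1 - (Re (fst p))\<^sup>2)), Complex (Re (fst p)) (- sqrt (1 - (Re (fst p))\<^sup>2))}"
    proof
      fix x assume x: "x \<in> fst ` T"
      then have "norm x = 1" using T(3) by (auto simp: torus2_def)
      then have "(Im x)\<^sup>2 = 1 - (Re (fst p))\<^sup>2"
        using const[OF x] cmod_power2[of x] by simp
      then have "\<bar>Im x\<bar> = sqrt (1 - (Re (fst p))\<^sup>2)" by (metis real_sqrt_abs)
      then show "x \<in> {Complex (Re (fst p)) (sqrt (1 - (Re (fst p))\<^sup>2)), Complex (Re (fst p)) (- sqrt (1 - (Re (fst p))\<^sup>2))}"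
        using const[OF x] by (auto simp: complex_eq_iff abs_if split: if_splits)
    qed
    then have "finite (fst ` T)" by (rule finite_subset) simp
    then show False
      using C pq connected_finite_iff_sing[of "fst ` T"] by (metis empty_iff imageI singletonD)
  qed
  then obtain a b where ab: "a \<in> Re ` fst ` T" "b \<in> Re ` fst ` T" "a < b" by blast
  then have sub: "{a..b} \<subseteq> Re ` fst ` T" using connected_contains_Icc[OF R] by blast
  have "{a..b} \<subseteq> cos ` angles E"
  proof
    fix x assume "x \<in> {a..b}"
    then obtain z where z: "z \<in> T" "x = Re (fst z)" using sub by auto
    have c: "\<exists>s\<in>{0..2 * pi}. y = cis s" if "norm y = 1" for y
      using Arg2pi[of y] that by (intro bexI[of _ "Arg2pi y"]) (auto simp: cis_conv_exp is_Arg_def)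
    have "norm (fst z) = 1" "norm (snd z) = 1" using z T(3) by (auto simp: torus2_def mem_Times_iff)
    then obtain s t where st: "s \<in> {0..2 * pi}" "fst z = cis s" "t \<in> {0..2 * pi}" "snd z = cis t"
      using c by metis
    then have "(cis s, cis t) \<in> E" using z(1) T(2) by (metis prod.collapse subsetD)
    then have "s \<in> angles E" using st by (auto simp: angles_def)
    then show "x \<in> cos ` angles E" using z st by auto
  qed
  moreover have "negligible (cos ` angles E)"
  proof (rule negligible_differentiable_image_negligible[OF _ neg])
    show "cos differentiable_on angles E"
      unfolding differentiable_on_def real_differentiable_def[symmetric]
      by (auto intro!: differentiableI simp: differentiable_def has_field_derivative_def
          intro: exI[of _ "\<lambda>x. - sin _ * x"] DERIV_cos[unfolded has_field_derivative_def, THEN has_derivative_at_withinI])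
  qed simp
  ultimately have "negligible {a..b}" using negligible_subset by blast
  then show False using negligible_interval(1)[of a b] ab by (simp add: box_real cbox_interval)
qed

lemma not_in_closure_if_real_dim_one:
  assumes "real_dim (zero_set f \<inter> torus2) = 1" "\<beta> > 1"
  shows "\<not> in_closure \<beta> f (pcoef 1)"
proof -
  obtain T p q where T: "connected T" "T \<subseteq> zero_set f \<inter> torus2" "p \<in> T" "q \<in> T" "p \<noteq> q"
    using real_dim_one_arc[OF assms(1)] by metis
  show ?thesis
  proof (rule not_in_closure_if_curve[where E = "zero_set f"])
    show "closed (zero_set f)"
      unfolding zero_set_def by (intro closed_Collect_eq continuous_intros)
    show "\<not> negligible (angles (zero_set f)) \<or> \<not> negligible (angles (prod.swap ` zero_set f))"
    proof (cases "fst p = fst q")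
      case False
      then have "\<not> negligible (angles (zero_set f))"
        using T by (intro angles_not_negligible[of T _ p q]) auto
      then show ?thesis ..
    next
      case True
      have "connected (prod.swap ` T)"
        by (intro connected_continuous_image T) (auto intro!: continuous_intros simp: prod.swap_def)
      then have "\<not> negligible (angles (prod.swap ` zero_set f))"
        using T True by (intro angles_not_negligible[of "prod.swap ` T" _ "prod.swap p" "prod.swap q"])
          (auto simp: torus2_def prod_eq_iff)
      then show ?thesis ..
    qed
  qed (use assms in \<open>auto simp: zero_set_def\<close>)
qed

section \<open>Elimination on the torus\<close>

lemma poly_lower_bound_roots:
  fixes p :: "complex poly"
  assumes "p \<noteq> 0" "\<And>\<zeta>. poly p \<zeta> = 0 \<Longrightarrow> d \<le> norm (w - \<zeta>)" "d \<ge> 0"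
  shows "norm (lead_coeff p) * d ^ degree p \<le> norm (poly p w)"
  using assms(1,2)
proof (induction "degree p" arbitrary: p)
  case 0
  then obtain c where "p = [:c:]" by (metis degree_eq_zeroE)
  then show ?case by simp
next
  case (Suc n)
  then have "\<not> constant (poly p)" by (simp add: constant_degree)
  then obtain \<zeta> where \<zeta>: "poly p \<zeta> = 0" using fundamental_theorem_of_algebra by blast
  then obtain q where q: "p = [:-\<zeta>, 1:] * q" by (metis dvdE poly_eq_0_iff_dvd)
  have qn: "q \<noteq> 0" using q Suc.hyps by auto
  then have dp: "degree p = Suc (degree q)" unfolding q by (subst degree_mult_eq) auto
  have lc: "lead_coeff p = lead_coeff q" unfolding q lead_coeff_mult by simp
  have "norm (lead_coeff q) * d ^ degree q \<le> norm (poly q w)"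
    by (rule Suc.hyps(1)) (use dp Suc.hyps(2) Suc.prems qn in \<open>auto simp: q\<close>)
  then have "d * (norm (lead_coeff q) * d ^ degree q) \<le> norm (w - \<zeta>) * norm (poly q w)"
    using Suc.prems(2)[OF \<zeta>] assms(3) by (intro mult_mono) auto
  also have "\<dots> = norm (poly p w)"
    unfolding norm_mult[symmetric] by (simp add: q algebra_simps)
  finally show ?case unfolding lc by (simp add: dp mult_ac)
qed

text \<open>
  Up to a monomial, this is the complex conjugate of f composed with the inversion in the torus
  (\<open>eval2_reflect2\<close>). The number \<open>degree_bound f\<close> serves as the degree of the reflection in both
  variables.
\<close>
definition reflect2 :: "complex poly poly \<Rightarrow> complex poly poly" where
  "reflect2 f = poly_of (\<lambda>L. cnj (pcoef f (degree_bound f - fst L, degree_bound f - snd L))) ({..degree_bound f} \<times> {..degree_bound f})"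

lemma supp_square: "supp f \<subseteq> {..degree_bound f} \<times> {..degree_bound f}"
  using le_degree_bound[of _ f] by force

lemma eval2_reflect2:
  assumes "z \<noteq> 0" "w \<noteq> 0"
  shows "eval2 (reflect2 f) (z, w) = z ^ degree_bound f * w ^ degree_bound f * cnj (eval2 f (1 / cnj z, 1 / cnj w))"
proof -
  let ?N = "degree_bound f"
  let ?S = "{..?N} \<times> {..?N}"
  let ?i = "\<lambda>L. (?N - fst L, ?N - snd L)"
  have "eval2 f (1 / cnj z, 1 / cnj w) = (\<Sum>L\<in>?S. pcoef f L * ((1 / cnj z) ^ fst L * (1 / cnj w) ^ snd L))"
    unfolding eval2_eq_sum by (rule sum.mono_neutral_cong_left) (use supp_square[of f] in \<open>auto simp: supp_def\<close>)
  then have "z ^ ?N * w ^ ?N * cnj (eval2 f (1 / cnj z, 1 / cnj w)) =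
      (\<Sum>L\<in>?S. cnj (pcoef f L) * ((z ^ ?N * (1 / z) ^ fst L) * (w ^ ?N * (1 / w) ^ snd L)))"
    by (simp add: cnj_sum sum_distrib_left mult_ac)
  also have "\<dots> = (\<Sum>L\<in>?S. cnj (pcoef f L) * (z ^ (?N - fst L) * w ^ (?N - snd L)))"
    using assms by (intro sum.cong refl) (auto simp: power_diff power_divide)
  also have "\<dots> = (\<Sum>L\<in>?S. cnj (pcoef f (?i L)) * (z ^ fst L * w ^ snd L))"
    by (rule sum.reindex_bij_witness[of _ ?i ?i]) auto
  also have "\<dots> = eval2 (reflect2 f) (z, w)"
    by (simp add: reflect2_def eval2_poly_of)
  finally show ?thesis by simp
qed

lemma norm_reflect2_torus:
  assumes "z \<in> torus2"
  shows "norm (eval2 (reflect2 f) z) = norm (eval2 f z)"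
proof -
  obtain x y where z: "z = (x, y)" "norm x = 1" "norm y = 1"
    using assms by (auto simp: torus2_def)
  have inv: "1 / cnj v = v" if "norm v = 1" for v :: complex
  proof -
    have "v * cnj v = 1" using that by (simp add: complex_norm_square[symmetric])
    moreover from this have "cnj v \<noteq> 0" by auto
    ultimately show ?thesis by (simp add: field_simps)
  qed
  have "x \<noteq> 0" "y \<noteq> 0" using z by auto
  then show ?thesis
    using z by (simp add: eval2_reflect2 inv norm_mult norm_power del: complex_cnj_cnj)
qed

lemma eval2_map_poly: "eval2 p (z, w) = poly (map_poly (\<lambda>c. poly c z) p) w"
  by (induction p) (auto simp: eval2_def map_poly_pCons)

lemma infinite_sphere: "infinite (sphere (0::complex) 1)"
proof
  assume "finite (sphere (0::complex) 1)"
  moreover have "1 \<in> sphere (0::complex) 1" "-1 \<in> sphere (0::complex) 1" "(1::complex) \<noteq> -1"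
    by (auto simp: complex_eq_iff)
  ultimately show False
    using connected_sphere[of "0::complex" 1] connected_finite_iff_sing[of "sphere (0::complex) 1"]
    by (metis DIM_complex empty_iff order_refl singletonD)
qed

text \<open>
  Away from the finite set \<open>Bd\<close>, zeros of h are zeros of both f and its reflection. The former
  has no zeros with both coordinates inside the disc, the latter none with both coordinates outside.
  So over a generic point z of the circle every root of h lies on the circle, because it is a
  limit of roots over points inside and of roots over points outside the disc. Here continuity of the
  roots is used in a quantitative form: if all roots over nearby points had distance at least
  \<open>\<delta>\<close> from w, the values of h at w would be bounded away from 0.
\<close>
lemma infinite_zeros_if_common_component:
  assumes nz: "\<And>z. z \<in> bidisk \<Longrightarrow> eval2 f z \<noteq> 0"
    and h: "degree h > 0" "smult c f = h * q" "smult d (reflect2 f) = h * q'" "c \<noteq> 0" "d \<noteq> 0"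
  shows "infinite (zero_set f \<inter> torus2)"
proof -
  define lc where "lc = lead_coeff h"
  have lc: "lc \<noteq> 0" using h(1) by (auto simp: lc_def)
  define Bd where "Bd = {z. poly (c * d * lc) z = 0}"
  have Bd: "finite Bd" unfolding Bd_def by (rule poly_roots_finite) (use lc h in auto)
  define P where "P z = map_poly (\<lambda>c. poly c z) h" for z
  have Pe: "poly (P z) w = eval2 h (z, w)" for z w by (simp add: P_def eval2_map_poly)
  have Pd: "degree (P z) = degree h" "lead_coeff (P z) = poly lc z" if "z \<notin> Bd" for z
  proof -
    have "poly lc z \<noteq> 0" using that by (auto simp: Bd_def)
    then show "degree (P z) = degree h"
      unfolding P_def lc_def by (intro antisym le_degree degree_le) (auto simp: coeff_map_poly coeff_eq_0)
    then show "lead_coeff (P z) = poly lc z" by (simp add: P_def lc_def coeff_map_poly)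
  qed
  have fz: "eval2 f (z, w) = 0" "eval2 (reflect2 f) (z, w) = 0" if "z \<notin> Bd" "eval2 h (z, w) = 0" for z w
  proof -
    have e: "eval2 (smult c g) (z, w) = poly c z * eval2 g (z, w)" for c g by (simp add: eval2_def)
    have "poly c z * eval2 f (z, w) = 0" "poly d z * eval2 (reflect2 f) (z, w) = 0"
      unfolding e[symmetric] h(2,3) using that(2) by simp_all
    then show "eval2 f (z, w) = 0" "eval2 (reflect2 f) (z, w) = 0"
      using that(1) by (auto simp: Bd_def)
  qed
  \<comment> \<open>Roots over points inside the disc lie outside, and vice versa.\<close>
  have inner: "norm w \<ge> 1" if "z \<notin> Bd" "norm z < 1" "poly (P z) w = 0" for z w
    using nz[of "(z, w)"] fz(1)[of z w] that by (force simp: bidisk_def Pe)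
  have outer: "norm w \<le> 1" if "z \<notin> Bd" "norm z > 1" "poly (P z) w = 0" for z w
  proof (rule ccontr)
    assume "\<not> norm w \<le> 1"
    then have n0: "z \<noteq> 0" "w \<noteq> 0" and w: "norm w > 1" using that(2) by auto
    have "eval2 (reflect2 f) (z, w) = 0" using fz(2)[of z w] that by (simp add: Pe)
    then have "eval2 f (1 / cnj z, 1 / cnj w) = 0" using n0 by (simp add: eval2_reflect2)
    moreover have "(1 / cnj z, 1 / cnj w) \<in> bidisk"
      using that(2) w by (auto simp: bidisk_def norm_divide divide_less_eq)
    ultimately show False using nz by blast
  qed
  have on_circle: "norm w = 1" if z: "norm z = 1" "z \<notin> Bd" and w: "poly (P z) w = 0" for z w
  proof (rule ccontr)
    assume w1: "norm w \<noteq> 1"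
    define \<delta> where "\<delta> = \<bar>norm w - 1\<bar>"
    have \<delta>: "\<delta> > 0" using w1 by (simp add: \<delta>_def)
    \<comment> \<open>The point z is approached radially, from the side that contradicts the position of w.\<close>
    define F :: "real filter" where "F = (if norm w > 1 then at_right 1 else at_left 1)"
    have Fnb: "F \<noteq> bot" by (simp add: F_def)
    have F1: "((\<lambda>s. s) \<longlongrightarrow> 1) F" by (simp add: F_def)
    have zs: "((\<lambda>s. of_real s * z) \<longlongrightarrow> z) F"
      using tendsto_mult[OF tendsto_of_real[OF F1] tendsto_const[of z]] by simp
    have Fin: "eventually (\<lambda>s. s \<noteq> 1) F" unfolding F_def
      by (auto simp: eventually_at_filter)
    have ev1: "eventually (\<lambda>s. of_real s * z \<notin> Bd) F"
    proof -
      have "open (- Bd)" using Bd by (simp add: finite_imp_closed open_Compl)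
      from topological_tendstoD[OF zs this] z(2) show ?thesis by simp
    qed
    have ev2: "eventually (\<lambda>s. if norm w > 1 then s > 1 else 0 < s \<and> s < 1) F"
    proof (cases "norm w > 1")
      case True
      then show ?thesis by (simp add: F_def eventually_at_right_less)
    next
      case False
      have "eventually (\<lambda>s. s \<in> {0<..<1}) (at_left (1::real))"
        by (rule eventually_at_leftI[of 0]) auto
      then show ?thesis using False by (simp add: F_def)
    qed
    have le: "eventually (\<lambda>s. norm (poly lc (of_real s * z)) * \<delta> ^ degree h \<le> norm (eval2 h (of_real s * z, w))) F"
      using ev1 ev2
    proof eventually_elim
      case (elim s)
      have dist: "\<delta> \<le> norm (w - \<zeta>)" if "poly (P (of_real s * z)) \<zeta> = 0" for \<zeta>
      proof (cases "norm w > 1")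
        case True
        then have "norm \<zeta> \<le> 1" using outer[OF elim(1) _ that] elim(2) z(1) by (simp add: norm_mult)
        then show ?thesis using True norm_triangle_ineq2[of w \<zeta>] by (simp add: \<delta>_def)
      next
        case False
        then have "norm \<zeta> \<ge> 1" using inner[OF elim(1) _ that] elim(2) z(1) by (simp add: norm_mult)
        then show ?thesis using False norm_triangle_ineq2[of \<zeta> w] by (simp add: \<delta>_def norm_minus_commute)
      qed
      have "P (of_real s * z) \<noteq> 0" using Pd(1)[OF elim(1)] h(1) by auto
      then have "norm (lead_coeff (P (of_real s * z))) * \<delta> ^ degree (P (of_real s * z)) \<le> norm (poly (P (of_real s * z)) w)"
        by (rule poly_lower_bound_roots) (use dist \<delta> in auto)
      then show ?case unfolding Pd(2)[OF elim(1)] Pe by (simp only: Pd(1)[OF elim(1)])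
    qed
    have "((\<lambda>s. norm (poly lc (of_real s * z)) * \<delta> ^ degree h) \<longlongrightarrow> norm (poly lc z) * \<delta> ^ degree h) F"
      by (intro tendsto_intros isCont_tendsto_compose[OF _ zs]) simp
    moreover have "((\<lambda>s. norm (eval2 h (of_real s * z, w))) \<longlongrightarrow> norm (eval2 h (z, w))) F"
    proof -
      have "isCont (\<lambda>x. eval2 h (x, w)) z" by (simp add: eval2_def)
      from isCont_tendsto_compose[OF this zs] show ?thesis by (intro tendsto_intros)
    qed
    ultimately have "norm (poly lc z) * \<delta> ^ degree h \<le> norm (eval2 h (z, w))"
      using le Fnb by (intro tendsto_le[where F = F])
    also have "\<dots> = 0" using w by (simp add: Pe)
    finally have "poly lc z = 0" using zero_less_power[OF \<delta>, of "degree h"] by (auto simp: mult_le_0_iff)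
    then show False using z(2) by (simp add: Bd_def)
  qed
  have "sphere 0 1 - Bd \<subseteq> fst ` (zero_set f \<inter> torus2)"
  proof
    fix z assume z: "z \<in> sphere 0 1 - Bd"
    then have "\<not> constant (poly (P z))" using Pd(1)[of z] h(1) by (simp add: constant_degree)
    then obtain w where w: "poly (P z) w = 0" using fundamental_theorem_of_algebra by blast
    then have "norm w = 1" using on_circle z by auto
    moreover have "eval2 f (z, w) = 0" using fz(1)[of z w] w z by (simp add: Pe)
    ultimately have "(z, w) \<in> zero_set f \<inter> torus2" using z by (auto simp: zero_set_def torus2_def)
    then show "z \<in> fst ` (zero_set f \<inter> torus2)" by force
  qed
  moreover have "infinite (sphere (0::complex) 1 - Bd)" using Bd infinite_sphere by simp
  ultimately show ?thesis by (meson finite_imageI finite_subset)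
qed

text \<open>
  An element h of least degree in the ideal divides f and its reflection up to factors in
  the first variable, by pseudo-division. If h had positive degree, then there would be infinitely many
  zeros on the torus.
\<close>
lemma elimination_polynomial:
  assumes nz: "\<And>z. z \<in> bidisk \<Longrightarrow> eval2 f z \<noteq> 0" and fin: "finite (zero_set f \<inter> torus2)"
  shows "\<exists>R A B. R \<noteq> 0 \<and> [:R:] = A * f + B * reflect2 f"
proof -
  define I where "I = {A * f + B * reflect2 f | A B. True}"
  have f0: "f \<noteq> 0" using nz[of "(0, 0)"] by (auto simp: bidisk_def)
  have fI: "f \<in> I" "reflect2 f \<in> I"
    unfolding I_def by (auto intro: exI[of _ 0] exI[of _ 1])
  have closed: "x * a - y * b \<in> I" if ab: "a \<in> I" "b \<in> I" for a b x y
  proof -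
    obtain A B where a: "a = A * f + B * reflect2 f" using ab(1) by (auto simp: I_def)
    obtain A' B' where b: "b = A' * f + B' * reflect2 f" using ab(2) by (auto simp: I_def)
    have "x * a - y * b = (x * A - y * A') * f + (x * B - y * B') * reflect2 f"
      by (simp add: a b algebra_simps)
    then show ?thesis unfolding I_def by blast
  qed
  obtain h where h: "h \<in> I" "h \<noteq> 0" and min: "\<And>g. g \<in> I \<Longrightarrow> g \<noteq> 0 \<Longrightarrow> degree h \<le> degree g"
    using ex_has_least_nat[of "\<lambda>g. g \<in> I \<and> g \<noteq> 0" f degree] fI(1) f0 by blast
  have dvd: "\<exists>c q. c \<noteq> 0 \<and> smult c g = h * q" if g: "g \<in> I" for g
  proof -
    obtain c q where cq: "c \<noteq> 0" "smult c g = h * q + pseudo_mod g h"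
      using pseudo_mod(1)[OF h(2), of g] by auto
    have "pseudo_mod g h = [:c:] * g - q * h" using cq(2) by (simp add: algebra_simps)
    then have "pseudo_mod g h \<in> I" using closed[OF g h(1), of "[:c:]" q] by simp
    then have "pseudo_mod g h = 0" using min pseudo_mod(2)[OF h(2), of g] by force
    then show ?thesis using cq by auto
  qed
  have "degree h = 0"
  proof (rule ccontr)
    assume "degree h \<noteq> 0"
    moreover obtain c q where "c \<noteq> 0" "smult c f = h * q" using dvd[OF fI(1)] by blast
    moreover obtain d q' where "d \<noteq> 0" "smult d (reflect2 f) = h * q'" using dvd[OF fI(2)] by blast
    ultimately show False using infinite_zeros_if_common_component[OF nz] fin by blast
  qed
  then obtain R where "h = [:R:]" by (metis degree_eq_zeroE)
  then show ?thesis using h by (auto simp: I_def)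
qed

section \<open>A Lojasiewicz inequality\<close>

text \<open>
  Inequalities with unspecified exponent and constant can be composed, added and patched together
  over a compact set, without tracking the exponents. For bounded u a larger exponent is a weaker
  requirement, up to the constant.
\<close>
definition dominated :: "'a set \<Rightarrow> ('a \<Rightarrow> real) \<Rightarrow> ('a \<Rightarrow> real) \<Rightarrow> bool" where
  "dominated X u \<phi> \<longleftrightarrow> (\<exists>N C. \<forall>x\<in>X. u x ^ N \<le> C * \<phi> x)"

lemma dominatedI: "(\<And>x. x \<in> X \<Longrightarrow> u x ^ N \<le> C * \<phi> x) \<Longrightarrow> dominated X u \<phi>"
  unfolding dominated_def by blast

lemma dominatedE:
  assumes "dominated X u \<phi>" "\<And>x. x \<in> X \<Longrightarrow> \<phi> x \<ge> 0"
  obtains N C where "C > 0" "\<And>x. x \<in> X \<Longrightarrow> u x ^ N \<le> C * \<phi> x"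
proof -
  obtain N C where C: "\<And>x. x \<in> X \<Longrightarrow> u x ^ N \<le> C * \<phi> x" using assms by (auto simp: dominated_def)
  have "u x ^ N \<le> (\<bar>C\<bar> + 1) * \<phi> x" if "x \<in> X" for x
    by (rule order_trans[OF C[OF that]]) (intro mult_right_mono assms that; simp)
  then show thesis using that[of "\<bar>C\<bar> + 1" N] by simp
qed

lemma dominated_trans:
  assumes "dominated X u \<psi>" "dominated X \<psi> \<phi>" "\<And>x. x \<in> X \<Longrightarrow> u x \<ge> 0" "\<And>x. x \<in> X \<Longrightarrow> \<psi> x \<ge> 0"
  shows "dominated X u \<phi>"
proof -
  obtain N C where C: "C > 0" "\<And>x. x \<in> X \<Longrightarrow> u x ^ N \<le> C * \<psi> x" using dominatedE[OF assms(1,4)] by blast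
  obtain M D where D: "\<And>x. x \<in> X \<Longrightarrow> \<psi> x ^ M \<le> D * \<phi> x" using assms(2) by (auto simp: dominated_def)
  show ?thesis
  proof (rule dominatedI)
    fix x assume x: "x \<in> X"
    have "u x ^ (N * M) \<le> (C * \<psi> x) ^ M"
      unfolding power_mult using assms(3)[OF x] C(2)[OF x] by (intro power_mono) auto
    also have "\<dots> = C ^ M * \<psi> x ^ M" by (simp add: power_mult_distrib)
    also have "\<dots> \<le> C ^ M * (D * \<phi> x)" using C(1) D[OF x] by (intro mult_left_mono) auto
    finally show "u x ^ (N * M) \<le> (C ^ M * D) * \<phi> x" by (simp add: mult_ac)
  qed
qed

lemma dominated_mono:
  assumes "dominated X v \<phi>" "\<And>x. x \<in> X \<Longrightarrow> 0 \<le> u x" "\<And>x. x \<in> X \<Longrightarrow> u x \<le> K * v x" "K \<ge> 0"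
  shows "dominated X u \<phi>"
proof -
  obtain N C where C: "\<And>x. x \<in> X \<Longrightarrow> v x ^ N \<le> C * \<phi> x" using assms(1) by (auto simp: dominated_def)
  show ?thesis
  proof (rule dominatedI)
    fix x assume x: "x \<in> X"
    have "u x ^ N \<le> (K * v x) ^ N" using assms(2,3)[OF x] by (intro power_mono) auto
    also have "\<dots> \<le> K ^ N * (C * \<phi> x)"
      unfolding power_mult_distrib using C[OF x] assms(4) by (intro mult_left_mono) auto
    finally show "u x ^ N \<le> (K ^ N * C) * \<phi> x" by (simp add: mult_ac)
  qed
qed

lemma dominated_self: "(\<And>x. x \<in> X \<Longrightarrow> u x \<le> K * \<phi> x) \<Longrightarrow> dominated X u \<phi>"
  by (rule dominatedI[where N = 1]) simp

lemma dominated_add: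
  assumes "dominated X u \<phi>" "dominated X v \<phi>" and \<phi>: "\<And>x. x \<in> X \<Longrightarrow> \<phi> x \<ge> 0"
    and u: "\<And>x. x \<in> X \<Longrightarrow> 0 \<le> u x" "\<And>x. x \<in> X \<Longrightarrow> u x \<le> B"
    and v: "\<And>x. x \<in> X \<Longrightarrow> 0 \<le> v x" "\<And>x. x \<in> X \<Longrightarrow> v x \<le> B"
  shows "dominated X (\<lambda>x. u x + v x) \<phi>"
proof -
  obtain N C where C: "C > 0" "\<And>x. x \<in> X \<Longrightarrow> u x ^ N \<le> C * \<phi> x" using dominatedE[OF assms(1) \<phi>] by blast
  obtain M D where D: "D > 0" "\<And>x. x \<in> X \<Longrightarrow> v x ^ M \<le> D * \<phi> x" using dominatedE[OF assms(2) \<phi>] by blast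
  show ?thesis
  proof (rule dominatedI)
    fix x assume x: "x \<in> X"
    have B: "B \<ge> 0" using u[OF x] by linarith
    have "u x ^ (N + M) \<le> (C * \<phi> x) * B ^ M"
      unfolding power_add using u[OF x] C x \<phi>[OF x] B by (intro mult_mono power_mono C) auto
    moreover have "v x ^ (N + M) \<le> B ^ N * (D * \<phi> x)"
      unfolding power_add using v[OF x] D x \<phi>[OF x] B by (intro mult_mono power_mono D) auto
    moreover have "(u x + v x) ^ (N + M) \<le> 2 ^ (N + M) * (u x ^ (N + M) + v x ^ (N + M))"
    proof -
      have "(u x + v x) ^ (N + M) \<le> (2 * max (u x) (v x)) ^ (N + M)"
        using u(1)[OF x] v(1)[OF x] by (intro power_mono) auto
      also have "\<dots> = 2 ^ (N + M) * max (u x) (v x) ^ (N + M)" by (simp add: power_mult_distrib)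
      also have "max (u x) (v x) ^ (N + M) \<le> u x ^ (N + M) + v x ^ (N + M)"
        using u(1)[OF x] v(1)[OF x] by (auto simp: max_def)
      finally show ?thesis by simp
    qed
    ultimately have "(u x + v x) ^ (N + M) \<le> 2 ^ (N + M) * ((C * \<phi> x) * B ^ M + B ^ N * (D * \<phi> x))"
      by (smt (verit) mult_left_mono zero_le_power)
    also have "\<dots> = (2 ^ (N + M) * (C * B ^ M + B ^ N * D)) * \<phi> x" by (simp add: algebra_simps)
    finally show "(u x + v x) ^ (N + M) \<le> (2 ^ (N + M) * (C * B ^ M + B ^ N * D)) * \<phi> x" .
  qed
qed

lemma dominated_Un:
  assumes "dominated X u \<phi>" "dominated Y u \<phi>" and \<phi>: "\<And>x. \<phi> x \<ge> 0"
    and u: "\<And>x. 0 \<le> u x" "\<And>x. x \<in> X \<union> Y \<Longrightarrow> u x \<le> B"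
  shows "dominated (X \<union> Y) u \<phi>"
proof -
  obtain N C where C: "C > 0" "\<And>x. x \<in> X \<Longrightarrow> u x ^ N \<le> C * \<phi> x" using dominatedE[OF assms(1) \<phi>] by blast
  obtain M D where D: "D > 0" "\<And>x. x \<in> Y \<Longrightarrow> u x ^ M \<le> D * \<phi> x" using dominatedE[OF assms(2) \<phi>] by blast
  show ?thesis
  proof (rule dominatedI)
    fix x assume x: "x \<in> X \<union> Y"
    have B: "B \<ge> 0" using u(1)[of x] u(2)[OF x] by linarith
    have "u x ^ (N + M) \<le> (C * \<phi> x) * B ^ M \<or> u x ^ (N + M) \<le> B ^ N * (D * \<phi> x)"
    proof (cases "x \<in> X")
      case True
      have "u x ^ (N + M) \<le> (C * \<phi> x) * B ^ M"
        unfolding power_add using u(1)[of x] u(2)[OF x] C True \<phi>[of x] B by (intro mult_mono power_mono C) auto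
      then show ?thesis ..
    next
      case False
      have "u x ^ (N + M) \<le> B ^ N * (D * \<phi> x)"
        unfolding power_add using u(1)[of x] u(2)[OF x] D x False \<phi>[of x] B by (intro mult_mono power_mono D) auto
      then show ?thesis ..
    qed
    moreover have "0 \<le> (C * \<phi> x) * B ^ M" "0 \<le> B ^ N * (D * \<phi> x)" using B C(1) D(1) \<phi>[of x] by auto
    ultimately have "u x ^ (N + M) \<le> (C * \<phi> x) * B ^ M + B ^ N * (D * \<phi> x)" by linarith
    then show "u x ^ (N + M) \<le> (C * B ^ M + B ^ N * D) * \<phi> x" by (simp add: algebra_simps)
  qed
qed

lemma dominated_compact:
  fixes X :: "'a::t2_space set"
  assumes X: "compact X" and \<phi>: "\<And>x. \<phi> x \<ge> 0" and u: "\<And>x. 0 \<le> u x" "\<And>x. x \<in> X \<Longrightarrow> u x \<le> B"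
    and loc: "\<And>x. x \<in> X \<Longrightarrow> \<exists>U. open U \<and> x \<in> U \<and> dominated (X \<inter> U) u \<phi>"
  shows "dominated X u \<phi>"
proof -
  from loc obtain U where U: "\<And>x. x \<in> X \<Longrightarrow> open (U x) \<and> x \<in> U x \<and> dominated (X \<inter> U x) u \<phi>" by metis
  then have "X \<subseteq> (\<Union>x\<in>X. U x)" by blast
  then obtain F where F: "F \<subseteq> X" "finite F" "X \<subseteq> (\<Union>x\<in>F. U x)"
    by (rule compactE_image[OF X, rotated]) (use U in auto)
  have "dominated (\<Union>x\<in>F. X \<inter> U x) u \<phi>"
    using F(2,1)
  proof (induction F)
    case empty
    then show ?case by (simp add: dominated_def)
  next
    case (insert x F)
    have "dominated ((X \<inter> U x) \<union> (\<Union>x\<in>F. X \<inter> U x)) u \<phi>"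
      by (rule dominated_Un[where B = B]) (use insert U \<phi> u in auto)
    then show ?case by simp
  qed
  moreover have "(\<Union>x\<in>F. X \<inter> U x) = X" using F(3) by auto
  ultimately show ?thesis by simp
qed

lemma poly_zero_order_bound:
  fixes P :: "complex poly"
  assumes "P \<noteq> 0"
  shows "\<exists>U N C. open U \<and> z0 \<in> U \<and> (\<forall>z\<in>U. norm (z - z0) ^ N \<le> C * norm (poly P z))"
proof -
  obtain q where q: "P = [:- z0, 1:] ^ order z0 P * q" "\<not> [:- z0, 1:] dvd q"
    using order_decomp[OF assms] by blast
  have q0: "poly q z0 \<noteq> 0" using q(2) by (simp add: poly_eq_0_iff_dvd)
  define U where "U = {z. norm (poly q z0) / 2 < norm (poly q z)}"
  have "open U" unfolding U_def by (intro open_Collect_less continuous_intros)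
  moreover have "z0 \<in> U" using q0 by (simp add: U_def)
  moreover have "norm (z - z0) ^ order z0 P \<le> 2 / norm (poly q z0) * norm (poly P z)" if "z \<in> U" for z
  proof -
    have "norm (poly P z) = norm (z - z0) ^ order z0 P * norm (poly q z)"
      by (subst q(1)) (simp add: norm_mult norm_power)
    moreover have "norm (z - z0) ^ order z0 P * (norm (poly q z0) / 2) \<le> norm (z - z0) ^ order z0 P * norm (poly q z)"
      using that by (intro mult_left_mono) (auto simp: U_def)
    ultimately show ?thesis using q0 by (simp add: field_simps)
  qed
  ultimately show ?thesis by blast
qed

lemma bounded_eval2: "\<exists>B>0. \<forall>z\<in>closed_bidisk. norm (eval2 f z) \<le> B"
proof -
  have "compact (eval2 f ` closed_bidisk)"
    unfolding closed_bidisk_def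
    by (intro compact_continuous_image compact_Times compact_cball continuous_intros)
  then obtain B where "B > 0" "\<And>y. y \<in> eval2 f ` closed_bidisk \<Longrightarrow> norm y \<le> B"
    using compact_imp_bounded bounded_pos by metis
  then show ?thesis by blast
qed

lemma eval2_lipschitz:
  "\<exists>K\<ge>0. \<forall>z\<in>closed_bidisk. \<forall>w\<in>closed_bidisk.
     norm (eval2 f z - eval2 f w) \<le> K * (norm (fst z - fst w) + norm (snd z - snd w))"
proof -
  define K where "K = (\<Sum>L\<in>supp f. norm (pcoef f L) * real (fst L + snd L))"
  have "norm (eval2 f z - eval2 f w) \<le> K * (norm (fst z - fst w) + norm (snd z - snd w))"
    if z: "z \<in> closed_bidisk" and w: "w \<in> closed_bidisk" for z w
  proof -
    let ?d = "norm (fst z - fst w) + norm (snd z - snd w)"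
    have zw: "norm (fst z) \<le> 1" "norm (snd z) \<le> 1" "norm (fst w) \<le> 1" "norm (snd w) \<le> 1"
      using z w by (auto simp: closed_bidisk_def mem_Times_iff)
    have "norm (fst z ^ k * snd z ^ l - fst w ^ k * snd w ^ l) \<le> real (k + l) * ?d" for k l
    proof -
      have "fst z ^ k * snd z ^ l - fst w ^ k * snd w ^ l = (fst z ^ k - fst w ^ k) * snd z ^ l + fst w ^ k * (snd z ^ l - snd w ^ l)"
        by (simp add: algebra_simps)
      also have "norm \<dots> \<le> norm (fst z ^ k - fst w ^ k) * norm (snd z) ^ l + norm (fst w) ^ k * norm (snd z ^ l - snd w ^ l)"
        by (rule order_trans[OF norm_triangle_ineq]) (simp add: norm_mult norm_power)
      also have "\<dots> \<le> (real k * norm (fst z - fst w)) * 1 + 1 * (real l * norm (snd z - snd w))"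
        using zw by (intro add_mono mult_mono norm_power_diff power_le_one) auto
      also have "\<dots> \<le> real (k + l) * ?d" by (simp add: algebra_simps)
      finally show ?thesis .
    qed
    then have *: "norm (pcoef f L * (fst z ^ fst L * snd z ^ snd L - fst w ^ fst L * snd w ^ snd L))
        \<le> norm (pcoef f L) * (real (fst L + snd L) * ?d)" for L
      unfolding norm_mult by (intro mult_left_mono) auto
    have "eval2 f z - eval2 f w = (\<Sum>L\<in>supp f. pcoef f L * (fst z ^ fst L * snd z ^ snd L - fst w ^ fst L * snd w ^ snd L))"
      by (simp add: eval2_eq_sum sum_subtractf right_diff_distrib)
    also have "norm \<dots> \<le> (\<Sum>L\<in>supp f. norm (pcoef f L) * (real (fst L + snd L) * ?d))"
      by (rule sum_norm_le) (rule *)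
    also have "\<dots> = K * ?d" by (simp add: K_def sum_distrib_right mult.assoc)
    finally show ?thesis .
  qed
  moreover have "K \<ge> 0" unfolding K_def by (intro sum_nonneg) auto
  ultimately show ?thesis by blast
qed

lemma torus2_subset: "torus2 \<subseteq> closed_bidisk"
  by (auto simp: torus2_def closed_bidisk_def)

text \<open>
  The elimination polynomial R controls the distance in the first coordinate. In the second
  coordinate the restriction S of f to the line through x is a nonzero polynomial, since otherwise f would
  vanish on a circle. It controls the distance, and it differs from f by at most a multiple of the distance
  in the first coordinate.
\<close>
lemma distance_to_zero_dominated:
  assumes nz: "\<And>z. z \<in> bidisk \<Longrightarrow> eval2 f z \<noteq> 0" and fin: "finite (zero_set f \<inter> torus2)"
    and x: "x \<in> torus2"
  shows "\<exists>U. open U \<and> x \<in> U \<and>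
    dominated (torus2 \<inter> U) (\<lambda>z. norm (fst z - fst x) + norm (snd z - snd x)) (\<lambda>z. norm (eval2 f z))"
proof -
  obtain R A B where R: "R \<noteq> 0" "[:R:] = A * f + B * reflect2 f"
    using elimination_polynomial[OF nz fin] by blast
  obtain BA where BA: "\<And>z. z \<in> closed_bidisk \<Longrightarrow> norm (eval2 A z) \<le> BA" using bounded_eval2[of A] by blast
  obtain BB where BB: "\<And>z. z \<in> closed_bidisk \<Longrightarrow> norm (eval2 B z) \<le> BB" using bounded_eval2[of B] by blast
  have Rf: "norm (poly R (fst z)) \<le> (BA + BB) * norm (eval2 f z)" if z: "z \<in> torus2" for z
  proof -
    have "eval2 [:R:] z = eval2 A z * eval2 f z + eval2 B z * eval2 (reflect2 f) z" unfolding R(2) by simp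
    then have "norm (poly R (fst z)) = norm (eval2 A z * eval2 f z + eval2 B z * eval2 (reflect2 f) z)"
      by (simp add: eval2_def)
    also have "\<dots> \<le> norm (eval2 A z) * norm (eval2 f z) + norm (eval2 B z) * norm (eval2 f z)"
      by (rule order_trans[OF norm_triangle_ineq]) (simp add: norm_mult norm_reflect2_torus[OF z])
    also have "\<dots> \<le> BA * norm (eval2 f z) + BB * norm (eval2 f z)"
      using BA[of z] BB[of z] z torus2_subset by (intro add_mono mult_right_mono) auto
    finally show ?thesis by (simp add: algebra_simps)
  qed
  obtain V N C where V: "open V" "fst x \<in> V" "\<And>z. z \<in> V \<Longrightarrow> norm (z - fst x) ^ N \<le> C * norm (poly R z)"
    using poly_zero_order_bound[OF R(1), of "fst x"] by blast
  define S where "S = map_poly (\<lambda>c. poly c (fst x)) f"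
  have Se: "poly S w = eval2 f (fst x, w)" for w by (simp add: S_def eval2_map_poly)
  have "S \<noteq> 0"
  proof
    assume "S = 0"
    then have "eval2 f (fst x, w) = 0" for w by (metis Se poly_0)
    then have "Pair (fst x) ` sphere 0 1 \<subseteq> zero_set f \<inter> torus2"
      using x by (auto simp: zero_set_def torus2_def mem_Times_iff)
    then have "finite (Pair (fst x) ` sphere (0::complex) 1)" using fin by (rule finite_subset)
    then have "finite (sphere (0::complex) 1)" by (rule finite_imageD) (auto simp: inj_on_def)
    then show False using infinite_sphere by simp
  qed
  then obtain W M D where W: "open W" "snd x \<in> W" "\<And>z. z \<in> W \<Longrightarrow> norm (z - snd x) ^ M \<le> D * norm (poly S z)"
    using poly_zero_order_bound[of S "snd x"] by blast
  obtain K where K: "\<And>z w. z \<in> closed_bidisk \<Longrightarrow> w \<in> closed_bidisk \<Longrightarrow>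
     norm (eval2 f z - eval2 f w) \<le> K * (norm (fst z - fst w) + norm (snd z - snd w))"
    using eval2_lipschitz[of f] by blast
  define X where "X = torus2 \<inter> (V \<times> W)"
  define \<phi> where "\<phi> z = norm (eval2 f z)" for z
  have XT: "z \<in> closed_bidisk" "fst z \<in> V" "snd z \<in> W" "norm (fst z) = 1" "norm (snd z) = 1" "z \<in> torus2" if "z \<in> X" for z
    using that torus2_subset by (auto simp: X_def torus2_def)
  have "dominated X (\<lambda>z. norm (fst z - fst x)) (\<lambda>z. norm (poly R (fst z)))"
    by (rule dominatedI) (rule V(3)[OF XT(2)])
  moreover have "dominated X (\<lambda>z. norm (poly R (fst z))) \<phi>"
    by (rule dominated_self[where K = "BA + BB"]) (use Rf XT in \<open>auto simp: \<phi>_def\<close>)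
  ultimately have d1: "dominated X (\<lambda>z. norm (fst z - fst x)) \<phi>"
    by (rule dominated_trans) auto
  obtain F where F: "\<And>z. z \<in> closed_bidisk \<Longrightarrow> norm (eval2 f z) \<le> F" using bounded_eval2[of f] by blast
  have n2: "norm (fst z - fst x) \<le> 2" "norm (snd z - snd x) \<le> 2" if "z \<in> X" for z
    using XT[OF that] x norm_triangle_ineq4[of "fst z" "fst x"] norm_triangle_ineq4[of "snd z" "snd x"]
    by (auto simp: torus2_def mem_Times_iff)
  have d2: "dominated X (\<lambda>z. \<phi> z + norm (fst z - fst x)) \<phi>"
  proof (rule dominated_add[OF _ d1])
    show "dominated X \<phi> \<phi>" by (rule dominated_self[where K = 1]) simp
    show "\<phi> z \<le> max F 2" if "z \<in> X" for z using F[OF XT(1)[OF that]] by (simp add: \<phi>_def)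
    show "norm (fst z - fst x) \<le> max F 2" if "z \<in> X" for z using n2(1)[OF that] by simp
  qed (auto simp: \<phi>_def)
  have "dominated X (\<lambda>z. norm (snd z - snd x)) (\<lambda>z. norm (poly S (snd z)))"
    by (rule dominatedI) (rule W(3)[OF XT(3)])
  moreover have "dominated X (\<lambda>z. norm (poly S (snd z))) (\<lambda>z. \<phi> z + norm (fst z - fst x))"
  proof (rule dominated_self[where K = "max 1 K"])
    fix z assume z: "z \<in> X"
    have "(fst x, snd z) \<in> closed_bidisk"
      using x XT[OF z] by (auto simp: closed_bidisk_def torus2_def)
    from K[OF this XT(1)[OF z]] have "norm (eval2 f (fst x, snd z) - eval2 f z) \<le> K * norm (fst z - fst x)"
      by (simp add: norm_minus_commute)
    moreover have "norm (eval2 f (fst x, snd z)) \<le> norm (eval2 f z) + norm (eval2 f (fst x, snd z) - eval2 f z)"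
      by (rule norm_triangle_sub)
    ultimately have "norm (poly S (snd z)) \<le> 1 * \<phi> z + K * norm (fst z - fst x)" by (simp add: Se \<phi>_def)
    also have "\<dots> \<le> max 1 K * \<phi> z + max 1 K * norm (fst z - fst x)"
      by (intro add_mono mult_right_mono) (auto simp: \<phi>_def)
    finally show "norm (poly S (snd z)) \<le> max 1 K * (\<phi> z + norm (fst z - fst x))" by (simp add: distrib_left)
  qed
  ultimately have "dominated X (\<lambda>z. norm (snd z - snd x)) (\<lambda>z. \<phi> z + norm (fst z - fst x))"
    by (rule dominated_trans) auto
  from dominated_trans[OF this d2] have d3: "dominated X (\<lambda>z. norm (snd z - snd x)) \<phi>" by (auto simp: \<phi>_def)
  have "dominated X (\<lambda>z. norm (fst z - fst x) + norm (snd z - snd x)) \<phi>"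
    by (rule dominated_add[OF d1 d3, where B = 2]) (use n2 in \<open>auto simp: \<phi>_def\<close>)
  moreover have "open (V \<times> W)" "x \<in> V \<times> W" using V W by (auto simp: open_Times mem_Times_iff)
  ultimately show ?thesis unfolding X_def \<phi>_def by blast
qed

text \<open>
  Passing from the torus to the torus of radius \<open>\<rho>\<close> changes g by
  \<open>O(1 - \<rho>)\<close>, while \<open>|f(\<rho> z)|\<close> dominates both \<open>|f(z)|\<close> and a power of
  \<open>1 - \<rho>\<close>, by the radial bounds.
\<close>
lemma radial_domination:
  assumes nz: "\<And>z. z \<in> bidisk \<Longrightarrow> eval2 f z \<noteq> 0" and fin: "finite (zero_set f \<inter> torus2)"
    and g: "\<And>z. z \<in> zero_set f \<inter> torus2 \<Longrightarrow> eval2 g z = 0"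
  shows "\<exists>N C. \<forall>\<rho> z. 0 < \<rho> \<longrightarrow> \<rho> < 1 \<longrightarrow> z \<in> torus2 \<longrightarrow>
    norm (eval2 g (of_real \<rho> * fst z, of_real \<rho> * snd z)) ^ N \<le> C * norm (eval2 f (of_real \<rho> * fst z, of_real \<rho> * snd z))"
proof -
  obtain G where G: "G > 0" "\<And>z. z \<in> closed_bidisk \<Longrightarrow> norm (eval2 g z) \<le> G" using bounded_eval2[of g] by blast
  obtain K where K: "K \<ge> 0" "\<And>z w. z \<in> closed_bidisk \<Longrightarrow> w \<in> closed_bidisk \<Longrightarrow>
     norm (eval2 g z - eval2 g w) \<le> K * (norm (fst z - fst w) + norm (snd z - snd w))"
    using eval2_lipschitz[of g] by blast
  have torus: "dominated torus2 (\<lambda>z. norm (eval2 g z)) (\<lambda>z. norm (eval2 f z))"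
  proof (rule dominated_compact)
    show "compact torus2" unfolding torus2_def by (intro compact_Times compact_sphere)
    show "norm (eval2 g z) \<le> G" if "z \<in> torus2" for z using that torus2_subset by (intro G(2)) auto
    fix x assume x: "x \<in> torus2"
    show "\<exists>U. open U \<and> x \<in> U \<and> dominated (torus2 \<inter> U) (\<lambda>z. norm (eval2 g z)) (\<lambda>z. norm (eval2 f z))"
    proof (cases "eval2 f x = 0")
      case True
      then have gx: "eval2 g x = 0" using g x by (auto simp: zero_set_def)
      obtain U where U: "open U" "x \<in> U"
        "dominated (torus2 \<inter> U) (\<lambda>z. norm (fst z - fst x) + norm (snd z - snd x)) (\<lambda>z. norm (eval2 f z))"
        using distance_to_zero_dominated[OF nz fin x] by blast
      have "dominated (torus2 \<inter> U) (\<lambda>z. norm (eval2 g z)) (\<lambda>z. norm (eval2 f z))"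
        by (rule dominated_mono[OF U(3) _ _ K(1)]) (use K(2)[of _ x] gx x torus2_subset in force)+
      then show ?thesis using U by blast
    next
      case False
      let ?U = "{z. norm (eval2 f x) / 2 < norm (eval2 f z)}"
      have "open ?U" by (intro open_Collect_less continuous_intros)
      moreover have "x \<in> ?U" using False by simp
      moreover have "dominated (torus2 \<inter> ?U) (\<lambda>z. norm (eval2 g z)) (\<lambda>z. norm (eval2 f z))"
        by (rule dominatedI[where N = 0 and C = "2 / norm (eval2 f x)"]) (use False in \<open>auto simp: field_simps\<close>)
      ultimately show ?thesis by blast
    qed
  qed auto
  define X where "X = {0<..<1::real} \<times> torus2"
  define r where "r p = (of_real (fst p) * fst (snd p), of_real (fst p) * snd (snd p))" for p :: "real \<times> complex \<times> complex"
  define \<phi> where "\<phi> p = norm (eval2 f (r p))" for p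
  have X: "0 < fst p" "fst p < 1" "snd p \<in> torus2" "snd p \<in> closed_bidisk" "norm (fst (snd p)) = 1" "norm (snd (snd p)) = 1" if "p \<in> X" for p
    using that torus2_subset by (auto simp: X_def torus2_def)
  have rX: "r p \<in> closed_bidisk" if "p \<in> X" for p
    using X[OF that] by (auto simp: r_def closed_bidisk_def norm_mult)
  have "dominated X (\<lambda>p. norm (eval2 g (snd p))) (\<lambda>p. norm (eval2 f (snd p)))"
    using torus X(3) unfolding dominated_def by blast
  moreover have "dominated X (\<lambda>p. norm (eval2 f (snd p))) \<phi>"
  proof (rule dominated_self[where K = "2 ^ degree_bound f"])
    fix p assume p: "p \<in> X"
    show "norm (eval2 f (snd p)) \<le> 2 ^ degree_bound f * \<phi> p"
      using radial_bounds(1)[OF nz X(4)[OF p], of "fst p"] X[OF p] by (simp add: \<phi>_def r_def less_imp_le)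
  qed
  ultimately have d1: "dominated X (\<lambda>p. norm (eval2 g (snd p))) \<phi>" by (rule dominated_trans) auto
  have f0: "eval2 f (0, 0) \<noteq> 0" using nz[of "(0, 0)"] by (simp add: bidisk_def)
  have d2: "dominated X (\<lambda>p. 1 - fst p) \<phi>"
  proof (rule dominatedI)
    fix p assume p: "p \<in> X"
    show "(1 - fst p) ^ degree_bound f \<le> 1 / norm (eval2 f (0, 0)) * \<phi> p"
      using radial_bounds(2)[OF nz X(4)[OF p], of "fst p"] X[OF p] f0 by (simp add: \<phi>_def r_def field_simps)
  qed
  have "dominated X (\<lambda>p. norm (eval2 g (snd p)) + (1 - fst p)) \<phi>"
  proof (rule dominated_add[OF d1 d2])
    show "norm (eval2 g (snd p)) \<le> max G 1" if "p \<in> X" for p using G(2) X(4)[OF that] by (simp add: le_max_iff_disj)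
    show "1 - fst p \<le> max G 1" if "p \<in> X" for p using X[OF that] by simp
  qed (use X in \<open>auto simp: \<phi>_def less_imp_le\<close>)
  then have "dominated X (\<lambda>p. norm (eval2 g (r p))) \<phi>"
  proof (rule dominated_mono[where K = "max 1 (2 * K)"])
    fix p assume p: "p \<in> X"
    have e: "norm (of_real (fst p) * v - v) = 1 - fst p" if "norm v = 1" for v :: complex
    proof -
      have "norm (of_real (fst p) * v - v) = norm ((of_real (fst p - 1)) * v)" by (simp add: algebra_simps)
      then show ?thesis using X[OF p] that by (simp only: norm_mult norm_of_real) simp
    qed
    have "norm (eval2 g (r p) - eval2 g (snd p)) \<le> K * (2 * (1 - fst p))"
      using K(2)[OF rX[OF p] X(4)[OF p]] X[OF p] by (simp add: r_def e)
    then have "norm (eval2 g (r p)) \<le> 1 * norm (eval2 g (snd p)) + 2 * K * (1 - fst p)"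
      using norm_triangle_sub[of "eval2 g (r p)" "eval2 g (snd p)"] by (simp add: algebra_simps)
    also have "\<dots> \<le> max 1 (2 * K) * norm (eval2 g (snd p)) + max 1 (2 * K) * (1 - fst p)"
      using X[OF p] by (intro add_mono mult_right_mono) auto
    finally show "norm (eval2 g (r p)) \<le> max 1 (2 * K) * (norm (eval2 g (snd p)) + (1 - fst p))"
      by (simp add: distrib_left)
  qed auto
  then obtain N C where "\<And>p. p \<in> X \<Longrightarrow> norm (eval2 g (r p)) ^ N \<le> C * \<phi> p" by (auto simp: dominated_def)
  then show ?thesis
    by (intro exI[of _ N] exI[of _ C]) (auto simp: X_def \<phi>_def r_def)
qed

section \<open>The model polynomial\<close>

definition linear_form :: "complex \<Rightarrow> complex \<Rightarrow> complex poly poly" where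
  "linear_form x y = [:[:0, x:], [:y:]:]"

lemma eval2_linear_form: "eval2 (linear_form x y) z = x * fst z + y * snd z"
  by (simp add: linear_form_def eval2_def mult_ac)

lemma pcoef_linear_form_power:
  "pcoef (linear_form x y ^ k) = (\<lambda>L. if fst L + snd L = k then of_nat (k choose fst L) * x ^ fst L * y ^ snd L else 0)"
proof (rule has_expansion_unique[OF has_expansion_eval2])
  show "has_expansion (\<lambda>L. if fst L + snd L = k then of_nat (k choose fst L) * x ^ fst L * y ^ snd L else 0) (eval2 (linear_form x y ^ k))"
    unfolding has_expansion_def
  proof
    fix z :: "complex \<times> complex"
    let ?g = "\<lambda>L. (if fst L + snd L = k then of_nat (k choose fst L) * x ^ fst L * y ^ snd L else 0) * (fst z ^ fst L * snd z ^ snd L)"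
    have "sum ?g ((\<lambda>i. (i, k - i)) ` {..k}) = (\<Sum>i\<le>k. of_nat (k choose i) * (x * fst z) ^ i * (y * snd z) ^ (k - i))"
      by (subst sum.reindex) (auto simp: inj_on_def power_mult_distrib mult_ac intro!: sum.cong)
    also have "\<dots> = eval2 (linear_form x y ^ k) z"
      by (simp add: eval2_linear_form binomial_ring)
    finally have *: "sum ?g ((\<lambda>i. (i, k - i)) ` {..k}) = eval2 (linear_form x y ^ k) z" .
    show "(?g has_sum eval2 (linear_form x y ^ k) z) UNIV"
    proof (rule has_sum_finite_neutralI)
      show "eval2 (linear_form x y ^ k) z = sum ?g ((\<lambda>i. (i, k - i)) ` {..k})" by (simp add: *)
      show "?g L = 0" if "L \<in> UNIV - (\<lambda>i. (i, k - i)) ` {..k}" for L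
        using that by (cases L) (auto simp: image_iff)
    qed auto
  qed
qed

text \<open>
  The quotient of consecutive left-hand sides is
  \<open>(2 k + 1) (2 k + 3) / (2 k + 2)^2 \<le> 1\<close>.
\<close>
lemma central_binomial_le: "(real ((2 * k) choose k) / 4 ^ k)\<^sup>2 * (2 * real k + 1) \<le> 1"
proof (induction k)
  case (Suc k)
  let ?b = "real ((2 * k) choose k) / 4 ^ k"
  have "Suc k * (Suc (Suc (2 * k)) choose Suc k) = Suc (Suc (2 * k)) * (Suc (2 * k) choose k)"
    by (rule Suc_times_binomial)
  moreover have "Suc (2 * k) choose k = Suc (2 * k) choose Suc k"
    using binomial_symmetric[of k "Suc (2 * k)"] by simp
  moreover have "Suc k * (Suc (2 * k) choose Suc k) = Suc (2 * k) * ((2 * k) choose k)"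
    by (rule Suc_times_binomial)
  ultimately have "Suc k * (Suc k * (Suc (Suc (2 * k)) choose Suc k)) = Suc (Suc (2 * k)) * (Suc (2 * k) * ((2 * k) choose k))"
    by (metis mult.left_commute)
  then have F: "real (Suc k * (Suc k * (Suc (Suc (2 * k)) choose Suc k))) = real (Suc (Suc (2 * k)) * (Suc (2 * k) * ((2 * k) choose k)))"
    by (simp only:)
  define b where "b = real ((2 * k) choose k)"
  define B where "B = real (Suc (Suc (2 * k)) choose Suc k)"
  have "(real k + 1) * ((real k + 1) * B) = (real k + 1) * (2 * (2 * real k + 1) * real ((2 * k) choose k))"
    using F unfolding of_nat_mult B_def[symmetric] by (simp add: algebra_simps)
  then have "(real k + 1) * B = 2 * (2 * real k + 1) * real ((2 * k) choose k)"
    by (subst (asm) mult_left_cancel) auto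
  then have "B / 4 ^ Suc k = (2 * real k + 1) / (2 * real k + 2) * (b / 4 ^ k)"
  proof -
    assume "(real k + 1) * B = 2 * (2 * real k + 1) * real ((2 * k) choose k)"
    then have B: "B = 2 * (2 * real k + 1) * b / (real k + 1)"
      unfolding b_def[symmetric] by (simp add: field_simps)
    have "2 * c * b / x / (4 * q) = c / (2 * x) * (b / q)" for c x q :: real by (simp add: mult_ac)
    from this[of "2 * real k + 1" "real k + 1" "4 ^ k"] show ?thesis
      unfolding B power_Suc by (simp only: distrib_left mult_1_right)
  qed
  then have e: "real ((2 * Suc k) choose Suc k) / 4 ^ Suc k = (2 * real k + 1) / (2 * real k + 2) * ?b"
    by (simp only: B_def b_def mult_Suc_right add_2_eq_Suc)
  have "(real ((2 * Suc k) choose Suc k) / 4 ^ Suc k)\<^sup>2 * (2 * real (Suc k) + 1) =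
      (?b\<^sup>2 * (2 * real k + 1)) * ((2 * real k + 1) * (2 * real k + 3) / (2 * real k + 2)\<^sup>2)"
  proof -
    have *: "(s / t * b)\<^sup>2 * w = (b\<^sup>2 * s) * (s * w / t\<^sup>2)" for s t b w :: real
      by (simp add: power2_eq_square)
    have "2 * real (Suc k) + 1 = 2 * real k + 3" by simp
    then show ?thesis unfolding e by (simp only: *)
  qed
  also have "\<dots> \<le> 1 * 1"
  proof (intro mult_mono Suc.IH)
    show "(2 * real k + 1) * (2 * real k + 3) / (2 * real k + 2)\<^sup>2 \<le> 1"
      by (simp add: divide_le_eq_1 power2_eq_square algebra_simps add_pos_nonneg)
  qed auto
  finally show ?case by simp
qed simp

lemma central_binomial_weight: "real ((2 * k) choose k) / 4 ^ k * (real k + 2) powr (3 / 2) \<le> 2 * (real k + 2)"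
proof -
  let ?b = "real ((2 * k) choose k) / 4 ^ k"
  have "?b\<^sup>2 * (real k + 2) \<le> ?b\<^sup>2 * (2 * (2 * real k + 1))" by (intro mult_left_mono) auto
  also have "\<dots> = 2 * (?b\<^sup>2 * (2 * real k + 1))" by simp
  also have "\<dots> \<le> 2 * 1" by (intro mult_left_mono central_binomial_le) simp
  finally have le2: "?b\<^sup>2 * (real k + 2) \<le> 2" by simp
  have sq: "(y * sqrt (real k + 2))\<^sup>2 = y\<^sup>2 * (real k + 2)" for y :: real
    by (simp add: power_mult_distrib)
  have "(?b * sqrt (real k + 2))\<^sup>2 \<le> 2\<^sup>2"
    unfolding sq by (rule order_trans[OF le2]) simp
  then have 1: "?b * sqrt (real k + 2) \<le> 2" by (rule power2_le_imp_le) simp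
  have "(real k + 2) powr (3 / 2) = (real k + 2) powr (1 / 2 + 1)" by simp
  also have "\<dots> = sqrt (real k + 2) * (real k + 2)"
    by (subst powr_add) (simp add: powr_half_sqrt)
  finally have "?b * (real k + 2) powr (3 / 2) = (?b * sqrt (real k + 2)) * (real k + 2)" by simp
  also have "\<dots> \<le> 2 * (real k + 2)" by (intro mult_right_mono 1) auto
  finally show ?thesis .
qed

text \<open>
  Powers of a linear form with different exponents have disjoint supports. The squared norm of
  the k-th power is the sum of \<open>(k choose i)^2 / 4 ^ k\<close>, a central binomial coefficient, times the
  weight.
\<close>
lemma sum_linear_form_power_sqnorm:
  assumes "norm x = 1 / 2" "norm y = 1 / 2"
  shows "sqnorm (3 / 2) (\<lambda>L. \<Sum>k<n. of_real (c k) * pcoef (linear_form x y ^ k) L) \<le> (\<Sum>k<n. (c k)\<^sup>2 * (2 * (real k + 2)))"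
proof -
  define a where "a L = (\<Sum>k<n. of_real (c k) * pcoef (linear_form x y ^ k) L)" for L
  have aL: "a L = (if fst L + snd L < n then of_real (c (fst L + snd L)) * (of_nat ((fst L + snd L) choose fst L) * x ^ fst L * y ^ snd L) else 0)" for L
  proof -
    have "a L = (\<Sum>k<n. if fst L + snd L = k then of_real (c k) * (of_nat (k choose fst L) * x ^ fst L * y ^ snd L) else 0)"
      unfolding a_def pcoef_linear_form_power by (intro sum.cong) auto
    then show ?thesis by simp
  qed
  have "sqnorm (3 / 2) a \<le> (\<Sum>k<n. (c k)\<^sup>2 * (2 * (real k + 2)))"
  proof (rule in_l2_bounded_sums(2))
    fix S :: "(nat \<times> nat) set" assume S: "finite S"
    let ?h = "\<lambda>L. (norm (a L))\<^sup>2 * wt (3 / 2) L"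
    let ?T = "{L :: nat \<times> nat. fst L + snd L < n}"
    have "finite ?T" by (rule finite_subset[of _ "{..<n} \<times> {..<n}"]) auto
    have "sum ?h S = sum ?h (S \<inter> ?T)"
      by (rule sum.mono_neutral_right) (use S aL in auto)
    also have "\<dots> \<le> sum ?h ?T"
      by (rule sum_mono2) (use \<open>finite ?T\<close> in auto)
    also have "sum ?h ?T = (\<Sum>(i, j)\<in>{(i, j). i + j < n}. ?h (i, j))"
      by (intro sum.cong) auto
    also have "\<dots> = (\<Sum>k<n. \<Sum>i\<le>k. ?h (i, k - i))" by (rule sum.triangle_reindex)
    also have "\<dots> \<le> (\<Sum>k<n. (c k)\<^sup>2 * (2 * (real k + 2)))"
    proof (rule sum_mono)
      fix k assume k: "k \<in> {..<n}"
      have "?h (i, k - i) = (c k)\<^sup>2 * ((real (k choose i))\<^sup>2 * ((1 / 4 ^ k) * (real k + 2) powr (3 / 2)))" if "i \<le> k" for i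
      proof -
        have "norm x ^ i * norm y ^ (k - i) = (1 / 2) ^ k"
          unfolding assms using that by (simp flip: power_add)
        then have "norm (a (i, k - i)) = \<bar>c k\<bar> * (real (k choose i) * (1 / 2) ^ k)"
          using k that by (simp add: aL norm_mult norm_power mult.assoc)
        then have "(norm (a (i, k - i)))\<^sup>2 = (c k)\<^sup>2 * ((real (k choose i))\<^sup>2 * ((1 / 2) ^ k)\<^sup>2)"
          by (simp add: power_mult_distrib)
        also have "((1 / 2 :: real) ^ k)\<^sup>2 = 1 / 4 ^ k"
          by (simp add: power_divide power2_eq_square flip: power_mult_distrib)
        finally show ?thesis using that by (simp add: wt_def)
      qed
      then have "(\<Sum>i\<le>k. ?h (i, k - i)) = (\<Sum>i\<le>k. (c k)\<^sup>2 * ((real (k choose i))\<^sup>2 * ((1 / 4 ^ k) * (real k + 2) powr (3 / 2))))"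
        by (intro sum.cong) auto
      also have "\<dots> = (c k)\<^sup>2 * ((\<Sum>i\<le>k. (real (k choose i))\<^sup>2) * ((1 / 4 ^ k) * (real k + 2) powr (3 / 2)))"
        by (simp only: sum_distrib_left sum_distrib_right)
      also have "(\<Sum>i\<le>k. (real (k choose i))\<^sup>2) = real ((2 * k) choose k)"
        by (simp flip: choose_square_sum)
      also have "(c k)\<^sup>2 * (real ((2 * k) choose k) * ((1 / 4 ^ k) * (real k + 2) powr (3 / 2))) \<le> (c k)\<^sup>2 * (2 * (real k + 2))"
        using central_binomial_weight[of k] by (intro mult_left_mono) auto
      finally show "(\<Sum>i\<le>k. ?h (i, k - i)) \<le> (c k)\<^sup>2 * (2 * (real k + 2))" .
    qed
    finally show "sum ?h S \<le> (\<Sum>k<n. (c k)\<^sup>2 * (2 * (real k + 2)))" .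
  qed
  then show ?thesis by (simp add: a_def[abs_def])
qed

text \<open>
  The coefficients \<open>c k\<close> are proportional to \<open>1 / (k + 2)\<close> and have sum 1. The average
  of the powers of X then has squared norm at most \<open>2 / H n\<close>, where the harmonic sums \<open>H n\<close>
  are unbounded.
\<close>
lemma in_closure_linear_factor:
  assumes "norm x = 1" "norm y = 1"
  shows "in_closure (3 / 2) [:[:2, - x:], [:- y:]:] (pcoef 1)"
proof -
  let ?f = "[:[:2, - x:], [:- y:]:]"
  define X where "X = linear_form (x / 2) (y / 2)"
  have fX: "?f = [:[:2:]:] * (1 - X)"
    by (simp add: X_def linear_form_def one_pCons)
  show ?thesis
    unfolding in_closure_def
  proof (intro conjI allI impI)
    fix \<epsilon> :: real assume e: "\<epsilon> > 0"
    define H where "H n = (\<Sum>k<n. 1 / (real k + 2))" for n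
    have "\<exists>n. H n > 2 / \<epsilon>"
    proof (rule ccontr)
      assume "\<not> ?thesis"
      then have "H n \<le> 2 / \<epsilon>" for n by (simp add: not_less)
      then have "summable (\<lambda>k. 1 / (real k + 2))"
        unfolding H_def by (intro summableI_nonneg_bounded) auto
      then have "summable (\<lambda>k. 1 / real (k + 2))" by (simp add: add.commute)
      then have "summable (\<lambda>k. 1 / real k)" using summable_iff_shift[of "\<lambda>k. 1 / real k" 2] by simp
      then show False using not_summable_harmonic[where 'a = real] by (simp add: inverse_eq_divide)
    qed
    then obtain n where n: "H n > 2 / \<epsilon>" by blast
    then have H0: "H n > 0" using e by (meson divide_pos_pos less_trans zero_less_numeral)
    define c where "c k = 1 / ((real k + 2) * H n)" for k
    have c1: "(\<Sum>k<n. c k) = 1"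
    proof -
      have "(\<Sum>k<n. c k) = H n / H n" unfolding H_def[of n] sum_divide_distrib
        by (simp add: c_def H_def)
      then show ?thesis using H0 by simp
    qed
    have c2: "(\<Sum>k<n. (c k)\<^sup>2 * (2 * (real k + 2))) = 2 / H n"
    proof -
      have "(c k)\<^sup>2 * (2 * (real k + 2)) = 2 / (H n)\<^sup>2 * (1 / (real k + 2))" for k
      proof -
        have G: "(1 / (x * h))\<^sup>2 * (2 * x) = 2 / h\<^sup>2 * (1 / x)" if "x > 0" for x h :: real
          using that by (simp add: power2_eq_square)
        show ?thesis unfolding c_def by (rule G) simp
      qed
      then have "(\<Sum>k<n. (c k)\<^sup>2 * (2 * (real k + 2))) = 2 / (H n)\<^sup>2 * H n"
        by (simp only: H_def[of n] sum_distrib_left)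
      then show ?thesis by (simp add: power2_eq_square)
    qed
    define K where "K t = [:[:complex_of_real t:]:]" for t
    have Kc: "pcoef (K t * p) L = of_real t * pcoef p L" for t p L
      by (simp add: K_def pcoef_def)
    define Q where "Q = (\<Sum>k<n. K (c k) * (\<Sum>i<k. X ^ i))"
    have "Q * (1 - X) = (\<Sum>k<n. K (c k) * (1 - X ^ k))"
      unfolding Q_def sum_distrib_right by (intro sum.cong refl) (simp add: one_diff_power_eq mult_ac)
    also have "\<dots> = (\<Sum>k<n. K (c k)) - (\<Sum>k<n. K (c k) * X ^ k)"
      by (simp add: right_diff_distrib sum_subtractf)
    also have "(\<Sum>k<n. K (c k)) = K (\<Sum>k<n. c k)"
      by (induction n) (auto simp: K_def)
    also have "\<dots> = 1" by (simp add: c1 K_def one_pCons)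
    finally have Q: "Q * (1 - X) = 1 - (\<Sum>k<n. K (c k) * X ^ k)" .
    have "K (1 / 2) * Q * ?f = (K (1 / 2) * [:[:2:]:]) * (Q * (1 - X))"
      by (simp only: fX mult_ac)
    also have "K (1 / 2) * [:[:2:]:] = 1" by (simp add: K_def one_pCons)
    finally have "pcoef 1 L - pcoef (K (1 / 2) * Q * ?f) L = (\<Sum>k<n. of_real (c k) * pcoef (X ^ k) L)" for L
      unfolding Q Kc[symmetric] by (simp add: pcoef_def coeff_sum)
    then have "sqnorm (3 / 2) (\<lambda>L. pcoef 1 L - pcoef (K (1 / 2) * Q * ?f) L) \<le> (\<Sum>k<n. (c k)\<^sup>2 * (2 * (real k + 2)))"
      unfolding X_def by (simp only: sum_linear_form_power_sqnorm[of "x / 2" "y / 2"] assms norm_divide norm_numeral)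
    also have "\<dots> = 2 / H n" by (rule c2)
    also have "\<dots> < \<epsilon>" using n H0 e by (simp add: field_simps)
    finally show "\<exists>p. sqnorm (3 / 2) (\<lambda>L. pcoef 1 L - pcoef (p * ?f) L) < \<epsilon>" by blast
  qed simp
qed

section \<open>Finitely many zeros on the torus\<close>

lemma poly_fiber: "poly (poly p [:w:]) z = eval2 p (z, w)"
  by (simp add: eval2_def)

lemma pderiv_fiber: "pderiv (poly p [:w:]) = poly (map_poly pderiv p) [:w:]"
  by (induction p) (auto simp: map_poly_pCons pderiv_add pderiv_mult pderiv_pCons pderiv_smult)

text \<open>
  In the derivative of \<open>g ^ (2 N + 1) / f\<close> the denominator is at worst \<open>f^2\<close>, and
  \<open>|g| ^ (2 N)\<close> is bounded by a multiple of \<open>|f|^2\<close>.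
\<close>
lemma quotient_derivative_bessel:
  assumes nz: "\<And>z. z \<in> bidisk \<Longrightarrow> eval2 f z \<noteq> 0"
    and dom: "\<And>\<rho> z. \<lbrakk>0 < \<rho>; \<rho> < 1; z \<in> torus2\<rbrakk> \<Longrightarrow>
      norm (eval2 g (of_real \<rho> * fst z, of_real \<rho> * snd z)) ^ N \<le> C * norm (eval2 f (of_real \<rho> * fst z, of_real \<rho> * snd z))"
    and a: "has_expansion a (\<lambda>z. eval2 g z ^ (2 * N + 1) / eval2 f z)"
  shows "\<exists>B. \<forall>K L. (\<Sum>k<K. (real k)\<^sup>2 * (\<Sum>l<L. (norm (a (k, l)))\<^sup>2)) \<le> B"
proof -
  define dg where "dg = map_poly pderiv g"
  define df where "df = map_poly pderiv f"
  obtain G where G: "G > 0" "\<And>z. z \<in> closed_bidisk \<Longrightarrow> norm (eval2 g z) \<le> G" using bounded_eval2[of g] by blast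
  obtain G' where G': "G' > 0" "\<And>z. z \<in> closed_bidisk \<Longrightarrow> norm (eval2 dg z) \<le> G'" using bounded_eval2[of dg] by blast
  obtain F' where F': "F' > 0" "\<And>z. z \<in> closed_bidisk \<Longrightarrow> norm (eval2 df z) \<le> F'" using bounded_eval2[of df] by blast
  define M where "M = real (2 * N + 1) * G ^ N * G' * \<bar>C\<bar> + G * F' * \<bar>C\<bar>\<^sup>2"
  have "(\<Sum>k<K. (real k)\<^sup>2 * (\<Sum>l<L. (norm (a (k, l)))\<^sup>2)) \<le> M\<^sup>2" for K L
  proof (rule fiber_average[OF a])
    fix \<rho> :: real and w :: complex assume \<rho>: "0 < \<rho>" "\<rho> < 1" and w\<rho>: "norm w = \<rho>"
    have w: "norm w < 1" using \<rho> w\<rho> by simp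
    define D where "D z = (of_nat (2 * N + 1) * eval2 g (z, w) ^ (2 * N) * eval2 dg (z, w) * eval2 f (z, w) -
        eval2 g (z, w) ^ (2 * N + 1) * eval2 df (z, w)) / (eval2 f (z, w) * eval2 f (z, w))" for z
    show "(\<Sum>k<K. (real k)\<^sup>2 * \<rho> ^ (2 * k) * (norm (\<Sum>l. a (k, l) * w ^ l))\<^sup>2) \<le> M\<^sup>2"
    proof (rule derivative_bessel[OF expansion_fiber_sums[OF a _ w] _ \<rho>])
      fix z :: complex assume z: "norm z < 1"
      have f0: "eval2 f (z, w) \<noteq> 0" using nz[of "(z, w)"] z w by (simp add: bidisk_def)
      have dG: "((\<lambda>z. eval2 g (z, w)) has_field_derivative eval2 dg (z, w)) (at z)"
        unfolding dg_def poly_fiber[symmetric] pderiv_fiber[symmetric] by (rule poly_DERIV)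
      have dF: "((\<lambda>z. eval2 f (z, w)) has_field_derivative eval2 df (z, w)) (at z)"
        unfolding df_def poly_fiber[symmetric] pderiv_fiber[symmetric] by (rule poly_DERIV)
      show "((\<lambda>z. eval2 g (z, w) ^ (2 * N + 1) / eval2 f (z, w)) has_field_derivative D z) (at z)"
        using DERIV_divide[OF DERIV_power[OF dG, of "2 * N + 1"] dF f0]
        by (simp add: D_def mult_ac)
    next
      fix z :: complex assume z: "norm z = \<rho>"
      define f1 g1 where "f1 = norm (eval2 f (z, w))" and "g1 = norm (eval2 g (z, w))"
      have cb: "(z, w) \<in> closed_bidisk" using z w\<rho> \<rho> by (simp add: closed_bidisk_def)
      have "eval2 f (z, w) \<noteq> 0" using nz[of "(z, w)"] z w \<rho> by (simp add: bidisk_def)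
      then have f1: "f1 > 0" by (simp add: f1_def)
      have "(z / of_real \<rho>, w / of_real \<rho>) \<in> torus2" using z w\<rho> \<rho> by (simp add: torus2_def norm_divide)
      from dom[OF \<rho> this] have gN: "g1 ^ N \<le> \<bar>C\<bar> * f1"
        using \<rho> mult_right_mono[OF abs_ge_self[of C] less_imp_le[OF f1]] by (simp add: f1_def g1_def)
      have g1: "0 \<le> g1" "g1 \<le> G" using G(2)[OF cb] by (auto simp: g1_def)
      have 1: "real (2 * N + 1) * g1 ^ (2 * N) * norm (eval2 dg (z, w)) / f1 \<le> real (2 * N + 1) * G ^ N * G' * \<bar>C\<bar>"
      proof -
        have "g1 ^ (2 * N) \<le> G ^ N * (\<bar>C\<bar> * f1)"
          unfolding mult_2 power_add using g1 gN G(1) by (intro mult_mono power_mono) auto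
        then have "g1 ^ (2 * N) * norm (eval2 dg (z, w)) \<le> (G ^ N * (\<bar>C\<bar> * f1)) * G'"
          using G'(2)[OF cb] G(1) f1 by (intro mult_mono) auto
        then have "real (2 * N + 1) * (g1 ^ (2 * N) * norm (eval2 dg (z, w))) \<le> real (2 * N + 1) * ((G ^ N * (\<bar>C\<bar> * f1)) * G')"
          by (intro mult_left_mono) auto
        then show ?thesis using f1 by (simp only: pos_divide_le_eq) (simp only: mult_ac)
      qed
      have 2: "g1 ^ (2 * N + 1) * norm (eval2 df (z, w)) / (f1 * f1) \<le> G * F' * \<bar>C\<bar>\<^sup>2"
      proof -
        have "g1 ^ (2 * N + 1) \<le> (\<bar>C\<bar> * f1) * (\<bar>C\<bar> * f1) * G"
          unfolding mult_2 power_add power_one_right using g1 gN f1 by (intro mult_mono) auto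
        then have "g1 ^ (2 * N + 1) * norm (eval2 df (z, w)) \<le> ((\<bar>C\<bar> * f1) * (\<bar>C\<bar> * f1) * G) * F'"
          using F'(2)[OF cb] G(1) f1 by (intro mult_mono) auto
        also have "\<dots> = (G * F' * \<bar>C\<bar>\<^sup>2) * (f1 * f1)" by (simp only: power2_eq_square mult_ac)
        finally show ?thesis using f1 by (subst pos_divide_le_eq) auto
      qed
      have "D z = of_nat (2 * N + 1) * eval2 g (z, w) ^ (2 * N) * eval2 dg (z, w) / eval2 f (z, w) -
          eval2 g (z, w) ^ (2 * N + 1) * eval2 df (z, w) / (eval2 f (z, w) * eval2 f (z, w))"
        using \<open>eval2 f (z, w) \<noteq> 0\<close> by (simp add: D_def diff_divide_distrib)
      also have "norm \<dots> \<le> real (2 * N + 1) * g1 ^ (2 * N) * norm (eval2 dg (z, w)) / f1 + g1 ^ (2 * N + 1) * norm (eval2 df (z, w)) / (f1 * f1)"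
        by (rule order_trans[OF norm_triangle_ineq4])
           (simp only: norm_mult norm_divide norm_power norm_of_nat f1_def g1_def order_refl)
      also have "\<dots> \<le> M" unfolding M_def using 1 2 by (rule add_mono)
      finally have "norm (D z) \<le> M" .
      moreover have "norm (z * D z) \<le> 1 * norm (D z)"
        unfolding norm_mult using z \<rho> by (intro mult_right_mono) auto
      ultimately show "norm (z * D z) \<le> M" by simp
    qed
  qed simp
  then show ?thesis by blast
qed

lemma in_l2_quotient:
  assumes nz: "\<And>z. z \<in> bidisk \<Longrightarrow> eval2 f z \<noteq> 0"
    and dom: "\<And>\<rho> z. \<lbrakk>0 < \<rho>; \<rho> < 1; z \<in> torus2\<rbrakk> \<Longrightarrow>
      norm (eval2 g (of_real \<rho> * fst z, of_real \<rho> * snd z)) ^ N \<le> C * norm (eval2 f (of_real \<rho> * fst z, of_real \<rho> * snd z))"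
    and a: "has_expansion a (\<lambda>z. eval2 g z ^ (2 * N + 1) / eval2 f z)"
  shows "in_l2 2 a"
proof -
  obtain B where B: "\<And>K L. (\<Sum>k<K. (real k)\<^sup>2 * (\<Sum>l<L. (norm (a (k, l)))\<^sup>2)) \<le> B"
    using quotient_derivative_bessel[OF nz dom a] by blast
  have "\<exists>B. \<forall>K L. (\<Sum>k<K. (real k)\<^sup>2 * (\<Sum>l<L. (norm ((a \<circ> prod.swap) (k, l)))\<^sup>2)) \<le> B"
  proof (rule quotient_derivative_bessel[where f = "swap_poly f" and g = "swap_poly g" and N = N and C = C])
    show "eval2 (swap_poly f) z \<noteq> 0" if "z \<in> bidisk" for z
      unfolding eval2_swap_poly using that by (intro nz) (auto simp: bidisk_def)
    show "norm (eval2 (swap_poly g) (of_real \<rho> * fst z, of_real \<rho> * snd z)) ^ N \<le> C * norm (eval2 (swap_poly f) (of_real \<rho> * fst z, of_real \<rho> * snd z))"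
      if "0 < \<rho>" "\<rho> < 1" "z \<in> torus2" for \<rho> z
      using dom[OF that(1,2), of "prod.swap z"] that(3) by (auto simp: eval2_swap_poly torus2_def)
    show "has_expansion (a \<circ> prod.swap) (\<lambda>z. eval2 (swap_poly g) z ^ (2 * N + 1) / eval2 (swap_poly f) z)"
      using has_expansion_swap[OF a] by (simp add: o_def eval2_swap_poly)
  qed
  then obtain B' where B': "\<And>K L. (\<Sum>l<K. (real l)\<^sup>2 * (\<Sum>k<L. (norm (a (k, l)))\<^sup>2)) \<le> B'" by auto
  show ?thesis
  proof (rule in_l2_bounded_sums(1))
    fix S :: "(nat \<times> nat) set" assume "finite S"
    then obtain K where K: "S \<subseteq> {..<K} \<times> {..<K}" by (rule finite_subset_square)
    let ?T = "{..<Suc K} \<times> {..<Suc K}"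
    have w: "wt 2 L \<le> 18 * (real (fst L))\<^sup>2 + 18 * (real (snd L))\<^sup>2 + (if L = (0, 0) then 4 else 0)" for L
    proof (cases "L = (0, 0)")
      case False
      then have "fst L + snd L \<ge> 1" by (cases L) auto
      then have "real 1 \<le> real (fst L + snd L)" by (simp only: of_nat_le_iff)
      then have "real (fst L + snd L) + 2 \<le> 3 * real (fst L + snd L)" by simp
      then have "(real (fst L + snd L) + 2)\<^sup>2 \<le> (3 * real (fst L + snd L))\<^sup>2" by (intro power_mono) auto
      also have "\<dots> \<le> 18 * (real (fst L))\<^sup>2 + 18 * (real (snd L))\<^sup>2"
        using sum_squares_bound[of "real (fst L)" "real (snd L)"]
        by (simp add: power2_eq_square algebra_simps)
      finally show ?thesis using False by (simp add: wt_def)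
    qed (simp add: wt_def)
    have "(\<Sum>L\<in>S. (norm (a L))\<^sup>2 * wt 2 L) \<le> (\<Sum>L\<in>?T. (norm (a L))\<^sup>2 * wt 2 L)"
      by (intro sum_mono2) (use K in auto)
    also have "\<dots> \<le> (\<Sum>L\<in>?T. (norm (a L))\<^sup>2 * (18 * (real (fst L))\<^sup>2 + 18 * (real (snd L))\<^sup>2 + (if L = (0, 0) then 4 else 0)))"
      by (intro sum_mono mult_left_mono w) auto
    also have "\<dots> = 18 * (\<Sum>L\<in>?T. (real (fst L))\<^sup>2 * (norm (a L))\<^sup>2) + 18 * (\<Sum>L\<in>?T. (real (snd L))\<^sup>2 * (norm (a L))\<^sup>2)
        + (\<Sum>L\<in>?T. if L = (0, 0) then 4 * (norm (a (0, 0)))\<^sup>2 else 0)"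
      unfolding sum_distrib_left sum.distrib[symmetric] by (intro sum.cong refl) (auto simp: algebra_simps)
    also have "(\<Sum>L\<in>?T. if L = (0, 0) then 4 * (norm (a (0, 0)))\<^sup>2 else 0) = 4 * (norm (a (0, 0)))\<^sup>2"
      by (subst sum.delta) auto
    also have "(\<Sum>L\<in>?T. (real (fst L))\<^sup>2 * (norm (a L))\<^sup>2) = (\<Sum>k<Suc K. (real k)\<^sup>2 * (\<Sum>l<Suc K. (norm (a (k, l)))\<^sup>2))"
      unfolding sum_square sum_distrib_left by simp
    also have "(\<Sum>L\<in>?T. (real (snd L))\<^sup>2 * (norm (a L))\<^sup>2) = (\<Sum>l<Suc K. (real l)\<^sup>2 * (\<Sum>k<Suc K. (norm (a (k, l)))\<^sup>2))"
      unfolding sum_square sum_distrib_left by (subst sum.swap) simp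
    finally show "(\<Sum>L\<in>S. (norm (a L))\<^sup>2 * wt 2 L) \<le> 18 * B + 18 * B' + 4 * (norm (a (0, 0)))\<^sup>2"
      using B[of "Suc K" "Suc K"] B'[of "Suc K" "Suc K"] by linarith
  qed
qed

text \<open>
  The power of g is f times the array of \<open>g ^ M / f\<close>, which even lies in the space for
  \<open>\<beta> = 2\<close>. The factors of g are cyclic for \<open>\<beta> = 3 / 2\<close>.
\<close>
lemma in_closure_if_finite_torus_zeros:
  assumes nz: "\<And>z. z \<in> bidisk \<Longrightarrow> eval2 f z \<noteq> 0" and fin: "finite (zero_set f \<inter> torus2)"
  shows "in_closure (3 / 2) f (pcoef 1)"
proof -
  define lf where "lf \<zeta> = [:[:2, - cnj (fst \<zeta>):], [:- cnj (snd \<zeta>):]:]" for \<zeta> :: "complex \<times> complex"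
  define g where "g = (\<Prod>\<zeta>\<in>zero_set f \<inter> torus2. lf \<zeta>)"
  have l0: "eval2 (lf \<zeta>) \<zeta> = 0" if "\<zeta> \<in> torus2" for \<zeta>
  proof -
    have "cnj v * v = 1" if "norm v = 1" for v :: complex
      using that by (simp add: complex_norm_square[symmetric] mult.commute[of "cnj v"])
    then show ?thesis using that by (auto simp: lf_def eval2_def torus2_def mult.commute)
  qed
  have g0: "eval2 g \<zeta> = 0" if "\<zeta> \<in> zero_set f \<inter> torus2" for \<zeta>
    unfolding g_def eval2_prod by (rule prod_zero[OF fin]) (use that l0 in blast)
  obtain N C where dom: "\<And>\<rho> z. \<lbrakk>0 < \<rho>; \<rho> < 1; z \<in> torus2\<rbrakk> \<Longrightarrow>
      norm (eval2 g (of_real \<rho> * fst z, of_real \<rho> * snd z)) ^ N \<le> C * norm (eval2 f (of_real \<rho> * fst z, of_real \<rho> * snd z))"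
    using radial_domination[OF nz fin g0] by blast
  define M where "M = 2 * N + 1"
  obtain b where b: "has_expansion b (\<lambda>z. 1 / eval2 f z)" using has_expansion_inverse[OF nz] by blast
  define u where "u = pmul (g ^ M) b"
  have u: "has_expansion u (\<lambda>z. eval2 g z ^ M / eval2 f z)"
    using has_expansion_pmul[OF b, of "g ^ M"] by (simp add: u_def)
  have ul2: "in_l2 2 u" by (rule in_l2_quotient[OF nz dom u[unfolded M_def]])
  have "pmul f u = pcoef (g ^ M)"
  proof (rule has_expansion_unique)
    show "has_expansion (pmul f u) (eval2 (g ^ M))"
      using has_expansion_pmul[OF u, of f] nz by (auto simp: has_expansion_def)
  qed (rule has_expansion_eval2)
  then have "in_closure 2 f (pcoef (g ^ M))" using in_closure_pmul[OF ul2, of f] by simp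
  then have "in_closure (3 / 2) f (pcoef (g ^ M))" by (rule in_closure_antimono) simp
  moreover have "in_closure (3 / 2) (g ^ M) (pcoef 1)"
    unfolding g_def lf_def
    by (intro in_closure_power in_closure_prod in_closure_linear_factor) (auto simp: torus2_def)
  ultimately show ?thesis by (rule in_closure_trans[rotated])
qed

section \<open>Cyclic polynomials\<close>

theorem theorem31:
  fixes f :: "complex poly poly"
  assumes nonvanishing: "zero_set f \<inter> bidisk = {}"
  shows
    "(finite (zero_set f \<inter> torus2) \<and> zero_set f \<inter> torus2 \<noteq> {} \<longrightarrow>
        (\<forall>\<beta>::real. \<beta> \<le> 3 / 2 \<longrightarrow> cyclic \<beta> (eval2 f)) \<and>
        (\<forall>\<beta>::real. \<beta> > 2 \<longrightarrow> \<not> cyclic \<beta> (eval2 f)))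
     \<and> (real_dim (zero_set f \<inter> torus2) = 1 \<longrightarrow>
        (\<forall>\<beta>::real. cyclic \<beta> (eval2 f) \<longleftrightarrow> \<beta> \<le> 1))
     \<and> (\<forall>\<beta>::real. \<beta> > 2 \<longrightarrow>
        (cyclic \<beta> (eval2 f) \<longleftrightarrow> zero_set f \<inter> closed_bidisk = {}))"
proof -
  have nz: "eval2 f z \<noteq> 0" if "z \<in> bidisk" for z
    using nonvanishing that by (auto simp: zero_set_def)
  have boundary_zero: "\<not> in_closure \<beta> f (pcoef 1)" if "\<beta> > 2" "z \<in> zero_set f" "z \<in> closed_bidisk" for \<beta> z
    using not_in_closure_if_zero_in_closed_bidisk[OF that(1,3)] that(2) by (simp add: zero_set_def)
  show ?thesis
    unfolding cyclic_iff_in_closure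
  proof (intro conjI impI allI)
    fix \<beta> :: real
    assume "finite (zero_set f \<inter> torus2) \<and> zero_set f \<inter> torus2 \<noteq> {}" "\<beta> \<le> 3 / 2"
    then show "in_closure \<beta> f (pcoef 1)"
      using in_closure_antimono[OF in_closure_if_finite_torus_zeros[OF nz]] by blast
  next
    fix \<beta> :: real
    assume "finite (zero_set f \<inter> torus2) \<and> zero_set f \<inter> torus2 \<noteq> {}" "\<beta> > 2"
    then show "\<not> in_closure \<beta> f (pcoef 1)" using boundary_zero torus2_subset by blast
  next
    fix \<beta> :: real
    assume dim: "real_dim (zero_set f \<inter> torus2) = 1"
    show "in_closure \<beta> f (pcoef 1) \<longleftrightarrow> \<beta> \<le> 1"
    proof
      assume "in_closure \<beta> f (pcoef 1)"
      then show "\<beta> \<le> 1" using not_in_closure_if_real_dim_one[OF dim, of \<beta>] by linarith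
    qed (rule in_closure_antimono[OF in_closure_beta_one[OF nz]])
  next
    fix \<beta> :: real
    assume "\<beta> > 2"
    then show "in_closure \<beta> f (pcoef 1) \<longleftrightarrow> zero_set f \<inter> closed_bidisk = {}"
      using boundary_zero in_closure_if_nonvanishing_closed_bidisk[of f \<beta>] by blast
  qed
qed

end
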